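(* Let $\mathfrak C=\varinjlim\mathfrak C_n$, $\mathfrak C_n=\bigoplus_{0\le k<2^n}M_{q(n,k)}(\mathbb C)$, be the codimension-one ideal of $\mathfrak A$ obtained by erasing all vertices $(n,2^n)$ from the Bratteli diagram of $\mathfrak A$ (the Pascal triangle with memory). For $n\ge0$ let $p_{(n,0)}(X)=1$ and $p_{(n,k)}(X)=X^k+X^{-k}$ for $1\le k<2^n$, let $\mathcal P_n=\bigl\{\sum_{0\le k<2^n}c_kp_{(n,k)}:c_k\in\mathbb Z\bigr\}\subset\mathbb Z[X,X^{-1}]$, and let $\beta_n:\mathcal P_n\to\mathcal P_{n+1}$ be the injective group morphism $$(\beta_n(p))(X)=(X^{-1}+1+X)\,p(X^2).$$ Then there is a group isomorphism from $K_0(\mathfrak C)$ onto $\mathcal P=\varinjlim(\mathcal P_n,\beta_n)$ which maps $[e_{(n,k)}]$ to the class $[p_{(n,k)}]$ of $p_{(n,k)}\in\mathcal P_n$ for all $n\ge0$, $0\le k<2^n$. Under this isomorphism, for $p\in\mathcal P_n$ the class $[p]$ belongs to the image of the positive cone $K_0(\mathfrak C)^+$ if and only if $p(X)$ has nonnegative coefficients.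
   Context: The Pascal triangle with memory is the graph with vertices $(n,k)$, $n\ge 0$, $0\le k\le 2^n$ (floor $n$), with a single edge joining $(n,k)$ to $(n+1,\ell)$ exactly when $|2k-\ell|\le 1$, and no other edges. Integers $q(n,k)$ are defined by $q(n,0)=q(n,2^n)=1$, $q(n+1,2k)=q(n,k)$ for $0\le k\le 2^n$, and $q(n+1,2k+1)=q(n,k)+q(n,k+1)$ for $0\le k<2^n$. $\mathfrak A=\varinjlim\mathfrak A_n$ is the AF algebra with $\mathfrak A_n=\bigoplus_{0\le k\le 2^n}M_{q(n,k)}(\mathbb C)$ and unital embeddings given by this graph regarded as a Bratteli diagram (multiplicity one for each edge); $\mathfrak C_n\hookrightarrow\mathfrak C_{n+1}$ is the restriction of $\mathfrak A_n\hookrightarrow\mathfrak A_{n+1}$, so its multiplicities are given by the edges between vertices $(n,k)$, $0\le k<2^n$, and $(n+1,\ell)$, $0\le\ell<2^{n+1}$. $[e_{(n,k)}]\in K_0(\mathfrak C)$ is the class of a minimal projection of the summand $M_{q(n,k)}(\mathbb C)$ of $\mathfrak C_n$. *)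

theory Defs
  imports
    "HOL-Analysis.Elementary_Normed_Spaces"
    "HOL-Algebra.Coset"
    "HOL-Library.FuncSet"
    "HOL-Library.Poly_Mapping"
    "Jordan_Normal_Form.Matrix"
begin

section \<open>Complex *-algebras and C*-algebras\<close>

class star_ring = ring +
  fixes star :: "'a \<Rightarrow> 'a"
  assumes star_add: "star (x + y) = star x + star y"
    and star_mult: "star (x * y) = star y * star x"
    and star_star: "star (star x) = x"

class complex_star_algebra = star_ring +
  fixes scaleC :: "complex \<Rightarrow> 'a \<Rightarrow> 'a"  (infixr \<open>*\<^sub>C\<close> 75)
  assumes scaleC_add_right: "c *\<^sub>C (x + y) = c *\<^sub>C x + c *\<^sub>C y"
    and scaleC_add_left: "(c + d) *\<^sub>C x = c *\<^sub>C x + d *\<^sub>C x"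
    and scaleC_scaleC: "c *\<^sub>C (d *\<^sub>C x) = (c * d) *\<^sub>C x"
    and scaleC_one: "1 *\<^sub>C x = x"
    and scaleC_mult_left: "(c *\<^sub>C x) * y = c *\<^sub>C (x * y)"
    and scaleC_mult_right: "x * (c *\<^sub>C y) = c *\<^sub>C (x * y)"
    and star_scaleC: "star (c *\<^sub>C x) = cnj c *\<^sub>C star x"

class cstar_algebra = complex_star_algebra + real_normed_algebra + complete_space +
  assumes scaleR_scaleC: "r *\<^sub>R x = complex_of_real r *\<^sub>C x"
    and norm_scaleC: "norm (c *\<^sub>C x) = cmod c * norm x"
    and norm_star_mult: "norm (star x * x) = (norm x)\<^sup>2"

instantiation complex :: complex_star_algebra
begin
definition star_complex :: "complex \<Rightarrow> complex" where "star_complex = cnj"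
definition scaleC_complex :: "complex \<Rightarrow> complex \<Rightarrow> complex" where "scaleC_complex = (*)"
instance by standard (simp_all add: star_complex_def scaleC_complex_def algebra_simps)
end

instance complex :: cstar_algebra
  by standard (simp_all add: star_complex_def scaleC_complex_def scaleR_conv_of_real norm_mult
      power2_eq_square)

definition is_projection :: "'a::star_ring \<Rightarrow> bool" where
  "is_projection e \<longleftrightarrow> e * e = e \<and> star e = e"

definition minimal_projection :: "'a::star_ring set \<Rightarrow> 'a \<Rightarrow> bool" where
  "minimal_projection B e \<longleftrightarrow> e \<in> B \<and> is_projection e \<and> e \<noteq> 0 \<and>
     (\<forall>f\<in>B. is_projection f \<and> f * e = f \<longrightarrow> f = 0 \<or> f = e)"

definition closed_ideal :: "'a::cstar_algebra set \<Rightarrow> bool" where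
  "closed_ideal I \<longleftrightarrow> closed I \<and> 0 \<in> I \<and> (\<forall>x\<in>I. \<forall>y\<in>I. x + y \<in> I) \<and> (\<forall>c. \<forall>x\<in>I. c *\<^sub>C x \<in> I) \<and>
     (\<forall>a. \<forall>x\<in>I. a * x \<in> I \<and> x * a \<in> I)"

definition codimension_one :: "'a::complex_star_algebra set \<Rightarrow> bool" where
  "codimension_one I \<longleftrightarrow> (\<exists>u. u \<notin> I \<and> (\<forall>a. \<exists>c. a - c *\<^sub>C u \<in> I))"


section \<open>Unitization\<close>

text \<open>Only the *-algebra structure is needed, since Murray-von Neumann equivalence of projections
  does not refer to the norm.\<close>

datatype 'a unitization = Unitization (ideal_part: 'a) (scalar_part: complex)

instantiation unitization :: (complex_star_algebra) "{ring_1, complex_star_algebra}"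
begin
definition "0 = Unitization 0 0"
definition "1 = Unitization 0 1"
definition "x + y = Unitization (ideal_part x + ideal_part y) (scalar_part x + scalar_part y)"
definition "x - y = Unitization (ideal_part x - ideal_part y) (scalar_part x - scalar_part y)"
definition "- x = Unitization (- ideal_part x) (- scalar_part x)"
definition "x * y = Unitization
  (ideal_part x * ideal_part y + scalar_part x *\<^sub>C ideal_part y + scalar_part y *\<^sub>C ideal_part x)
  (scalar_part x * scalar_part y)"
definition "star x = Unitization (star (ideal_part x)) (cnj (scalar_part x))"
definition "c *\<^sub>C x = Unitization (c *\<^sub>C ideal_part x) (c * scalar_part x)"
instance
proof -
  have z: "(0::complex) *\<^sub>C y = 0" for y :: 'a
    using scaleC_add_left[of 0 0 y] by simp
  have r: "c *\<^sub>C (0::'a) = 0" for c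
    using scaleC_add_right[of c 0 "0::'a"] by simp
  note defs = zero_unitization_def one_unitization_def plus_unitization_def minus_unitization_def
    uminus_unitization_def times_unitization_def star_unitization_def scaleC_unitization_def
  show "OFCLASS('a unitization, ring_1_class)"
    by standard (simp_all add: defs z r scaleC_one algebra_simps scaleC_add_right scaleC_add_left
        scaleC_mult_left scaleC_mult_right scaleC_scaleC)
  show "OFCLASS('a unitization, complex_star_algebra_class)"
    by standard (simp_all add: defs algebra_simps scaleC_add_right scaleC_add_left scaleC_one
        scaleC_mult_left scaleC_mult_right scaleC_scaleC star_add star_mult star_star star_scaleC)
qed
end

definition unitize :: "'a set \<Rightarrow> 'a unitization set" where
  "unitize C = {x. ideal_part x \<in> C}"


section \<open>K-theory\<close>

definition adj :: "'a::star_ring mat \<Rightarrow> 'a mat" where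
  "adj A = map_mat star (transpose_mat A)"

definition dsum :: "'a::zero mat \<Rightarrow> 'a mat \<Rightarrow> 'a mat"  (infixr \<open>\<boxplus>\<close> 65) where
  "p \<boxplus> q = four_block_mat p (0\<^sub>m (dim_row p) (dim_col q)) (0\<^sub>m (dim_row q) (dim_col p)) q"

definition projs :: "'a::star_ring set \<Rightarrow> 'a mat set" where
  "projs S = {p. square_mat p \<and> elements_mat p \<subseteq> S \<and> p * p = p \<and> adj p = p}"

text \<open>Murray-von Neumann equivalence of projections of possibly different sizes, implemented by a
  rectangular partial isometry.\<close>

definition mvn :: "'a::star_ring set \<Rightarrow> 'a mat \<Rightarrow> 'a mat \<Rightarrow> bool" where
  "mvn S p q \<longleftrightarrow> (\<exists>v \<in> carrier_mat (dim_row q) (dim_row p).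
      elements_mat v \<subseteq> S \<and> adj v * v = p \<and> v * adj v = q)"

text \<open>\<open>K0_unital S\<close> is the Grothendieck group of the semigroup of equivalence classes of
  projections over the unital *-subalgebra \<open>S\<close>; the pair \<open>(p, q)\<close> stands for \<open>[p] - [q]\<close>.\<close>

definition K0_rel :: "'a::star_ring set \<Rightarrow> (('a mat \<times> 'a mat) \<times> ('a mat \<times> 'a mat)) set" where
  "K0_rel S = {((p, q), (p', q')). p \<in> projs S \<and> q \<in> projs S \<and> p' \<in> projs S \<and> q' \<in> projs S \<and>
      (\<exists>r \<in> projs S. mvn S (p \<boxplus> q' \<boxplus> r) (p' \<boxplus> q \<boxplus> r))}"

definition K0_diff :: "'a::star_ring set \<Rightarrow> 'a mat \<Rightarrow> 'a mat \<Rightarrow> ('a mat \<times> 'a mat) set" where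
  "K0_diff S p q = K0_rel S `` {(p, q)}"

definition K0_unital :: "'a::star_ring set \<Rightarrow> ('a mat \<times> 'a mat) set monoid" where
  "K0_unital S = \<lparr>carrier = (projs S \<times> projs S) // K0_rel S,
     monoid.mult = (\<lambda>X Y. \<Union>(p, q)\<in>X. \<Union>(p', q')\<in>Y. K0_diff S (p \<boxplus> p') (q \<boxplus> q')),
     one = K0_diff S (0\<^sub>m 0 0) (0\<^sub>m 0 0)\<rparr>"

definition K0_map :: "'b::star_ring set \<Rightarrow> ('a::star_ring \<Rightarrow> 'b) \<Rightarrow>
    ('a mat \<times> 'a mat) set \<Rightarrow> ('b mat \<times> 'b mat) set" where
  "K0_map T f X = (\<Union>(p, q)\<in>X. K0_diff T (map_mat f p) (map_mat f q))"

text \<open>For a *-algebra \<open>C\<close> that need not have a unit, the group is the kernel of the map induced by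
  the canonical character of the unitization.\<close>

definition K0 :: "'a::complex_star_algebra set \<Rightarrow>
    ('a unitization mat \<times> 'a unitization mat) set monoid" where
  "K0 C = (K0_unital (unitize C))
     \<lparr>carrier := kernel (K0_unital (unitize C)) (K0_unital UNIV) (K0_map UNIV scalar_part)\<rparr>"

definition K0_class :: "'a::complex_star_algebra set \<Rightarrow> 'a mat \<Rightarrow>
    ('a unitization mat \<times> 'a unitization mat) set" where
  "K0_class C p = K0_diff (unitize C) (map_mat (\<lambda>a. Unitization a 0) p) (0\<^sub>m 0 0)"

definition K0_positive :: "'a::complex_star_algebra set \<Rightarrow>
    ('a unitization mat \<times> 'a unitization mat) set set" where
  "K0_positive C = K0_class C ` projs C"


section \<open>Sequential direct limits of groups\<close>

fun shift :: "(nat \<Rightarrow> 'g \<Rightarrow> 'g) \<Rightarrow> nat \<Rightarrow> nat \<Rightarrow> 'g \<Rightarrow> 'g" where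
  "shift f m 0 x = x"
| "shift f m (Suc d) x = f (m + d) (shift f m d x)"

definition dirlim_rel :: "(nat \<Rightarrow> 'g monoid) \<Rightarrow> (nat \<Rightarrow> 'g \<Rightarrow> 'g) \<Rightarrow> ((nat \<times> 'g) \<times> (nat \<times> 'g)) set" where
  "dirlim_rel G f = {((m, x), (n, y)). x \<in> carrier (G m) \<and> y \<in> carrier (G n) \<and>
      (\<exists>N. m \<le> N \<and> n \<le> N \<and> shift f m (N - m) x = shift f n (N - n) y)}"

definition dirlim_class :: "(nat \<Rightarrow> 'g monoid) \<Rightarrow> (nat \<Rightarrow> 'g \<Rightarrow> 'g) \<Rightarrow> nat \<Rightarrow> 'g \<Rightarrow> (nat \<times> 'g) set" where
  "dirlim_class G f n x = dirlim_rel G f `` {(n, x)}"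

definition dirlim :: "(nat \<Rightarrow> 'g monoid) \<Rightarrow> (nat \<Rightarrow> 'g \<Rightarrow> 'g) \<Rightarrow> (nat \<times> 'g) set monoid" where
  "dirlim G f = \<lparr>carrier = (SIGMA n:UNIV. carrier (G n)) // dirlim_rel G f,
     monoid.mult = (\<lambda>X Y. \<Union>(m, x)\<in>X. \<Union>(n, y)\<in>Y.
        dirlim_class G f (max m n)
          (shift f m (max m n - m) x \<otimes>\<^bsub>G (max m n)\<^esub> shift f n (max m n - n) y)),
     one = dirlim_class G f 0 \<one>\<^bsub>G 0\<^esub>\<rparr>"


section \<open>The Pascal triangle with memory\<close>

definition edge :: "nat \<Rightarrow> nat \<Rightarrow> bool" where
  "edge k l \<longleftrightarrow> \<bar>2 * int k - int l\<bar> \<le> 1"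

text \<open>The values \<open>q n k\<close> with \<open>k > 2 ^ n\<close> are junk.\<close>

fun q :: "nat \<Rightarrow> nat \<Rightarrow> nat" where
  "q 0 k = 1"
| "q (Suc n) k = (if even k then q n (k div 2) else q n (k div 2) + q n (k div 2 + 1))"

lemma q_equations:
  "q n 0 = 1"
  "q n (2 ^ n) = 1"
  "q (Suc n) (2 * k) = q n k"
  "q (Suc n) (2 * k + 1) = q n k + q n (k + 1)"
  by (induction n) auto

text \<open>Elements of the finite-dimensional algebra on floor \<open>n\<close> are families of matrices, with pointwise
  operations.\<close>

definition floor_alg :: "nat \<Rightarrow> (nat \<Rightarrow> complex mat) set" where
  "floor_alg n = (\<Pi>\<^sub>E k\<in>{..2 ^ n}. carrier_mat (q n k) (q n k))"

definition floor_ideal :: "nat \<Rightarrow> (nat \<Rightarrow> complex mat) set" where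
  "floor_ideal n = {x \<in> floor_alg n. x (2 ^ n) = 0\<^sub>m (q n (2 ^ n)) (q n (2 ^ n))}"

definition summand :: "nat \<Rightarrow> nat \<Rightarrow> (nat \<Rightarrow> complex mat) set" where
  "summand n k = {x \<in> floor_alg n. \<forall>j\<le>2 ^ n. j \<noteq> k \<longrightarrow> x j = 0\<^sub>m (q n j) (q n j)}"

definition embed :: "nat \<Rightarrow> (nat \<Rightarrow> complex mat) \<Rightarrow> (nat \<Rightarrow> complex mat)" where
  "embed n x = (\<lambda>l\<in>{..2 ^ Suc n}.
     diag_block_mat (map x (filter (\<lambda>k. edge k l) [0..<Suc (2 ^ n)])))"

text \<open>The C*-algebra \<open>'a\<close> is the inductive limit of the system given by \<open>floor_alg\<close> and \<open>embed\<close>: the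
  maps \<open>\<iota> n\<close> are compatible injective unital *-homomorphisms, and the union of their ranges is dense.\<close>

locale pascal_limit =
  fixes \<iota> :: "nat \<Rightarrow> (nat \<Rightarrow> complex mat) \<Rightarrow> 'a::{cstar_algebra, real_normed_algebra_1}"
  assumes add: "\<And>n x y. x \<in> floor_alg n \<Longrightarrow> y \<in> floor_alg n \<Longrightarrow>
      \<iota> n (\<lambda>k\<in>{..2 ^ n}. x k + y k) = \<iota> n x + \<iota> n y"
    and scale: "\<And>n c x. x \<in> floor_alg n \<Longrightarrow> \<iota> n (\<lambda>k\<in>{..2 ^ n}. c \<cdot>\<^sub>m x k) = c *\<^sub>C \<iota> n x"
    and mult: "\<And>n x y. x \<in> floor_alg n \<Longrightarrow> y \<in> floor_alg n \<Longrightarrow>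
      \<iota> n (\<lambda>k\<in>{..2 ^ n}. x k * y k) = \<iota> n x * \<iota> n y"
    and star: "\<And>n x. x \<in> floor_alg n \<Longrightarrow> \<iota> n (\<lambda>k\<in>{..2 ^ n}. adj (x k)) = star (\<iota> n x)"
    and unit: "\<And>n. \<iota> n (\<lambda>k\<in>{..2 ^ n}. 1\<^sub>m (q n k)) = 1"
    and inj: "\<And>n. inj_on (\<iota> n) (floor_alg n)"
    and compatible: "\<And>n x. x \<in> floor_alg n \<Longrightarrow> \<iota> (Suc n) (embed n x) = \<iota> n x"
    and dense: "closure (\<Union>n. \<iota> n ` floor_alg n) = UNIV"

text \<open>The subalgebra obtained by erasing the vertices \<open>(n, 2 ^ n)\<close>.\<close>

definition limit_ideal :: "(nat \<Rightarrow> (nat \<Rightarrow> complex mat) \<Rightarrow> 'a::cstar_algebra) \<Rightarrow> 'a set" where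
  "limit_ideal \<iota> = closure (\<Union>n. \<iota> n ` floor_ideal n)"


section \<open>Laurent polynomials\<close>

text \<open>Finitely supported functions on the integers, with convolution product, are the Laurent
  polynomials; \<open>Poly_Mapping.lookup p j\<close> is the coefficient of \<open>X ^ j\<close>.\<close>

type_synonym laurent = "int \<Rightarrow>\<^sub>0 int"

definition X_pow :: "int \<Rightarrow> laurent" where
  "X_pow j = Poly_Mapping.single j 1"

definition subst_square :: "laurent \<Rightarrow> laurent" where
  "subst_square p = (\<Sum>j\<in>Poly_Mapping.keys p. of_int (Poly_Mapping.lookup p j) * X_pow (2 * j))"

definition p_poly :: "nat \<Rightarrow> nat \<Rightarrow> laurent" where
  "p_poly n k = (if k = 0 then 1 else X_pow (int k) + X_pow (- int k))"

definition P_group :: "nat \<Rightarrow> laurent monoid" where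
  "P_group n = \<lparr>carrier = {\<Sum>k<2 ^ n. of_int (c k) * p_poly n k |c. True}, monoid.mult = (+), one = 0\<rparr>"

definition beta :: "nat \<Rightarrow> laurent \<Rightarrow> laurent" where
  "beta n p = (X_pow (-1) + 1 + X_pow 1) * subst_square p"

end

theory Submission
  imports Defs
begin

text \<open>Floor \<open>n + 1\<close> contains the summand \<open>(n, k)\<close> unchanged as the summand \<open>(n + 1, 2 * k)\<close>, so each
  dyadic number \<open>k / 2 ^ n\<close> carries a finite-dimensional representation of the whole algebra, whose
  trace is bounded because matrix entries are compressions by matrix units of norm one. These
  countably many traces form a complete invariant of projections over \<open>'a\<close>: a Newton--Schulz
  iteration replaces any projection by an equivalent one in a finite stage, where projections are
  classified by their traces. The ideal is the kernel of the character at the dyadic number 1, so its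
  unitization is \<open>'a\<close> itself, and its \<open>K0\<close> becomes a group of integer functions on the dyadic numbers.
  The coefficients of a Laurent polynomial, followed along \<open>beta\<close>, obey the same recursion
  \<open>f (n + 1, 2 * k) = f (n, k)\<close>, \<open>f (n + 1, 2 * k + 1) = f (n, k) + f (n, k + 1)\<close>, which identifies the
  direct limit with the same group of functions.\<close>

section \<open>Matrices over star rings\<close>

text \<open>The obstacle is that an approximant of a projection in a finite stage is no longer a
  projection. Polar parts repair this, and the iteration reaches them by addition, multiplication,
  adjoint and halving alone, so it stays in any closed star subring with halves, under a crude
  submultiplicative norm. It is run not near the projection \<open>p\<close>, for which no exact
  target in the stage is known, but near the symmetry \<open>2 p - 1\<close>, whose initial and
  final projection is the unit.

  Traces are natural numbers because rank-one pieces split off one at a time; the same splitting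
  makes equal traces imply equivalence. The even rule holds for all traces, the odd rule only from
  the floor on which a projection lives, so the functions in question obey the recursion from some
  floor \<open>n\<close> on and are determined by their values there. Value 0 at the dyadic number 1
  corresponds to the missing coefficient at \<open>X ^ (2 ^ n)\<close>, and symmetry of the
  polynomials takes care of negative exponents. Nonnegativity passes from floor \<open>n\<close> to
  all others because every new value is a sum of two old ones.\<close>

lemma star_zero [simp]: "star (0::'a::star_ring) = 0"
  using star_add[of "0::'a" 0] by simp

lemma star_uminus [simp]: "star (- x::'a::star_ring) = - star x"
  using star_add[of x "- x"] by (simp add: eq_neg_iff_add_eq_0 add.commute)

lemma star_diff: "star (x - y::'a::star_ring) = star x - star y"
  using star_add[of x "- y"] by simp

lemma star_sum: "star (sum f A) = (\<Sum>i\<in>A. star (f i :: 'a::star_ring))"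
  by (induction A rule: infinite_finite_induct) (simp_all add: star_add)

lemma index_mult_mat_sum:
  assumes "A \<in> carrier_mat m n" "B \<in> carrier_mat n k" "i < m" "j < k"
  shows "(A * B) $$ (i, j) = (\<Sum>l<n. A $$ (i, l) * B $$ (l, j))"
  using assms by (simp add: scalar_prod_def atLeast0LessThan)

lemma dim_adj [simp]: "dim_row (adj A) = dim_col A" "dim_col (adj A) = dim_row A"
  by (simp_all add: adj_def)

lemma adj_carrier [simp]: "adj A \<in> carrier_mat m n \<longleftrightarrow> A \<in> carrier_mat n m"
  unfolding carrier_mat_def by auto

lemma index_adj [simp]: "i < dim_col A \<Longrightarrow> j < dim_row A \<Longrightarrow> adj A $$ (i, j) = star (A $$ (j, i))"
  by (simp add: adj_def)

lemma adj_adj [simp]: "adj (adj A) = A"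
  by (rule eq_matI) (simp_all add: star_star)

lemma adj_zero [simp]: "adj (0\<^sub>m m n :: 'a::star_ring mat) = 0\<^sub>m n m"
  by (rule eq_matI) simp_all

lemma adj_mult:
  assumes "A \<in> carrier_mat m n" "B \<in> carrier_mat n k"
  shows "adj (A * B) = adj B * adj A"
proof (rule eq_matI)
  fix i j assume "i < dim_row (adj B * adj A)" "j < dim_col (adj B * adj A)"
  then have ij: "i < k" "j < m" using assms by auto
  have "adj (A * B) $$ (i, j) = star ((A * B) $$ (j, i))"
    using assms ij by simp
  also have "\<dots> = (\<Sum>l<n. star (A $$ (j, l) * B $$ (l, i)))"
    by (simp add: index_mult_mat_sum[OF assms ij(2,1)] star_sum)
  also have "\<dots> = (adj B * adj A) $$ (i, j)"
    using assms ij by (subst index_mult_mat_sum[of _ k n _ m]) (simp_all add: star_mult)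
  finally show "adj (A * B) $$ (i, j) = (adj B * adj A) $$ (i, j)" .
qed (use assms in auto)

lemma adj_add: "A \<in> carrier_mat m n \<Longrightarrow> B \<in> carrier_mat m n \<Longrightarrow> adj (A + B) = adj A + adj B"
  by (rule eq_matI) (auto simp: star_add)

lemma adj_minus: "A \<in> carrier_mat m n \<Longrightarrow> B \<in> carrier_mat m n \<Longrightarrow> adj (A - B) = adj A - adj B"
  by (rule eq_matI) (auto simp: star_diff)

section \<open>Star subrings, projections and Murray-von Neumann equivalence\<close>

definition star_subring :: "'a::star_ring set \<Rightarrow> bool" where
  "star_subring S \<longleftrightarrow> 0 \<in> S \<and> (\<forall>x\<in>S. \<forall>y\<in>S. x + y \<in> S \<and> x - y \<in> S \<and> x * y \<in> S) \<and> (\<forall>x\<in>S. star x \<in> S)"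

lemma star_subring_UNIV [simp]: "star_subring UNIV"
  by (simp add: star_subring_def)

lemma star_subring_sum:
  "star_subring S \<Longrightarrow> (\<And>i. i \<in> A \<Longrightarrow> f i \<in> S) \<Longrightarrow> sum f A \<in> S"
  by (induction A rule: infinite_finite_induct) (auto simp: star_subring_def)

lemma elements_mat_subset_iff:
  "elements_mat A \<subseteq> S \<longleftrightarrow> (\<forall>i<dim_row A. \<forall>j<dim_col A. A $$ (i, j) \<in> S)"
  by (auto simp: elements_mat_def UN_subset_iff image_subset_iff)

lemma elements_mat_mult:
  assumes "star_subring S" "A \<in> carrier_mat m n" "B \<in> carrier_mat n k"
    "elements_mat A \<subseteq> S" "elements_mat B \<subseteq> S"
  shows "elements_mat (A * B) \<subseteq> S"
  unfolding elements_mat_subset_iff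
proof (intro allI impI)
  fix i j assume "i < dim_row (A * B)" "j < dim_col (A * B)"
  then have ij: "i < m" "j < k" using assms by auto
  have "A $$ (i, l) * B $$ (l, j) \<in> S" if "l < n" for l
    using assms ij that unfolding elements_mat_subset_iff star_subring_def by auto
  then show "(A * B) $$ (i, j) \<in> S"
    unfolding index_mult_mat_sum[OF assms(2,3) ij] by (intro star_subring_sum[OF assms(1)]) simp
qed

lemma elements_mat_adj: "star_subring S \<Longrightarrow> elements_mat A \<subseteq> S \<Longrightarrow> elements_mat (adj A) \<subseteq> S"
  by (auto simp: elements_mat_subset_iff star_subring_def)

lemma elements_mat_add:
  "star_subring S \<Longrightarrow> A \<in> carrier_mat m n \<Longrightarrow> B \<in> carrier_mat m n \<Longrightarrow>
    elements_mat A \<subseteq> S \<Longrightarrow> elements_mat B \<subseteq> S \<Longrightarrow> elements_mat (A + B) \<subseteq> S"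
  by (auto simp: elements_mat_subset_iff star_subring_def)

lemma elements_mat_minus:
  "star_subring S \<Longrightarrow> A \<in> carrier_mat m n \<Longrightarrow> B \<in> carrier_mat m n \<Longrightarrow>
    elements_mat A \<subseteq> S \<Longrightarrow> elements_mat B \<subseteq> S \<Longrightarrow> elements_mat (A - B) \<subseteq> S"
  by (auto simp: elements_mat_subset_iff star_subring_def)

lemma projsE:
  assumes "p \<in> projs S"
  obtains n where "p \<in> carrier_mat n n" "elements_mat p \<subseteq> S" "p * p = p" "adj p = p"
  using assms that[of "dim_row p"] unfolding projs_def by (auto intro!: carrier_matI)

lemma projsI:
  "p \<in> carrier_mat n n \<Longrightarrow> elements_mat p \<subseteq> S \<Longrightarrow> p * p = p \<Longrightarrow> adj p = p \<Longrightarrow> p \<in> projs S"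
  unfolding projs_def by auto

lemma projs_mono: "S \<subseteq> T \<Longrightarrow> projs S \<subseteq> projs T"
  unfolding projs_def by auto

lemma zero_in_projs: "0 \<in> S \<Longrightarrow> 0\<^sub>m n n \<in> projs S"
  unfolding projs_def by (auto dest: subsetD[OF elements_0_mat])

lemma mvn_sym: "star_subring S \<Longrightarrow> mvn S p r \<Longrightarrow> mvn S r p"
  unfolding mvn_def
  by (erule bexE, rule_tac x = "adj v" in bexI) (simp_all add: elements_mat_adj)

text \<open>Replacing \<open>v\<close> by \<open>v v\<^sup>* v\<close> makes the initial and final projections act trivially without
  an appeal to the C*-identity for matrices.\<close>

lemma mvn_strong:
  assumes S: "star_subring S" and p: "p \<in> projs S" "p \<in> carrier_mat n n"
    and r: "r \<in> projs S" "r \<in> carrier_mat m m" and "mvn S p r"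
  obtains v where "v \<in> carrier_mat m n" "elements_mat v \<subseteq> S" "adj v * v = p" "v * adj v = r"
    "r * v = v" "v * p = v" "p * adj v = adj v" "adj v * r = adj v"
proof -
  obtain v where v: "v \<in> carrier_mat m n" "elements_mat v \<subseteq> S" "adj v * v = p" "v * adj v = r"
    using assms unfolding mvn_def by auto
  have av: "adj v \<in> carrier_mat n m" using v by simp
  have pp: "p * p = p" "adj p = p" and rr: "r * r = r" "adj r = r"
    using p r by (auto simp: projs_def)
  define w where "w = v * p"
  have w: "w \<in> carrier_mat m n" using v p by (simp add: w_def)
  \<comment> \<open>Both \<open>v * p\<close> and \<open>r * v\<close> are bracketings of
    \<open>v * adj v * v\<close>.\<close>
  have w2: "w = r * v"
    using assoc_mult_mat[OF v(1) av v(1)] v(3,4) by (simp add: w_def)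
  have aw: "adj w = p * adj v"
    using adj_mult[OF v(1) p(2)] by (simp add: w_def pp)
  have aw2: "adj w = adj v * r"
    using adj_mult[OF r(2) v(1)] by (simp add: w2 rr)
  have "adj w * w = p * (adj v * v) * p"
    unfolding aw unfolding w_def using v(1) av p(2) by (simp add: assoc_mult_mat[of _ n n _ n _ n]
        assoc_mult_mat[of _ n n _ m _ n] assoc_mult_mat[of _ n m _ n _ n])
  then have 1: "adj w * w = p" by (simp add: v pp)
  have "w * adj w = r * (v * adj v) * r"
    unfolding aw2 unfolding w2 using v(1) av r(2) by (simp add: assoc_mult_mat[of _ m m _ m _ m]
        assoc_mult_mat[of _ m m _ n _ m] assoc_mult_mat[of _ m n _ m _ m])
  then have 2: "w * adj w = r" by (simp add: v rr)
  have 3: "r * w = w" unfolding w2 using r v rr by (simp flip: assoc_mult_mat)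
  have 4: "w * p = w" unfolding w_def using p v pp by simp
  have 5: "p * adj w = adj w" using arg_cong[OF 4, of adj] adj_mult[OF w p(2)] by (simp add: pp)
  have 6: "adj w * r = adj w" using arg_cong[OF 3, of adj] adj_mult[OF r(2) w] by (simp add: rr)
  have 7: "elements_mat w \<subseteq> S"
    unfolding w_def by (rule elements_mat_mult[OF S v(1) p(2)]) (use v p in \<open>auto simp: projs_def\<close>)
  show ?thesis by (rule that[OF w 7 1 2 3 4 5 6])
qed

text \<open>The product \<open>w * v\<close> works because in their strong forms both partial
  isometries absorb \<open>r\<close>, so the middle factors \<open>adj w * w\<close> and
  \<open>v * adj v\<close>, both equal to \<open>r\<close>, disappear.\<close>

lemma mvn_trans:
  assumes S: "star_subring S" and "p \<in> projs S" "r \<in> projs S" "s \<in> projs S"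
    and "mvn S p r" "mvn S r s"
  shows "mvn S p s"
proof -
  obtain n where p: "p \<in> carrier_mat n n" using assms(2) by (rule projsE)
  obtain m where r: "r \<in> carrier_mat m m" using assms(3) by (rule projsE)
  obtain k where s: "s \<in> carrier_mat k k" using assms(4) by (rule projsE)
  obtain v where v: "v \<in> carrier_mat m n" "elements_mat v \<subseteq> S" "adj v * v = p" "v * adj v = r"
    "r * v = v" "adj v * r = adj v"
    using mvn_strong[OF S assms(2) p assms(3) r assms(5)] by metis
  obtain w where w: "w \<in> carrier_mat k m" "elements_mat w \<subseteq> S" "adj w * w = r" "w * adj w = s"
    "s * w = w" "w * r = w"
    using mvn_strong[OF S assms(3) r assms(4) s assms(6)] by metis
  have av: "adj v \<in> carrier_mat n m" and aw: "adj w \<in> carrier_mat m k" using v w by auto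
  have a: "adj (w * v) = adj v * adj w" by (rule adj_mult[OF w(1) v(1)])
  have "adj (w * v) * (w * v) = adj v * ((adj w * w) * v)"
    unfolding a using v(1) w(1) av aw
    by (simp add: assoc_mult_mat[of _ n m _ k _ n] assoc_mult_mat[of _ m k _ m _ n])
  then have 1: "adj (w * v) * (w * v) = p" by (simp add: w v)
  have "(w * v) * adj (w * v) = w * ((v * adj v) * adj w)"
    unfolding a using v(1) w(1) av aw
    by (simp add: assoc_mult_mat[of _ k m _ n _ k] assoc_mult_mat[of _ m n _ m _ k])
  then have 2: "(w * v) * adj (w * v) = s"
    using assoc_mult_mat[OF w(1) r aw] by (simp add: v(4) w(4,6))
  show ?thesis
    unfolding mvn_def using 1 2 p s v(1) w(1) elements_mat_mult[OF S w(1) v(1) w(2) v(2)]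
    by (intro bexI[of _ "w * v"]) auto
qed

section \<open>Direct sums of matrices\<close>

lemma dsum_carrier [simp]:
  "p \<in> carrier_mat m n \<Longrightarrow> r \<in> carrier_mat k l \<Longrightarrow> p \<boxplus> r \<in> carrier_mat (m + k) (n + l)"
  by (simp add: dsum_def)

lemma dim_dsum [simp]: "dim_row (p \<boxplus> r) = dim_row p + dim_row r" "dim_col (p \<boxplus> r) = dim_col p + dim_col r"
  by (simp_all add: dsum_def)

lemma adj_dsum: "adj (p \<boxplus> r) = adj p \<boxplus> adj r"
  by (rule eq_matI) (auto simp: dsum_def)

lemma mult_dsum:
  assumes "p \<in> carrier_mat m n" "p' \<in> carrier_mat n k" "r \<in> carrier_mat a b" "r' \<in> carrier_mat b c"
  shows "(p \<boxplus> r) * (p' \<boxplus> r') = (p * p') \<boxplus> (r * r')"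
  unfolding dsum_def using assms
  by (subst mult_four_block_mat[of _ m n _ b _ a _ _ k _ c]) auto

lemma elements_mat_dsum:
  assumes "0 \<in> S" "elements_mat p \<subseteq> S" "elements_mat r \<subseteq> S"
  shows "elements_mat (p \<boxplus> r) \<subseteq> S"
  using assms unfolding elements_mat_subset_iff by (auto simp: dsum_def)

lemma dsum_in_projs:
  assumes "0 \<in> S" "p \<in> projs S" "r \<in> projs S"
  shows "p \<boxplus> r \<in> projs S"
proof -
  obtain n where p: "p \<in> carrier_mat n n" using assms(2) by (rule projsE)
  obtain m where r: "r \<in> carrier_mat m m" using assms(3) by (rule projsE)
  show ?thesis
    using assms p r by (intro projsI[of _ "n + m"])
      (auto simp: projs_def mult_dsum[of _ n n _ n _ m m _ m] adj_dsum elements_mat_dsum)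
qed

section \<open>Star homomorphisms applied entrywise\<close>

definition star_hom :: "('a::star_ring \<Rightarrow> 'b::star_ring) \<Rightarrow> bool" where
  "star_hom f \<longleftrightarrow> (\<forall>x y. f (x + y) = f x + f y) \<and> (\<forall>x y. f (x * y) = f x * f y) \<and> (\<forall>x. f (star x) = star (f x))"

lemma star_hom_zero: "star_hom f \<Longrightarrow> f 0 = 0"
  unfolding star_hom_def by (metis add_cancel_right_right)

lemma star_hom_sum: "star_hom f \<Longrightarrow> f (sum g A) = (\<Sum>i\<in>A. f (g i))"
  by (induction A rule: infinite_finite_induct) (simp_all add: star_hom_zero, simp add: star_hom_def)

lemma map_mat_mult:
  assumes f: "star_hom f" and "A \<in> carrier_mat m n" "B \<in> carrier_mat n k"
  shows "map_mat f (A * B) = map_mat f A * map_mat f B"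
proof (rule eq_matI)
  fix i j assume "i < dim_row (map_mat f A * map_mat f B)" "j < dim_col (map_mat f A * map_mat f B)"
  then have ij: "i < m" "j < k" using assms by auto
  have "map_mat f (A * B) $$ (i, j) = (\<Sum>l<n. f (A $$ (i, l) * B $$ (l, j)))"
    using ij assms by (simp add: index_mult_mat_sum[OF assms(2,3)] star_hom_sum del: index_mult_mat(1))
  also have "\<dots> = (map_mat f A * map_mat f B) $$ (i, j)"
    using ij assms by (subst index_mult_mat_sum[of _ m n _ k]) (auto simp: star_hom_def)
  finally show "map_mat f (A * B) $$ (i, j) = (map_mat f A * map_mat f B) $$ (i, j)" .
qed (use assms in auto)

lemma map_mat_adj: "star_hom f \<Longrightarrow> map_mat f (adj A) = adj (map_mat f A)"
  by (rule eq_matI) (auto simp: star_hom_def)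

lemma map_mat_dsum: "star_hom f \<Longrightarrow> map_mat f (p \<boxplus> r) = map_mat f p \<boxplus> map_mat f r"
  by (rule eq_matI) (auto simp: dsum_def star_hom_zero)

lemma map_mat_projs:
  assumes f: "star_hom f" "f ` S \<subseteq> T" and p: "p \<in> projs S"
  shows "map_mat f p \<in> projs T"
proof -
  obtain n where "p \<in> carrier_mat n n" "elements_mat p \<subseteq> S" "p * p = p" "adj p = p"
    using p by (rule projsE)
  then show ?thesis
    using f map_mat_mult[OF f(1), of p n n p n] map_mat_adj[OF f(1), of p]
    by (intro projsI[of _ n]) auto
qed

lemma mvn_map_mat:
  assumes f: "star_hom f" "f ` S \<subseteq> T" and "mvn S p r"
  shows "mvn T (map_mat f p) (map_mat f r)"
proof -
  obtain v where v: "v \<in> carrier_mat (dim_row r) (dim_row p)" "elements_mat v \<subseteq> S"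
      "adj v * v = p" "v * adj v = r"
    using assms(3) unfolding mvn_def by auto
  have "adj (map_mat f v) * map_mat f v = map_mat f p" "map_mat f v * adj (map_mat f v) = map_mat f r"
    using v map_mat_mult[OF f(1), of "adj v" _ _ v] map_mat_mult[OF f(1), of v _ _ "adj v"]
    by (simp_all add: map_mat_adj[OF f(1), symmetric])
  then show ?thesis
    using v f unfolding mvn_def by (intro bexI[of _ "map_mat f v"]) auto
qed

section \<open>Traces of matrices induced by a tracial functional on the entries\<close>

definition mtrace :: "('a \<Rightarrow> complex) \<Rightarrow> 'a mat \<Rightarrow> complex" where
  "mtrace t p = (\<Sum>i<dim_row p. t (p $$ (i, i)))"

text \<open>Rectangular factors are allowed because \<open>adj v * v\<close> and
  \<open>v * adj v\<close> may have different sizes in an equivalence of projections.\<close>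

lemma mtrace_mult_commute:
  assumes add: "\<And>x y. t (x + y) = t x + t y" and comm: "\<And>x y. t (x * y) = t (y * x)"
    and A: "A \<in> carrier_mat m n" and B: "B \<in> carrier_mat n m"
  shows "mtrace t (A * B :: 'a::ring mat) = mtrace t (B * A)"
proof -
  have z: "t 0 = 0" using add[of 0 0] by simp
  have s: "t (sum f I) = (\<Sum>i\<in>I. t (f i))" for f and I :: "nat set"
    by (induction I rule: infinite_finite_induct) (simp_all add: z add)
  have "mtrace t (A * B) = (\<Sum>i<m. \<Sum>j<n. t (A $$ (i, j) * B $$ (j, i)))"
    using A B by (simp add: mtrace_def index_mult_mat_sum[OF A B] s del: index_mult_mat(1))
  also have "\<dots> = (\<Sum>j<n. \<Sum>i<m. t (B $$ (j, i) * A $$ (i, j)))"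
    by (subst sum.swap) (simp add: comm)
  also have "\<dots> = mtrace t (B * A)"
    using A B by (simp add: mtrace_def index_mult_mat_sum[OF B A] s del: index_mult_mat(1))
  finally show ?thesis .
qed

lemma sum_lessThan_plus: "(\<Sum>i<a + b. f i) = (\<Sum>i<a. f i) + (\<Sum>i<b. f (a + i))" for a b :: nat
  by (induction b) (simp_all add: add.assoc)

lemma mtrace_dsum: "square_mat p \<Longrightarrow> square_mat r \<Longrightarrow> mtrace t (p \<boxplus> r) = mtrace t p + mtrace t r"
  by (simp add: mtrace_def sum_lessThan_plus dsum_def)

lemma mtrace_mvn:
  assumes add: "\<And>x y. t (x + y) = t x + t y" and comm: "\<And>x y. t (x * y) = t (y * x)"
    and "mvn S p r"
  shows "mtrace t p = mtrace t r"
proof -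
  obtain v where v: "v \<in> carrier_mat (dim_row r) (dim_row p)" "adj v * v = p" "v * adj v = r"
    using assms(3) unfolding mvn_def by auto
  show ?thesis
    using mtrace_mult_commute[of t v, OF add comm v(1), of "adj v"] v by simp
qed

section \<open>The Newton--Schulz iteration\<close>

context cstar_algebra begin
subclass banach ..
end

lemma norm_star [simp]: "norm (star x) = norm (x::'a::cstar_algebra)"
proof -
  have *: "norm y \<le> norm (star y)" for y :: 'a
  proof (cases "norm y = 0")
    case False
    have "norm y * norm y \<le> norm (star y) * norm y"
      using norm_star_mult[of y] norm_mult_ineq[of "star y" y] by (simp add: power2_eq_square)
    then show ?thesis using False by (simp add: mult_le_cancel_right)
  qed simp
  show ?thesis using *[of x] *[of "star x"] by (simp add: star_star)
qed

lemma tendsto_star: "(f \<longlongrightarrow> l) F \<Longrightarrow> ((\<lambda>i. star (f i)) \<longlongrightarrow> star (l::'a::cstar_algebra)) F"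
  by (simp add: tendsto_iff dist_norm flip: star_diff)

lemma star_scaleR: "star (r *\<^sub>R x) = r *\<^sub>R star (x::'a::cstar_algebra)"
  by (simp add: scaleR_scaleC star_scaleC)

text \<open>The sum of the entry norms stands in for the C*-norm on matrices: it is
  submultiplicative, invariant under \<open>adj\<close>, and small exactly when all entries are
  small.\<close>

definition mnorm :: "'a::real_normed_vector mat \<Rightarrow> real" where
  "mnorm A = (\<Sum>i<dim_row A. \<Sum>j<dim_col A. norm (A $$ (i, j)))"

lemma mnorm_nonneg [simp]: "0 \<le> mnorm A"
  by (simp add: mnorm_def sum_nonneg)

lemma norm_le_mnorm: "i < dim_row A \<Longrightarrow> j < dim_col A \<Longrightarrow> norm (A $$ (i, j)) \<le> mnorm A"
proof -
  assume ij: "i < dim_row A" "j < dim_col A"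
  have "norm (A $$ (i, j)) \<le> (\<Sum>j<dim_col A. norm (A $$ (i, j)))"
    using ij by (intro member_le_sum) auto
  also have "\<dots> \<le> mnorm A"
    unfolding mnorm_def using ij by (intro member_le_sum[of _ _ "\<lambda>i. \<Sum>j<dim_col A. norm (A $$ (i, j))"]) (auto intro: sum_nonneg)
  finally show ?thesis .
qed

lemma mnorm_add: "A \<in> carrier_mat m n \<Longrightarrow> B \<in> carrier_mat m n \<Longrightarrow> mnorm (A + B) \<le> mnorm A + mnorm B"
  by (auto simp: mnorm_def sum.distrib[symmetric] intro!: sum_mono norm_triangle_ineq)

lemma mnorm_minus_commute: "A \<in> carrier_mat m n \<Longrightarrow> B \<in> carrier_mat m n \<Longrightarrow> mnorm (A - B) = mnorm (B - A)"
  by (auto simp: mnorm_def norm_minus_commute intro!: sum.cong)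

lemma mnorm_mult:
  assumes A: "A \<in> carrier_mat m n" and B: "B \<in> carrier_mat n k"
  shows "mnorm (A * B :: 'a::real_normed_algebra mat) \<le> mnorm A * mnorm B"
proof -
  have "mnorm (A * B) = (\<Sum>i<m. \<Sum>l<k. norm (\<Sum>j<n. A $$ (i, j) * B $$ (j, l)))"
    using A B by (simp add: mnorm_def index_mult_mat_sum[OF A B] del: index_mult_mat(1))
  also have "\<dots> \<le> (\<Sum>i<m. \<Sum>l<k. \<Sum>j<n. norm (A $$ (i, j)) * norm (B $$ (j, l)))"
    by (intro sum_mono order_trans[OF norm_sum] norm_mult_ineq)
  also have "\<dots> = (\<Sum>i<m. \<Sum>j<n. norm (A $$ (i, j)) * (\<Sum>l<k. norm (B $$ (j, l))))"
    unfolding sum_distrib_left by (intro sum.cong refl sum.swap)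
  also have "\<dots> \<le> (\<Sum>i<m. \<Sum>j<n. norm (A $$ (i, j)) * mnorm B)"
  proof (intro sum_mono mult_left_mono)
    fix j assume "j \<in> {..<n}"
    then show "(\<Sum>l<k. norm (B $$ (j, l))) \<le> mnorm B"
      unfolding mnorm_def using B
      by (intro order_trans[OF _ member_le_sum[of j _ "\<lambda>i. \<Sum>j<dim_col B. norm (B $$ (i, j))"]])
        (auto intro: sum_nonneg)
  qed simp
  also have "\<dots> = mnorm A * mnorm B"
    using A by (simp add: mnorm_def sum_distrib_right)
  finally show ?thesis .
qed

lemma mnorm_adj [simp]: "mnorm (adj A) = mnorm (A :: 'a::cstar_algebra mat)"
  unfolding mnorm_def by (subst sum.swap) simp

text \<open>Real scaling reaches the entries through \<open>scaleR\<close>;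
  \<open>\<cdot>\<^sub>m\<close> would take its scalar from the entry ring, which may lack a
  unit.\<close>

definition half :: "'a::real_vector mat \<Rightarrow> 'a mat" where
  "half = map_mat (\<lambda>x. (1 / 2) *\<^sub>R x)"

lemma dim_half [simp]: "dim_row (half A) = dim_row A" "dim_col (half A) = dim_col A"
  by (simp_all add: half_def)

lemma half_carrier [simp]: "half A \<in> carrier_mat m n \<longleftrightarrow> A \<in> carrier_mat m n"
  unfolding carrier_mat_def by auto

lemma index_half [simp]: "i < dim_row A \<Longrightarrow> j < dim_col A \<Longrightarrow> half A $$ (i, j) = (1 / 2) *\<^sub>R A $$ (i, j)"
  by (simp add: half_def)

lemma mnorm_half [simp]: "mnorm (half A) = mnorm A / 2"
  by (simp add: mnorm_def sum_divide_distrib)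

lemma adj_half: "adj (half A) = half (adj A :: 'a::cstar_algebra mat)"
  by (rule eq_matI) (simp_all add: star_scaleR)

lemma half_mult:
  assumes "A \<in> carrier_mat m n" "B \<in> carrier_mat n k"
  shows "half A * B = half (A * B :: 'a::real_normed_algebra mat)" "A * half B = half (A * B)"
  using assms by (auto intro!: eq_matI simp: index_mult_mat_sum[of _ m n _ k] scaleR_right.sum
      simp del: index_mult_mat(1))

text \<open>The cubic step \<open>v (3 - adj v * v) / 2\<close> towards the polar part of
  \<open>v\<close>, arranged so that no unit occurs.\<close>

definition newton :: "'a::cstar_algebra mat \<Rightarrow> 'a mat" where
  "newton v = v + half (v - v * (adj v * v))"

lemma newton_carrier [simp]: "v \<in> carrier_mat m n \<Longrightarrow> newton v \<in> carrier_mat m n"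
  by (auto simp: newton_def)

text \<open>The product \<open>v * adj v * v\<close> can be bracketed from either side, so the step
  commutes with \<open>adj\<close>. Facts about \<open>adj v * v\<close> thereby turn into facts
  about \<open>v * adj v\<close>.\<close>

lemma adj_newton:
  assumes v: "v \<in> carrier_mat m n"
  shows "newton (adj v) = adj (newton v)"
proof -
  have av: "adj v \<in> carrier_mat n m" using v by simp
  have 1: "adj (v * (adj v * v)) = adj v * (v * adj v)"
    using v av by (simp add: adj_mult[of _ m n _ n] adj_mult[of _ n m _ n] assoc_mult_mat[of _ n m _ n _ m])
  have 2: "v * (adj v * v) \<in> carrier_mat m n" using v av by simp
  have "adj (newton v) = adj v + adj (half (v - v * (adj v * v)))"
    unfolding newton_def by (rule adj_add[OF v]) (use v 2 in auto)
  also have "adj (half (v - v * (adj v * v))) = half (adj v - adj v * (v * adj v))"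
    by (simp add: adj_half adj_minus[OF v 2] 1)
  finally show ?thesis by (simp add: newton_def)
qed

text \<open>For \<open>s = adj v * v\<close>, \<open>t = s ^ 2\<close>, \<open>u = s ^ 3\<close> and
  \<open>p\<close> acting as unit, this rewrites \<open>p - s (3 - s) ^ 2 / 4\<close> as
  \<open>(3 e ^ 2 + e ^ 3) / 4\<close> with \<open>e = p - s\<close>. Multiplication by 4 clears the
  nested halves.\<close>

lemma newton_scalar_identity:
  fixes p s t u :: "'a::real_vector"
  shows "p - (s + (1/2) *\<^sub>R (s - t) + ((1/2) *\<^sub>R (s - t) + (1/2) *\<^sub>R ((1/2) *\<^sub>R (s - t - (t - u)))))
    = p - s - (s - t) - (1/2) *\<^sub>R ((1/2) *\<^sub>R (p - s - (s - t)))
      + (1/2) *\<^sub>R ((1/2) *\<^sub>R (p - s - (s - t) - (s - t - (t - u))))"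
proof -
  have e: "4 *\<^sub>R z = z + z + z + z" for z :: 'a
    using scaleR_left_distrib[of 2 2 z] by (simp add: scaleR_2)
  have "x = y" if "4 *\<^sub>R x = 4 *\<^sub>R y" for x y :: 'a
    using that by simp
  then show ?thesis
    by (rule) (simp add: scaleR_right_distrib scaleR_right_diff_distrib, simp add: e scaleR_2 algebra_simps)
qed

text \<open>Since \<open>v * p = v\<close>, the projection \<open>p\<close> is a unit for
  \<open>s = adj v * v\<close>. All products reduce to combinations of \<open>p\<close> and powers
  of \<open>s\<close>, and the claim becomes \<open>newton_scalar_identity\<close> entry by
  entry.\<close>

lemma newton_defect:
  assumes v: "v \<in> carrier_mat m n" and p: "p \<in> carrier_mat n n" "p * p = p" "adj p = p"
    and vp: "v * p = v"
  defines "e \<equiv> p - adj v * v"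
  shows "p - adj (newton v) * newton v = e * e - half (half (e * e)) + half (half (e * e * e))"
proof -
  define s where "s = adj v * v"
  have av: "adj v \<in> carrier_mat n m" using v by simp
  have s: "s \<in> carrier_mat n n" using v by (simp add: s_def)
  have e: "e \<in> carrier_mat n n" "e = p - s" using s by (simp_all add: e_def s_def minus_carrier_mat)
  have ss: "s * s \<in> carrier_mat n n" and sss: "s * (s * s) \<in> carrier_mat n n" using s by auto
  have sp: "s * p = s" unfolding s_def using assoc_mult_mat[OF av v p(1)] by (simp add: vp)
  have as: "adj s = s" unfolding s_def using adj_mult[OF av v] by simp
  have ps: "p * s = s" using arg_cong[OF sp, of adj] adj_mult[OF s p(1)] by (simp add: as p)
  have ae: "adj e = e" unfolding e(2) using adj_minus[OF p(1) s] by (simp add: as p)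
  have ve: "v - v * s = v * e" unfolding e(2) using mult_minus_distrib_mat[OF v p(1) s] vp by simp
  have nv: "newton v = v + half (v * e)" by (simp add: newton_def ve flip: s_def)
  have h: "half (v * e) \<in> carrier_mat m n" "v * e \<in> carrier_mat m n" using v e by auto
  have h': "half (e * adj v) \<in> carrier_mat n m" "e * adj v \<in> carrier_mat n m" using av e by auto
  have anv: "adj (newton v) = adj v + half (e * adj v)"
    unfolding nv adj_add[OF v h(1)] adj_half adj_mult[OF v e(1)] ae ..
  have es: "e * s = s - s * s" unfolding e(2) using minus_mult_distrib_mat[OF p(1) s s] ps by simp
  have se: "s * e = s - s * s" unfolding e(2) using mult_minus_distrib_mat[OF s p(1) s] sp by simp
  have pe: "p * e = e" unfolding e(2) using mult_minus_distrib_mat[OF p(1) p(1) s] ps p by simp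
  have ep: "e * p = e" unfolding e(2) using minus_mult_distrib_mat[OF p(1) s p(1)] sp p by simp
  have ese: "e * (s * e) = s - s * s - (s * s - s * (s * s))"
    unfolding se using mult_minus_distrib_mat[OF e(1) s ss] es
      assoc_mult_mat[OF e(1) s s] minus_mult_distrib_mat[OF s ss s] assoc_mult_mat[OF s s s] by simp
  have ee: "e * e = p - s - (s - s * s)"
    using mult_minus_distrib_mat[OF e(1) p(1) s] by (simp add: es ep flip: e(2))
  have eee: "e * e * e = p - s - (s - s * s) - (s - s * s - (s * s - s * (s * s)))"
  proof -
    have 0: "e * e = e - s * e" using minus_mult_distrib_mat[OF p(1) s e(1)] pe by (simp flip: e(2))
    have "e * e * e = e * (e * e)" using e by simp
    also have "\<dots> = e * (e - s * e)" by (simp only: 0)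
    also have "\<dots> = e * e - e * (s * e)"
      using mult_minus_distrib_mat[OF e(1) e(1), of "s * e"] s e by simp
    also have "\<dots> = p - s - (s - s * s) - (s - s * s - (s * s - s * (s * s)))"
      by (simp only: ee ese)
    finally show ?thesis .
  qed
  have "adj (newton v) * newton v = (adj v * v + half (adj v * (v * e)))
      + (half (e * adj v * v) + half (half (e * adj v * (v * e))))"
  proof -
    have 1: "v + half (v * e) \<in> carrier_mat m n" using v h by simp
    have "adj (newton v) * newton v = adj v * (v + half (v * e)) + half (e * adj v) * (v + half (v * e))"
      unfolding anv unfolding nv by (rule add_mult_distrib_mat[OF av h'(1) 1])
    also have "\<dots> = (adj v * v + adj v * half (v * e)) + (half (e * adj v) * v + half (e * adj v) * half (v * e))"
      by (simp only: mult_add_distrib_mat[OF av v h(1)] mult_add_distrib_mat[OF h'(1) v h(1)])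
    finally show ?thesis
      by (simp only: half_mult(2)[OF av h(2)] half_mult(1)[OF h'(2) v] half_mult(1)[OF h'(2) h(1)]
          half_mult(2)[OF h'(2) h(2)])
  qed
  also have "adj v * (v * e) = s * e" unfolding s_def using v av e by simp
  also have "e * adj v * v = e * s" unfolding s_def using v av e by simp
  also have "e * adj v * (v * e) = e * (s * e)" unfolding s_def
    using assoc_mult_mat[OF e(1) av h(2)] assoc_mult_mat[OF av v e(1)] by simp
  finally have *: "adj (newton v) * newton v = (s + half (s - s * s))
      + (half (s - s * s) + half (half (s - s * s - (s * s - s * (s * s)))))"
    by (simp only: ese[unfolded se] se es flip: s_def)
  have d: "dim_row s = n" "dim_col s = n" "dim_row p = n" "dim_col p = n" using s p by auto
  show ?thesis unfolding * eee unfolding ee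
  proof (rule eq_matI, goal_cases)
    case (1 i j)
    then show ?case
      by (simp add: d newton_scalar_identity del: index_mult_mat(1) assoc_mult_mat
          scaleR_scaleR scaleR_right_diff_distrib)
  qed (simp_all add: d)
qed

lemma newton_defect_norm:
  assumes v: "v \<in> carrier_mat m n" and p: "p \<in> carrier_mat n n" "p * p = p" "adj p = p"
    and vp: "v * p = v" and small: "mnorm (p - adj v * v) \<le> 1"
  shows "mnorm (p - adj (newton v) * newton v) \<le> (mnorm (p - adj v * v))\<^sup>2"
proof -
  define e where "e = p - adj v * v"
  have e: "e \<in> carrier_mat n n" using v p by (auto simp: e_def intro!: minus_carrier_mat)
  have ee: "e * e \<in> carrier_mat n n" and eee: "e * e * e \<in> carrier_mat n n" using e by auto
  have n2: "mnorm (e * e) \<le> (mnorm e)\<^sup>2" using mnorm_mult[OF e e] by (simp add: power2_eq_square)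
  have "mnorm (e * e * e) \<le> mnorm (e * e) * mnorm e" by (rule mnorm_mult[OF ee e])
  also have "\<dots> \<le> (mnorm e)\<^sup>2 * 1"
    using n2 small by (intro mult_mono) (auto simp: e_def)
  finally have n3: "mnorm (e * e * e) \<le> (mnorm e)\<^sup>2" by simp
  \<comment> \<open>Written as a sum: the triangle inequality applied to the difference would give
    the factor 5/4 instead of 3/4, which together with the 1/4 of the cubic term makes 1.\<close>
  have eq: "e * e - half (half (e * e)) = half (e * e + half (e * e))"
  proof (rule eq_matI, goal_cases)
    case (1 i j)
    have "x - (1/2) *\<^sub>R ((1/2) *\<^sub>R x) = (1/2) *\<^sub>R (x + (1/2) *\<^sub>R x)" for x :: 'a
      using scaleR_left_distrib[of "1/2" "1/4" x] scaleR_left_diff_distrib[of 1 "1/4" x]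
      by (simp add: scaleR_right_distrib)
    with 1 ee show ?case by (simp del: index_mult_mat(1) scaleR_scaleR)
  qed (use e in auto)
  have "mnorm (p - adj (newton v) * newton v) = mnorm (half (e * e + half (e * e)) + half (half (e * e * e)))"
    unfolding newton_defect[OF v p vp] by (simp only: eq flip: e_def)
  also have "\<dots> \<le> mnorm (half (e * e + half (e * e))) + mnorm (half (half (e * e * e)))"
    by (rule mnorm_add[of _ n n]) (use ee eee in auto)
  also have "\<dots> \<le> (mnorm (e * e) + mnorm (e * e) / 2) / 2 + mnorm (e * e * e) / 4"
    using mnorm_add[of "e * e" n n "half (e * e)"] ee by simp
  also have "\<dots> \<le> (mnorm e)\<^sup>2" using n2 n3 by simp
  finally show ?thesis by (simp add: e_def)
qed


text \<open>A defect of at most 1/2 has a square of at most half its size, so quadratic decay yields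
  halving. The factor \<open>c\<close> matches the bounds \<open>1 / 2 * (1 / 2) ^ i\<close> that
  occur in inductions.\<close>

lemma newton_defect_iterate:
  assumes v: "v \<in> carrier_mat m n" and p: "p \<in> carrier_mat n n" "p * p = p" "adj p = p"
    and vp: "v * p = v" and small: "mnorm (p - adj v * v) \<le> 1 / 2 * c" and c: "0 \<le> c" "c \<le> 1"
  shows "mnorm (p - adj (newton v) * newton v) \<le> 1 / 2 * (mnorm (p - adj v * v))"
proof -
  have "mnorm (p - adj v * v) \<le> 1 / 2" using small c by simp
  then have "(mnorm (p - adj v * v))\<^sup>2 \<le> 1 / 2 * mnorm (p - adj v * v)"
    unfolding power2_eq_square by (intro mult_right_mono) auto
  with newton_defect_norm[OF v p vp] \<open>mnorm (p - adj v * v) \<le> 1 / 2\<close> show ?thesis by linarith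
qed

lemma newton_mult_right:
  assumes v: "v \<in> carrier_mat m n" and p: "p \<in> carrier_mat n n" and vp: "v * p = v"
  shows "newton v * p = newton v"
proof -
  have av: "adj v \<in> carrier_mat n m" using v by simp
  have 1: "v * (adj v * v) \<in> carrier_mat m n" using v av by simp
  have "v * (adj v * v) * p = v * (adj v * v)"
    using v av p vp by (simp add: assoc_mult_mat[of _ m n _ n _ n] assoc_mult_mat[of _ n m _ n _ n])
  then have "(v - v * (adj v * v)) * p = v - v * (adj v * v)"
    using minus_mult_distrib_mat[OF v 1 p] vp by simp
  then show ?thesis
    unfolding newton_def using v p 1 vp
    by (subst add_mult_distrib_mat[OF v _ p]) (auto simp: half_mult[OF _ p, of _ m] minus_carrier_mat)
qed

lemma geometric_steps_converge:
  fixes a :: "nat \<Rightarrow> 'a::banach"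
  assumes "\<And>i. norm (a (Suc i) - a i) \<le> K * (1 / 2) ^ i"
  shows "convergent a"
proof -
  have "summable (\<lambda>i. a (Suc i) - a i)"
    by (rule summable_comparison_test'[of "\<lambda>i. K * (1 / 2) ^ i" 0]) (use assms in auto)
  then have "convergent (\<lambda>n. \<Sum>i<n. a (Suc i) - a i)"
    by (simp add: summable_iff_convergent)
  then have "convergent (\<lambda>n. a n - a 0)"
    by (simp only: sum_lessThan_telescope)
  then have "convergent (\<lambda>n. a n - a 0 + a 0)"
    by (intro convergent_add convergent_const)
  then show ?thesis by simp
qed

text \<open>The right-hand version for \<open>adj v\<close>, transported by
  \<open>adj_newton\<close>.\<close>

lemma newton_mult_left:
  assumes v: "v \<in> carrier_mat m n" and r: "r \<in> carrier_mat m m" "adj r = r" and rv: "r * v = v"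
  shows "r * newton v = newton v"
proof -
  have av: "adj v \<in> carrier_mat n m" using v by simp
  have "adj v * r = adj v" using adj_mult[OF r(1) v] by (simp add: rv r)
  then have "newton (adj v) * r = newton (adj v)" by (rule newton_mult_right[OF av r(1)])
  then have "adj (newton v) * r = adj (newton v)" by (simp only: adj_newton[OF v])
  then have "adj (adj (newton v) * r) = newton v" by simp
  then show ?thesis
    using adj_mult[of "adj (newton v)" n m r m] v r by simp
qed

lemma elements_mat_half:
  "(\<And>x. x \<in> S \<Longrightarrow> (1 / 2) *\<^sub>R x \<in> S) \<Longrightarrow> elements_mat A \<subseteq> S \<Longrightarrow> elements_mat (half A) \<subseteq> S"
  by (auto simp: elements_mat_subset_iff)

text \<open>With \<open>e = p - v\<^sup>* v\<close> one step replaces \<open>e\<close> by \<open>(3 e\<^sup>2 + e\<^sup>3) / 4\<close> and moves \<open>v\<close> by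
  \<open>v e / 2\<close>, so the defects decay geometrically; the limit is the polar part of \<open>v\<close>.\<close>

theorem newton_limit:
  fixes v :: "'a::cstar_algebra mat"
  assumes v: "v \<in> carrier_mat m n"
    and p: "p \<in> carrier_mat n n" "p * p = p" "adj p = p" and vp: "v * p = v"
    and r: "r \<in> carrier_mat m m" "r * r = r" "adj r = r" and rv: "r * v = v"
    and ve: "mnorm (p - adj v * v) \<le> \<epsilon>" "\<epsilon> \<le> 1 / 2" and vf: "mnorm (r - v * adj v) \<le> 1 / 2"
    and S: "star_subring S" "\<And>x. x \<in> S \<Longrightarrow> (1 / 2) *\<^sub>R x \<in> S" "closed S" "elements_mat v \<subseteq> S"
  obtains w where "w \<in> carrier_mat m n" "elements_mat w \<subseteq> S" "adj w * w = p" "w * adj w = r"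
    "mnorm (w - v) \<le> 2 * \<epsilon> * mnorm v" "adj v = v \<Longrightarrow> adj w = w"
proof -
  define V where "V i = (newton ^^ i) v" for i
  define K where "K = mnorm v"
  have VS: "V (Suc i) = newton (V i)" for i by (simp add: V_def)
  have V0: "V 0 = v" by (simp add: V_def)
  have eps: "0 \<le> \<epsilon>" using ve(1) mnorm_nonneg order_trans by blast
  have V: "V i \<in> carrier_mat m n \<and> V i * p = V i \<and> r * V i = V i" for i
    by (induction i) (use v vp rv in \<open>auto simp: V0 VS newton_mult_right[OF _ p(1)] newton_mult_left[OF _ r(1,3)]\<close>)
  then have Vc [simp]: "V i \<in> carrier_mat m n" and Vp: "V i * p = V i" and rV: "r * V i = V i" for i
    by auto
  have aVr: "adj (V i) * r = adj (V i)" for i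
    using adj_mult[OF r(1) Vc[of i]] by (simp add: rV r)
  have Vdim [simp]: "dim_row (V i) = m" "dim_col (V i) = n" for i using carrier_matD[OF Vc[of i]] by auto
  have e: "mnorm (p - adj (V i) * V i) \<le> \<epsilon> * (1 / 2) ^ i" for i
  proof (induction i)
    case (Suc i)
    have "\<epsilon> * (1 / 2) ^ i \<le> 1 / 2 * (1 / 2) ^ i" using ve(2) by (intro mult_right_mono) auto
    then have "mnorm (p - adj (V i) * V i) \<le> 1 / 2 * (1 / 2) ^ i" using Suc by linarith
    then have "mnorm (p - adj (newton (V i)) * newton (V i)) \<le> 1 / 2 * mnorm (p - adj (V i) * V i)"
      by (intro newton_defect_iterate[OF Vc p Vp, of _ "(1 / 2) ^ i"]) (auto simp: power_le_one)
    then show ?case using Suc by (simp add: VS)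
  qed (use ve in \<open>simp add: V0\<close>)
  \<comment> \<open>The defect on this side is the other one for \<open>adj (V i)\<close>, with
    \<open>r\<close> in the role of \<open>p\<close>.\<close>
  have f: "mnorm (r - V i * adj (V i)) \<le> 1 / 2 * (1 / 2) ^ i" for i
  proof (induction i)
    case (Suc i)
    have "mnorm (r - adj (newton (adj (V i))) * newton (adj (V i))) \<le> 1 / 2 * mnorm (r - adj (adj (V i)) * adj (V i))"
      using Suc by (intro newton_defect_iterate[OF _ r aVr, of _ n "(1 / 2) ^ i"]) (auto simp: power_le_one)
    then show ?case using Suc by (simp add: VS adj_newton[OF Vc])
  qed (use vf in \<open>simp add: V0\<close>)
  have step: "mnorm (V (Suc i) - V i) \<le> mnorm (V i) * (\<epsilon> * (1 / 2) ^ i) / 2" for i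
  proof -
    have av: "adj (V i) * V i \<in> carrier_mat n n" by (rule mult_carrier_mat[of _ n m]) auto
    have "V (Suc i) - V i = half (V i - V i * (adj (V i) * V i))"
      unfolding VS newton_def by (rule eq_matI) auto
    also have "V i - V i * (adj (V i) * V i) = V i * (p - adj (V i) * V i)"
      using mult_minus_distrib_mat[OF Vc p(1) av] Vp by simp
    finally have "mnorm (V (Suc i) - V i) = mnorm (V i * (p - adj (V i) * V i)) / 2" by simp
    also have "\<dots> \<le> mnorm (V i) * mnorm (p - adj (V i) * V i) / 2"
      using mnorm_mult[OF Vc[of i], of "p - adj (V i) * V i" n] av by (simp add: minus_carrier_mat)
    also have "\<dots> \<le> mnorm (V i) * (\<epsilon> * (1 / 2) ^ i) / 2"
      using e[of i] by (intro divide_right_mono mult_left_mono) auto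
    finally show ?thesis .
  qed
  \<comment> \<open>Each increment is at most \<open>K * (1 / 2) ^ Suc i\<close>, exactly the growth
    of \<open>K * (2 - (1 / 2) ^ i)\<close>; hence \<open>mnorm (V i)\<close> never exceeds
    \<open>2 * K\<close>.\<close>
  have bound: "mnorm (V i) \<le> K * (2 - (1 / 2) ^ i)" for i
  proof (induction i)
    case (Suc i)
    have "V (Suc i) = V i + (V (Suc i) - V i)"
      by (rule eq_matI) auto
    then have "mnorm (V (Suc i)) \<le> mnorm (V i) + mnorm (V (Suc i) - V i)"
      using mnorm_add[OF Vc[of i], of "V (Suc i) - V i"] Vc by (metis minus_carrier_mat)
    also have "\<dots> \<le> mnorm (V i) + mnorm (V i) * (1 / 2 * (1 / 2) ^ i) / 2"
      using ve(2) by (intro add_left_mono order_trans[OF step] divide_right_mono mult_left_mono mult_right_mono) auto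
    also have "\<dots> \<le> K * (2 - (1 / 2) ^ i) + K * 2 * (1 / 2 * (1 / 2) ^ i) / 2"
    proof -
      have "mnorm (V i) \<le> K * 2" 
        using Suc by (rule order_trans) (auto simp: K_def intro!: mult_left_mono)
      then show ?thesis
        using Suc by (intro add_mono divide_right_mono mult_right_mono) auto
    qed
    also have "\<dots> = K * (2 - (1 / 2) ^ Suc i)" by (simp add: algebra_simps)
    finally show ?case .
  qed (simp add: K_def V0)
  have step': "mnorm (V (Suc i) - V i) \<le> K * \<epsilon> * (1 / 2) ^ i" for i
  proof -
    have "mnorm (V i) \<le> K * 2" 
      using bound[of i] by (rule order_trans) (auto simp: K_def intro!: mult_left_mono)
    then have "mnorm (V i) * (\<epsilon> * (1 / 2) ^ i) / 2 \<le> K * 2 * (\<epsilon> * (1 / 2) ^ i) / 2"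
      using eps by (intro divide_right_mono mult_right_mono) auto
    with step[of i] show ?thesis by simp
  qed
  have total: "mnorm (V i - v) \<le> 2 * \<epsilon> * K" for i
  proof -
    have "mnorm (V i - v) \<le> K * \<epsilon> * (2 - 2 * (1 / 2) ^ i)"
    proof (induction i)
      case 0
      have "V 0 - v = 0\<^sub>m m n" using v by (simp add: V0)
      then show ?case by (simp add: mnorm_def)
    next
      case (Suc i)
      have "V (Suc i) - v = (V i - v) + (V (Suc i) - V i)"
        using v by (intro eq_matI) auto
      then have "mnorm (V (Suc i) - v) \<le> mnorm (V i - v) + mnorm (V (Suc i) - V i)"
        using mnorm_add[of "V i - v" m n "V (Suc i) - V i"] v by (simp add: minus_carrier_mat)
      then show ?case using Suc step'[of i] by (simp add: algebra_simps)
    qed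
    also have "\<dots> \<le> K * \<epsilon> * 2" using eps by (intro mult_left_mono) (auto simp: K_def)
    finally show ?thesis by (simp add: mult_ac)
  qed
  have "convergent (\<lambda>i. V i $$ (a, b))" if "a < m" "b < n" for a b
  proof (rule geometric_steps_converge)
    fix i
    have "norm (V (Suc i) $$ (a, b) - V i $$ (a, b)) \<le> mnorm (V (Suc i) - V i)"
      using norm_le_mnorm[of a "V (Suc i) - V i" b] that by simp
    then show "norm (V (Suc i) $$ (a, b) - V i $$ (a, b)) \<le> K * \<epsilon> * (1 / 2) ^ i"
      using step'[of i] by simp
  qed
  then have "\<exists>l. (\<lambda>i. V i $$ (a, b)) \<longlonglongrightarrow> l" if "a < m" "b < n" for a b
    using that by (auto simp: convergent_def)
  then obtain l where l: "\<And>a b. a < m \<Longrightarrow> b < n \<Longrightarrow> (\<lambda>i. V i $$ (a, b)) \<longlonglongrightarrow> l a b"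
    by metis
  define w where "w = mat m n (\<lambda>(a, b). l a b)"
  have w: "w \<in> carrier_mat m n" by (simp add: w_def)
  have lim: "(\<lambda>i. V i $$ (a, b)) \<longlonglongrightarrow> w $$ (a, b)" if "a < m" "b < n" for a b
    using l[OF that] that by (simp add: w_def)
  have VS': "elements_mat (V i) \<subseteq> S" for i
  proof (induction i)
    case (Suc i)
    have aV: "adj (V i) \<in> carrier_mat n m" by simp
    have aVV: "adj (V i) * V i \<in> carrier_mat n n" by (rule mult_carrier_mat[OF aV Vc])
    have c: "V i * (adj (V i) * V i) \<in> carrier_mat m n" by (rule mult_carrier_mat[OF Vc aVV])
    have "elements_mat (V i * (adj (V i) * V i)) \<subseteq> S"
      by (intro elements_mat_mult[OF S(1) Vc aVV Suc] elements_mat_mult[OF S(1) aV Vc]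
          elements_mat_adj S(1) Suc)
    then have "elements_mat (half (V i - V i * (adj (V i) * V i))) \<subseteq> S"
      by (intro elements_mat_half S(2) elements_mat_minus[OF S(1) Vc c Suc])
    moreover have "half (V i - V i * (adj (V i) * V i)) \<in> carrier_mat m n"
      using minus_carrier_mat[OF c] by simp
    ultimately show ?case
      unfolding VS newton_def by (intro elements_mat_add[OF S(1) Vc] Suc)
  qed (use S in \<open>simp add: V0\<close>)
  have wS: "elements_mat w \<subseteq> S"
    unfolding elements_mat_subset_iff
  proof (intro allI impI)
    fix a b assume "a < dim_row w" "b < dim_col w"
    then have ab: "a < m" "b < n" using w by auto
    show "w $$ (a, b) \<in> S"
      by (rule closed_sequentially[OF S(3) _ lim[OF ab]]) (use VS' ab in \<open>auto simp: elements_mat_subset_iff\<close>)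
  qed
  have to0: "x \<longlonglongrightarrow> 0" if "\<And>i. norm (x i) \<le> c * (1 / 2) ^ i" for x :: "nat \<Rightarrow> 'a" and c
  proof -
    have "(\<lambda>i. c * (1 / 2) ^ i) \<longlonglongrightarrow> c * 0" by (intro tendsto_mult tendsto_const LIMSEQ_power_zero) auto
    then show ?thesis
      by (intro Lim_null_comparison[of x "\<lambda>i. c * (1 / 2) ^ i"]) (use that in auto)
  qed
  have ww: "adj w * w = p"
  proof (rule eq_matI)
    fix a b assume "a < dim_row p" "b < dim_col p"
    then have ab: "a < n" "b < n" using p by auto
    have "(\<lambda>i. p $$ (a, b) - (adj (V i) * V i) $$ (a, b)) \<longlonglongrightarrow> 0"
    proof (rule to0)
      show "norm (p $$ (a, b) - (adj (V i) * V i) $$ (a, b)) \<le> \<epsilon> * (1 / 2) ^ i" for i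
        using norm_le_mnorm[of a "p - adj (V i) * V i" b] e[of i] ab p by (simp del: index_mult_mat(1))
    qed
    moreover have "(\<lambda>i. p $$ (a, b) - (adj (V i) * V i) $$ (a, b)) \<longlonglongrightarrow> p $$ (a, b) - (adj w * w) $$ (a, b)"
      using ab w by (subst (1 2) index_mult_mat_sum[of _ n m _ n])
        (auto intro!: tendsto_intros tendsto_star lim)
    ultimately show "(adj w * w) $$ (a, b) = p $$ (a, b)"
      using LIMSEQ_unique by fastforce
  qed (use w p in auto)
  have ww': "w * adj w = r"
  proof (rule eq_matI)
    fix a b assume "a < dim_row r" "b < dim_col r"
    then have ab: "a < m" "b < m" using r by auto
    have "(\<lambda>i. r $$ (a, b) - (V i * adj (V i)) $$ (a, b)) \<longlonglongrightarrow> 0"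
    proof (rule to0)
      show "norm (r $$ (a, b) - (V i * adj (V i)) $$ (a, b)) \<le> 1 / 2 * (1 / 2) ^ i" for i
        using norm_le_mnorm[of a "r - V i * adj (V i)" b] f[of i] ab r by (simp del: index_mult_mat(1))
    qed
    moreover have "(\<lambda>i. r $$ (a, b) - (V i * adj (V i)) $$ (a, b)) \<longlonglongrightarrow> r $$ (a, b) - (w * adj w) $$ (a, b)"
      using ab w by (subst (1 2) index_mult_mat_sum[of _ m n _ m])
        (auto intro!: tendsto_intros tendsto_star lim)
    ultimately show "(w * adj w) $$ (a, b) = r $$ (a, b)"
      using LIMSEQ_unique by fastforce
  qed (use w r in auto)
  have "mnorm (w - v) \<le> 2 * \<epsilon> * K"
  proof (rule LIMSEQ_le_const2)
    show "(\<lambda>i. mnorm (V i - v)) \<longlonglongrightarrow> mnorm (w - v)"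
      using w v by (auto simp: mnorm_def intro!: tendsto_intros lim)
  qed (use total in auto)
  \<comment> \<open>The iteration preserves self-adjointness, so an approximate symmetry leads to an
    exact one.\<close>
  moreover have "adj w = w" if "adj v = v"
  proof -
    have mn: "m = n" using that v by (metis adj_carrier carrier_matD(1))
    have aV: "adj (V i) = V i" for i
      by (induction i) (simp add: V0 that, metis VS Vc adj_newton)
    show ?thesis
    proof (rule eq_matI)
      fix a b assume "a < dim_row w" "b < dim_col w"
      then have ab: "a < n" "b < n" using w mn by auto
      have "star (V i $$ (b, a)) = V i $$ (a, b)" for i
        using index_adj[of a "V i" b] aV[of i] ab mn by simp
      then have "(\<lambda>i. V i $$ (a, b)) \<longlonglongrightarrow> star (w $$ (b, a))"
        using tendsto_star[OF lim[of b a]] ab mn by simp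
      then show "adj w $$ (a, b) = w $$ (a, b)"
        using LIMSEQ_unique lim[of a b] ab mn w by auto
    qed (use w mn in auto)
  qed
  ultimately show ?thesis
    using that[OF w wS ww ww'] by (simp add: K_def)
qed

section \<open>The finite-dimensional stages\<close>

lemma scaleC_zero_left [simp]: "0 *\<^sub>C (x::'a::complex_star_algebra) = 0"
  using scaleC_add_left[of 0 0 x] by simp

lemma scaleC_zero_right [simp]: "c *\<^sub>C (0::'a::complex_star_algebra) = 0"
  using scaleC_add_right[of c "0::'a" 0] by simp

lemma scaleC_minus1: "(- 1) *\<^sub>C (x::'a::complex_star_algebra) = - x"
  using scaleC_add_left[of "-1" 1 x] by (simp add: scaleC_one eq_neg_iff_add_eq_0)

definition matrix_unit :: "nat \<Rightarrow> nat \<Rightarrow> nat \<Rightarrow> complex mat" where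
  "matrix_unit m i j = mat m m (\<lambda>(a, b). if a = i \<and> b = j then 1 else 0)"

lemma matrix_unit_carrier [simp]: "matrix_unit m i j \<in> carrier_mat m m"
  by (simp add: matrix_unit_def)

lemma matrix_unit_dim [simp]: "dim_row (matrix_unit m i j) = m" "dim_col (matrix_unit m i j) = m"
  by (simp_all add: matrix_unit_def)

lemma index_matrix_unit [simp]:
  "a < m \<Longrightarrow> b < m \<Longrightarrow> matrix_unit m i j $$ (a, b) = (if a = i \<and> b = j then 1 else 0)"
  by (simp add: matrix_unit_def)

lemma index_matrix_unit_mult:
  assumes "A \<in> carrier_mat m m" "j < m" "a < m" "b < m"
  shows "(matrix_unit m i j * A) $$ (a, b) = (if a = i then A $$ (j, b) else 0)"
    "(A * matrix_unit m j i) $$ (b, a) = (if a = i then A $$ (b, j) else 0)"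
proof -
  have "(matrix_unit m i j * A) $$ (a, b) = (\<Sum>l<m. if l = j then (if a = i then A $$ (j, b) else 0) else 0)"
    unfolding index_mult_mat_sum[OF matrix_unit_carrier assms(1,3,4)]
    by (intro sum.cong[OF refl]) (use assms in auto)
  then show "(matrix_unit m i j * A) $$ (a, b) = (if a = i then A $$ (j, b) else 0)"
    using assms by simp
  have "(A * matrix_unit m j i) $$ (b, a) = (\<Sum>l<m. if l = j then (if a = i then A $$ (b, j) else 0) else 0)"
    unfolding index_mult_mat_sum[OF assms(1) matrix_unit_carrier assms(4,3)]
    by (intro sum.cong[OF refl]) (use assms in auto)
  then show "(A * matrix_unit m j i) $$ (b, a) = (if a = i then A $$ (b, j) else 0)"
    using assms by simp
qed

section \<open>The embedding of a floor into the next one, vertex by vertex\<close>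

lemma filter_eq_upt: "j < N \<Longrightarrow> filter (\<lambda>k. k = j) [0..<N] = [j]"
  by (induction N) (auto simp: less_Suc_eq filter_empty_conv)

lemma filter_eq_Suc_upt: "Suc j < N \<Longrightarrow> filter (\<lambda>k. k = j \<or> k = Suc j) [0..<N] = [j, Suc j]"
proof (induction N)
  case (Suc N)
  show ?case
  proof (cases "N = Suc j")
    case True
    have "filter (\<lambda>k. k = j \<or> k = Suc j) [0..<j] = []" by (auto simp: filter_empty_conv)
    then show ?thesis using True by simp
  qed (use Suc in auto)
qed simp

lemma embed_even: "j \<le> 2 ^ n \<Longrightarrow> embed n x (2 * j) = x j"
proof -
  assume "j \<le> 2 ^ n"
  moreover have "edge k (2 * j) \<longleftrightarrow> k = j" for k by (auto simp: edge_def)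
  ultimately have "embed n x (2 * j) = diag_block_mat (map x [j])"
    by (simp add: embed_def filter_eq_upt del: upt_Suc)
  also have "\<dots> = x j" by (auto intro!: eq_matI)
  finally show ?thesis .
qed

lemma embed_odd: "j < 2 ^ n \<Longrightarrow> embed n x (Suc (2 * j)) = x j \<boxplus> x (Suc j)"
proof -
  assume "j < 2 ^ n"
  moreover have "edge k (Suc (2 * j)) \<longleftrightarrow> k = j \<or> k = Suc j" for k by (auto simp: edge_def)
  ultimately have "embed n x (Suc (2 * j)) = diag_block_mat (map x [j, Suc j])"
    by (simp add: embed_def filter_eq_Suc_upt del: upt_Suc)
  also have "\<dots> = x j \<boxplus> x (Suc j)" by (auto intro!: eq_matI simp: dsum_def)
  finally show ?thesis .
qed

lemma q_pos: "0 < q n k"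
  by (induction n arbitrary: k) auto

lemma q_mult_power: "q (n + d) (k * 2 ^ d) = q n k"
proof (induction d)
  case (Suc d)
  have "q (n + Suc d) (k * 2 ^ Suc d) = q (Suc (n + d)) (2 * (k * 2 ^ d))" by (simp add: mult_ac)
  then show ?case using Suc by (simp only: q_equations)
qed simp

lemma embed_in_floor_alg: "x \<in> floor_alg n \<Longrightarrow> embed n x \<in> floor_alg (Suc n)"
proof -
  assume x: "x \<in> floor_alg n"
  then have xk: "x k \<in> carrier_mat (q n k) (q n k)" if "k \<le> 2 ^ n" for k
    using that by (auto simp: floor_alg_def)
  show ?thesis
    unfolding floor_alg_def
  proof (rule PiE_I)
    fix l :: nat assume "l \<in> {..2 ^ Suc n}"
    then have l: "l \<le> 2 * 2 ^ n" by simp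
    show "embed n x l \<in> carrier_mat (q (Suc n) l) (q (Suc n) l)"
    proof (cases "even l")
      case True
      then obtain j where j: "l = 2 * j" by (rule evenE)
      with l have "j \<le> 2 ^ n" by simp
      then show ?thesis unfolding j embed_even[OF \<open>j \<le> 2 ^ n\<close>] q_equations by (rule xk)
    next
      case False
      then obtain j where j: "l = Suc (2 * j)" by (metis oddE Suc_eq_plus1)
      with l have j': "j < 2 ^ n" by simp
      have "q (Suc n) (Suc (2 * j)) = q n j + q n (Suc j)" using q_equations(4)[of n j] by simp
      then show ?thesis unfolding j embed_odd[OF j'] using j' xk[of j] xk[of "Suc j"] by simp
    qed
  qed (auto simp: embed_def)
qed

section \<open>The finite stages inside the limit algebra\<close>

context pascal_limit begin

definition B :: "nat \<Rightarrow> 'a set" where "B n = \<iota> n ` floor_alg n"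

text \<open>The inverse of \<open>\<iota> n\<close> on its range, which gives an element of the
  limit algebra its blocks; outside \<open>B n\<close> the value is arbitrary.\<close>

definition comp :: "nat \<Rightarrow> 'a \<Rightarrow> nat \<Rightarrow> complex mat" where
  "comp n b = inv_into (floor_alg n) (\<iota> n) b"

lemma comp_iota [simp]: "y \<in> floor_alg n \<Longrightarrow> comp n (\<iota> n y) = y"
  unfolding comp_def by (rule inv_into_f_f[OF inj])

lemma comp_in [simp]: "b \<in> B n \<Longrightarrow> comp n b \<in> floor_alg n"
  and iota_comp [simp]: "b \<in> B n \<Longrightarrow> \<iota> n (comp n b) = b"
  unfolding B_def by auto

lemma iota_in_B [simp]: "y \<in> floor_alg n \<Longrightarrow> \<iota> n y \<in> B n"
  unfolding B_def by auto

lemma floor_alg_restrict: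
  "(\<And>k. k \<le> 2 ^ n \<Longrightarrow> f k \<in> carrier_mat (q n k) (q n k)) \<Longrightarrow> (\<lambda>k\<in>{..2 ^ n}. f k) \<in> floor_alg n"
  unfolding floor_alg_def by auto

lemma comp_carrier [simp]: "b \<in> B n \<Longrightarrow> k \<le> 2 ^ n \<Longrightarrow> comp n b k \<in> carrier_mat (q n k) (q n k)"
  using comp_in[of b n] unfolding floor_alg_def by auto

lemma comp_dim [simp]:
  assumes "b \<in> B n" "k \<le> 2 ^ n"
  shows "dim_row (comp n b k) = q n k" "dim_col (comp n b k) = q n k"
  using comp_carrier[OF assms] by (auto simp del: comp_carrier)

text \<open>Turns each axiom about \<open>\<iota>\<close> into two facts at once: \<open>B n\<close>
  is closed under the operation, and \<open>comp\<close> computes it blockwise.\<close>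

lemma iota_restrict:
  assumes "\<And>k. k \<le> 2 ^ n \<Longrightarrow> f k \<in> carrier_mat (q n k) (q n k)" "\<iota> n (\<lambda>k\<in>{..2 ^ n}. f k) = b"
  shows "b \<in> B n" "k \<le> 2 ^ n \<Longrightarrow> comp n b k = f k"
  using floor_alg_restrict[of n f, OF assms(1)] assms(2) by (auto simp flip: assms(2))

lemma B_add [simp]: "a \<in> B n \<Longrightarrow> b \<in> B n \<Longrightarrow> a + b \<in> B n"
  and comp_add: "a \<in> B n \<Longrightarrow> b \<in> B n \<Longrightarrow> k \<le> 2 ^ n \<Longrightarrow> comp n (a + b) k = comp n a k + comp n b k"
  using iota_restrict[of n "\<lambda>k. comp n a k + comp n b k" "a + b"] add[of "comp n a" n "comp n b"] by simp_all

lemma B_mult [simp]: "a \<in> B n \<Longrightarrow> b \<in> B n \<Longrightarrow> a * b \<in> B n"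
  and comp_mult: "a \<in> B n \<Longrightarrow> b \<in> B n \<Longrightarrow> k \<le> 2 ^ n \<Longrightarrow> comp n (a * b) k = comp n a k * comp n b k"
  using iota_restrict[of n "\<lambda>k. comp n a k * comp n b k" "a * b"] mult[of "comp n a" n "comp n b"]
  by (simp_all add: mult_carrier_mat[OF comp_carrier comp_carrier])

lemma B_scaleC [simp]: "a \<in> B n \<Longrightarrow> c *\<^sub>C a \<in> B n"
  and comp_scaleC: "a \<in> B n \<Longrightarrow> k \<le> 2 ^ n \<Longrightarrow> comp n (c *\<^sub>C a) k = c \<cdot>\<^sub>m comp n a k"
  using iota_restrict[of n "\<lambda>k. c \<cdot>\<^sub>m comp n a k" "c *\<^sub>C a"] scale[of "comp n a" n c] by simp_all

lemma B_star [simp]: "a \<in> B n \<Longrightarrow> star a \<in> B n"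
  and comp_star: "a \<in> B n \<Longrightarrow> k \<le> 2 ^ n \<Longrightarrow> comp n (star a) k = adj (comp n a k)"
  using iota_restrict[of n "\<lambda>k. adj (comp n a k)" "star a"] star[of "comp n a" n] by simp_all

lemma B_one [simp]: "1 \<in> B n"
  and comp_one: "k \<le> 2 ^ n \<Longrightarrow> comp n 1 k = 1\<^sub>m (q n k)"
  using iota_restrict[of n "\<lambda>k. 1\<^sub>m (q n k)" 1] unit[of n] by simp_all

lemma B_zero [simp]: "0 \<in> B n"
  using B_scaleC[OF B_one, of 0 n] by simp

lemma B_diff [simp]: "a \<in> B n \<Longrightarrow> b \<in> B n \<Longrightarrow> a - b \<in> B n"
  using B_add[of a n "- b"] B_scaleC[of b n "-1"] by (simp add: scaleC_minus1)

lemma comp_diff: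
  assumes "a \<in> B n" "b \<in> B n" "k \<le> 2 ^ n"
  shows "comp n (a - b) k = comp n a k - comp n b k"
proof -
  have "a - b = a + (- 1) *\<^sub>C b" by (simp add: scaleC_minus1)
  then have "comp n (a - b) k = comp n a k + (- 1) \<cdot>\<^sub>m comp n b k"
    by (simp only: comp_add[OF assms(1) B_scaleC[OF assms(2)] assms(3)] comp_scaleC[OF assms(2,3)])
  also have "\<dots> = comp n a k - comp n b k"
    by (rule eq_matI) (simp_all add: assms)
  finally show ?thesis .
qed

lemma comp_zero: "k \<le> 2 ^ n \<Longrightarrow> comp n 0 k = 0\<^sub>m (q n k) (q n k)"
  using comp_diff[OF B_one B_one, of k n] by (simp add: comp_one)

lemma B_subring: "star_subring (B n)"
  by (simp add: star_subring_def)

lemma B_scaleR [simp]: "a \<in> B n \<Longrightarrow> r *\<^sub>R a \<in> B n"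
  by (simp add: scaleR_scaleC)

lemma comp_eqI:
  assumes "a \<in> B n" "b \<in> B n" "\<And>k. k \<le> 2 ^ n \<Longrightarrow> comp n a k = comp n b k"
  shows "a = b"
proof -
  have "comp n a = comp n b"
    using comp_in[OF assms(1)] comp_in[OF assms(2)] assms(3) unfolding floor_alg_def by (intro PiE_ext) auto
  then show ?thesis using assms iota_comp by metis
qed

lemma B_Suc: "b \<in> B n \<Longrightarrow> b \<in> B (Suc n)"
  and comp_Suc: "b \<in> B n \<Longrightarrow> comp (Suc n) b = embed n (comp n b)"
  using compatible[of "comp n b" n] embed_in_floor_alg[of "comp n b" n] comp_iota iota_in_B
  by (metis comp_in iota_comp)+

lemma B_mono: "m \<le> n \<Longrightarrow> B m \<subseteq> B n"
  by (rule lift_Suc_mono_le[of B]) (auto intro: B_Suc)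

definition mu :: "nat \<Rightarrow> nat \<Rightarrow> nat \<Rightarrow> nat \<Rightarrow> 'a" where
  "mu n k i j = \<iota> n (\<lambda>l\<in>{..2 ^ n}. if l = k then matrix_unit (q n l) i j else 0\<^sub>m (q n l) (q n l))"

lemma mu_in_B [simp]: "mu n k i j \<in> B n"
  and comp_mu: "l \<le> 2 ^ n \<Longrightarrow> comp n (mu n k i j) l =
    (if l = k then matrix_unit (q n l) i j else 0\<^sub>m (q n l) (q n l))"
  using iota_restrict[of n "\<lambda>l. if l = k then matrix_unit (q n l) i j else 0\<^sub>m (q n l) (q n l)" "mu n k i j"]
  by (simp_all add: mu_def)

lemma mu_mult_mult:
  assumes b: "b \<in> B n" and k: "k \<le> 2 ^ n" and ij: "i < q n k" "j < q n k"
  shows "mu n k i' i * b * mu n k j j' = (comp n b k $$ (i, j)) *\<^sub>C mu n k i' j'"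
proof (rule comp_eqI)
  fix l :: nat assume l: "l \<le> 2 ^ n"
  have *: "comp n (mu n k i' i * b * mu n k j j') l = comp n (mu n k i' i) l * comp n b l * comp n (mu n k j j') l"
    using b l by (simp add: comp_mult)
  show "comp n (mu n k i' i * b * mu n k j j') l = comp n ((comp n b k $$ (i, j)) *\<^sub>C mu n k i' j') l"
  proof (cases "l = k")
    case True
    have bk: "comp n b k \<in> carrier_mat (q n k) (q n k)" using b k by simp
    have "matrix_unit (q n k) i' i * comp n b k * matrix_unit (q n k) j j' = (comp n b k $$ (i, j)) \<cdot>\<^sub>m matrix_unit (q n k) i' j'"
    proof (rule eq_matI, goal_cases)
      case (1 x y)
      then have xy: "x < q n k" "y < q n k" by auto
      have "matrix_unit (q n k) i' i * comp n b k \<in> carrier_mat (q n k) (q n k)"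
        using bk by (rule mult_carrier_mat[OF matrix_unit_carrier])
      then show ?case
        using xy ij bk by (simp add: index_matrix_unit_mult del: index_mult_mat(1))
    qed (use b k in auto)
    with True k l * show ?thesis by (simp add: comp_mu comp_scaleC)
  next
    case False
    have "0\<^sub>m (q n l) (q n l) * comp n b l * 0\<^sub>m (q n l) (q n l) = (0\<^sub>m (q n l) (q n l) :: complex mat)"
      using b l by (simp add: right_mult_zero_mat[of _ "q n l" "q n l"] left_mult_zero_mat[of _ "q n l" "q n l"])
    then show ?thesis
      using False l * by (simp add: comp_mu comp_scaleC)
  qed
qed (use b in auto)

lemma mu_mult_mu: "k \<le> 2 ^ n \<Longrightarrow> j < q n k \<Longrightarrow> mu n k i j * mu n k j l = mu n k i l"
  using mu_mult_mult[of 1 n k j j i l] by (simp add: comp_one scaleC_one)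

lemma star_mu: "k \<le> 2 ^ n \<Longrightarrow> star (mu n k i j) = mu n k j i"
  by (rule comp_eqI[of _ n]) (auto simp: comp_star comp_mu star_complex_def intro!: eq_matI)

lemma mu_nonzero:
  assumes "k \<le> 2 ^ n" "i < q n k" "j < q n k"
  shows "mu n k i j \<noteq> 0"
proof
  assume "mu n k i j = 0"
  then have "matrix_unit (q n k) i j $$ (i, j) = 0\<^sub>m (q n k) (q n k) $$ (i, j)"
    using comp_mu[OF assms(1), of k i j] comp_zero[OF assms(1)] by simp
  then show False using assms by simp
qed

text \<open>The diagonal units are nonzero projections, so by the C*-identity their norm equals its
  own square. The others follow from
  \<open>star (mu n k i j) * mu n k i j = mu n k j j\<close>.\<close>

lemma norm_mu:
  assumes "k \<le> 2 ^ n" "i < q n k" "j < q n k"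
  shows "norm (mu n k i j) = 1"
proof -
  have "(norm (mu n k j j))\<^sup>2 = norm (mu n k j j)"
    using norm_star_mult[of "mu n k j j"] assms by (simp add: star_mu mu_mult_mu)
  then have 1: "norm (mu n k j j) = 1"
    using mu_nonzero[OF assms(1,3,3)] by (simp add: power2_eq_square)
  have "(norm (mu n k i j))\<^sup>2 = norm (mu n k j j)"
    using norm_star_mult[of "mu n k i j"] assms by (simp add: star_mu mu_mult_mu)
  then show ?thesis using 1 by (metis norm_ge_zero one_power2 power2_eq_iff_nonneg zero_le_one)
qed

lemma norm_comp_le:
  assumes b: "b \<in> B n" and k: "k \<le> 2 ^ n" and ij: "i < q n k" "j < q n k"
  shows "cmod (comp n b k $$ (i, j)) \<le> norm b"
proof -
  have "cmod (comp n b k $$ (i, j)) = norm (mu n k i i * b * mu n k j j)"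
    by (simp add: mu_mult_mult[OF assms] norm_scaleC norm_mu k ij)
  also have "\<dots> \<le> norm (mu n k i i) * norm b * norm (mu n k j j)"
    by (intro order_trans[OF norm_mult_ineq] mult_right_mono norm_mult_ineq) simp
  finally show ?thesis by (simp add: norm_mu k ij)
qed

lemma B_expansion:
  assumes "b \<in> B n"
  shows "b = (\<Sum>k\<le>2 ^ n. \<Sum>i<q n k. \<Sum>j<q n k. (comp n b k $$ (i, j)) *\<^sub>C mu n k i j)"
proof (rule comp_eqI[of _ n])
  have s: "sum f I \<in> B n" if "\<And>i. i \<in> I \<Longrightarrow> f i \<in> B n" for f and I :: "nat set"
    by (rule star_subring_sum[OF B_subring]) (use that in auto)
  have cs: "comp n (sum f I) l $$ (x, y) = (\<Sum>i\<in>I. comp n (f i) l $$ (x, y))"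
    if "finite I" "\<And>i. i \<in> I \<Longrightarrow> f i \<in> B n" "l \<le> 2 ^ n" "x < q n l" "y < q n l" for f and I :: "nat set" and l x y
    using that by (induction I rule: finite_induct) (simp_all add: comp_zero comp_add s)
  show "(\<Sum>k\<le>2 ^ n. \<Sum>i<q n k. \<Sum>j<q n k. (comp n b k $$ (i, j)) *\<^sub>C mu n k i j) \<in> B n"
    by (intro s) auto
  fix l :: nat assume l: "l \<le> 2 ^ n"
  show "comp n b l = comp n (\<Sum>k\<le>2 ^ n. \<Sum>i<q n k. \<Sum>j<q n k. (comp n b k $$ (i, j)) *\<^sub>C mu n k i j) l"
  proof (rule eq_matI, goal_cases)
    case (1 x y)
    have "(\<Sum>k\<le>2 ^ n. \<Sum>i<q n k. \<Sum>j<q n k. (comp n b k $$ (i, j)) *\<^sub>C mu n k i j) \<in> B n"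
      by (intro s) auto
    with 1 l have xy: "x < q n l" "y < q n l" by auto
    have "comp n (\<Sum>k\<le>2 ^ n. \<Sum>i<q n k. \<Sum>j<q n k. (comp n b k $$ (i, j)) *\<^sub>C mu n k i j) l $$ (x, y)
        = (\<Sum>k\<le>2 ^ n. \<Sum>i<q n k. \<Sum>j<q n k. comp n ((comp n b k $$ (i, j)) *\<^sub>C mu n k i j) l $$ (x, y))"
      using l xy by (simp add: cs s)
    also have "\<dots> = (\<Sum>k\<le>2 ^ n. if k = l then comp n b l $$ (x, y) else 0)"
    proof (rule sum.cong, simp, goal_cases)
      case (1 k)
      show ?case
      proof (cases "k = l")
        case True
        have "(\<Sum>i<q n k. \<Sum>j<q n k. comp n ((comp n b k $$ (i, j)) *\<^sub>C mu n k i j) l $$ (x, y))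
          = (\<Sum>i<q n l. \<Sum>j<q n l. if j = y then (if i = x then comp n b l $$ (x, y) else 0) else 0)"
          unfolding True by (intro sum.cong[OF refl]) (use l xy in \<open>auto simp: comp_scaleC comp_mu\<close>)
        also have "\<dots> = comp n b l $$ (x, y)" using xy by simp
        finally show ?thesis using True by simp
      next
        case False
        then show ?thesis using l xy by (auto simp: comp_scaleC comp_mu intro!: sum.neutral)
      qed
    qed
    also have "\<dots> = comp n b l $$ (x, y)" using l by simp
    finally show ?case by simp
  next
    case 2
    have "(\<Sum>k\<le>2 ^ n. \<Sum>i<q n k. \<Sum>j<q n k. (comp n b k $$ (i, j)) *\<^sub>C mu n k i j) \<in> B n"
      by (intro s) auto
    with l assms show ?case by simp
  next
    case 3
    have "(\<Sum>k\<le>2 ^ n. \<Sum>i<q n k. \<Sum>j<q n k. (comp n b k $$ (i, j)) *\<^sub>C mu n k i j) \<in> B n"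
      by (intro s) auto
    with l assms show ?case by simp
  qed
qed (use assms in auto)

lemma scaleC_minus_left: "(c - d) *\<^sub>C (x::'a) = c *\<^sub>C x - d *\<^sub>C x"
  using scaleC_add_left[of "c - d" d x] by (simp add: algebra_simps)

lemma tendsto_scaleC: "(f \<longlongrightarrow> c) F \<Longrightarrow> ((\<lambda>i. f i *\<^sub>C (x::'a)) \<longlongrightarrow> c *\<^sub>C x) F"
proof -
  assume "(f \<longlongrightarrow> c) F"
  then have "((\<lambda>i. norm (f i - c) * norm x) \<longlongrightarrow> 0 * norm x) F"
    by (intro tendsto_mult tendsto_const tendsto_norm_zero LIM_zero)
  then have "((\<lambda>i. norm (f i *\<^sub>C x - c *\<^sub>C x)) \<longlongrightarrow> 0) F"
    by (simp add: norm_scaleC flip: scaleC_minus_left)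
  then show ?thesis by (rule LIM_zero_cancel[OF tendsto_norm_zero_cancel])
qed

text \<open>The entries are contractive functionals, so a convergent sequence in \<open>B n\<close> has convergent
  entries.\<close>

lemma closed_B: "closed (B n)"
  unfolding closed_sequential_limits
proof (intro allI impI, elim conjE)
  fix f l assume f: "\<forall>m. f m \<in> B n" "f \<longlonglongrightarrow> l"
  have "\<exists>c. (\<lambda>m. comp n (f m) k $$ (i, j)) \<longlonglongrightarrow> c" if "k \<le> 2 ^ n" "i < q n k" "j < q n k" for k i j
  proof -
    have "Cauchy (\<lambda>m. comp n (f m) k $$ (i, j))"
    proof (rule metric_CauchyI)
      fix e :: real assume "e > 0"
      moreover have "Cauchy f" using f(2) by (rule LIMSEQ_imp_Cauchy)
      ultimately obtain M where M: "\<And>a b. a \<ge> M \<Longrightarrow> b \<ge> M \<Longrightarrow> dist (f a) (f b) < e"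
        by (meson metric_CauchyD)
      have "dist (comp n (f a) k $$ (i, j)) (comp n (f b) k $$ (i, j)) < e" if "a \<ge> M" "b \<ge> M" for a b
      proof -
        have "dist (comp n (f a) k $$ (i, j)) (comp n (f b) k $$ (i, j)) = cmod (comp n (f a - f b) k $$ (i, j))"
          using f \<open>k \<le> 2 ^ n\<close> \<open>i < q n k\<close> \<open>j < q n k\<close> by (simp add: comp_diff dist_norm)
        also have "\<dots> \<le> norm (f a - f b)"
          using f \<open>k \<le> 2 ^ n\<close> \<open>i < q n k\<close> \<open>j < q n k\<close> by (intro norm_comp_le) auto
        finally show ?thesis using M[OF that] by (simp add: dist_norm)
      qed
      then show "\<exists>M. \<forall>a\<ge>M. \<forall>b\<ge>M. dist (comp n (f a) k $$ (i, j)) (comp n (f b) k $$ (i, j)) < e"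
        by blast
    qed
    then show ?thesis using Cauchy_convergent_iff convergent_def by blast
  qed
  then obtain c where c: "\<And>k i j. k \<le> 2 ^ n \<Longrightarrow> i < q n k \<Longrightarrow> j < q n k \<Longrightarrow>
      (\<lambda>m. comp n (f m) k $$ (i, j)) \<longlonglongrightarrow> c k i j"
    by metis
  \<comment> \<open>By \<open>B_expansion\<close> this sequence is \<open>f\<close> itself, so the
    limit of \<open>f\<close> is a combination of matrix units.\<close>
  have "(\<lambda>m. \<Sum>k\<le>2 ^ n. \<Sum>i<q n k. \<Sum>j<q n k. (comp n (f m) k $$ (i, j)) *\<^sub>C mu n k i j)
    \<longlonglongrightarrow> (\<Sum>k\<le>2 ^ n. \<Sum>i<q n k. \<Sum>j<q n k. c k i j *\<^sub>C mu n k i j)"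
    by (intro tendsto_sum tendsto_scaleC c) auto
  then have "f \<longlonglongrightarrow> (\<Sum>k\<le>2 ^ n. \<Sum>i<q n k. \<Sum>j<q n k. c k i j *\<^sub>C mu n k i j)"
    using B_expansion f(1) by simp
  then have "l = (\<Sum>k\<le>2 ^ n. \<Sum>i<q n k. \<Sum>j<q n k. c k i j *\<^sub>C mu n k i j)"
    using f(2) LIMSEQ_unique by blast
  moreover have "\<dots> \<in> B n"
    by (intro star_subring_sum[OF B_subring]) auto
  ultimately show "l \<in> B n" by simp
qed

end

section \<open>Bounded traces at the dyadic vertices\<close>

context pascal_limit begin

definition tr :: "nat \<Rightarrow> nat \<Rightarrow> 'a \<Rightarrow> complex" where
  "tr n k b = mtrace (\<lambda>x. x) (comp n b k)"

lemma tr_sum: "b \<in> B n \<Longrightarrow> k \<le> 2 ^ n \<Longrightarrow> tr n k b = (\<Sum>i<q n k. comp n b k $$ (i, i))"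
  by (simp add: tr_def mtrace_def)

lemma comp_shift: "b \<in> B n \<Longrightarrow> k \<le> 2 ^ n \<Longrightarrow> comp (n + d) b (k * 2 ^ d) = comp n b k"
proof (induction d)
  case (Suc d)
  have b: "b \<in> B (n + d)" using Suc B_mono[of n "n + d"] by auto
  have k: "k * 2 ^ d \<le> 2 ^ (n + d)" using Suc by (simp add: power_add)
  have "comp (n + Suc d) b (k * 2 ^ Suc d) = embed (n + d) (comp (n + d) b) (2 * (k * 2 ^ d))"
    using comp_Suc[OF b] by (simp add: mult_ac)
  then show ?case using Suc embed_even[OF k] by simp
qed simp

lemma comp_level:
  assumes "b \<in> B m" "m \<le> m'" "n \<le> m" "k \<le> 2 ^ n"
  shows "comp m' b (k * 2 ^ (m' - n)) = comp m b (k * 2 ^ (m - n))"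
proof -
  have "k * 2 ^ (m - n) \<le> 2 ^ n * 2 ^ (m - n)" using assms by (intro mult_right_mono) auto
  then have "k * 2 ^ (m - n) \<le> 2 ^ m" using assms by (simp flip: power_add)
  from comp_shift[OF assms(1) this, of "m' - m"] show ?thesis
    using assms by (simp add: mult.assoc flip: power_add)
qed

lemma vertex_le: "k \<le> 2 ^ n \<Longrightarrow> n \<le> m \<Longrightarrow> k * 2 ^ (m - n) \<le> (2 ^ m :: nat)"
proof -
  assume "k \<le> 2 ^ n" "n \<le> m"
  then have "k * 2 ^ (m - n) \<le> 2 ^ n * 2 ^ (m - n)" by (intro mult_right_mono) auto
  with \<open>n \<le> m\<close> show ?thesis by (simp flip: power_add)
qed

lemma q_vertex: "n \<le> m \<Longrightarrow> q m (k * 2 ^ (m - n)) = q n k"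
  using q_mult_power[of n "m - n" k] by simp

lemma tr_odd:
  assumes "b \<in> B n" "k < 2 ^ n"
  shows "tr (Suc n) (Suc (2 * k)) b = tr n k b + tr n (Suc k) b"
  using assms by (simp add: tr_def comp_Suc embed_odd mtrace_dsum)

lemma tr_add: "a \<in> B n \<Longrightarrow> b \<in> B n \<Longrightarrow> k \<le> 2 ^ n \<Longrightarrow> tr n k (a + b) = tr n k a + tr n k b"
  by (simp add: tr_sum comp_add sum.distrib)

lemma tr_diff: "a \<in> B n \<Longrightarrow> b \<in> B n \<Longrightarrow> k \<le> 2 ^ n \<Longrightarrow> tr n k (a - b) = tr n k a - tr n k b"
  by (simp add: tr_sum comp_diff sum_subtractf)

lemma tr_scaleC: "a \<in> B n \<Longrightarrow> k \<le> 2 ^ n \<Longrightarrow> tr n k (c *\<^sub>C a) = c * tr n k a"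
  by (simp add: tr_sum comp_scaleC sum_distrib_left)

lemma tr_mult_commute: "a \<in> B n \<Longrightarrow> b \<in> B n \<Longrightarrow> k \<le> 2 ^ n \<Longrightarrow> tr n k (a * b) = tr n k (b * a)"
  unfolding tr_def by (simp add: comp_mult mtrace_mult_commute[of _ _ "q n k" "q n k"])

lemma norm_tr_le: "b \<in> B n \<Longrightarrow> k \<le> 2 ^ n \<Longrightarrow> cmod (tr n k b) \<le> real (q n k) * norm b"
  using sum_norm_bound[of "{..<q n k}" "\<lambda>i. comp n b k $$ (i, i)" "norm b"]
  by (simp add: tr_sum norm_comp_le)

definition UB :: "'a set" where "UB = (\<Union>n. B n)"

lemma UB_common:
  assumes "a \<in> UB" "b \<in> UB"
  obtains m where "n \<le> m" "a \<in> B m" "b \<in> B m"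
proof -
  obtain i j where "a \<in> B i" "b \<in> B j" using assms by (auto simp: UB_def)
  then show ?thesis
    using B_mono[of i "i + j + n"] B_mono[of j "i + j + n"] by (intro that[of "i + j + n"]) auto
qed

lemma UB_closure: "closure UB = UNIV"
  using dense by (simp add: UB_def B_def)

lemma UB_approx:
  obtains f where "\<And>i. f i \<in> UB" "f \<longlonglongrightarrow> x"
  using UB_closure closure_sequential[of x UB] by auto

text \<open>\<open>LEAST\<close> picks one floor that contains \<open>b\<close> and is high enough
  to have the vertex \<open>k / 2 ^ n\<close>; by \<open>T0_eq\<close> every such floor gives the
  same value.\<close>

definition T0 :: "nat \<Rightarrow> nat \<Rightarrow> 'a \<Rightarrow> complex" where
  "T0 n k b = (let m = (LEAST m. n \<le> m \<and> b \<in> B m) in tr m (k * 2 ^ (m - n)) b)"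

lemma T0_eq:
  assumes "b \<in> B m" "n \<le> m" "k \<le> 2 ^ n"
  shows "T0 n k b = tr m (k * 2 ^ (m - n)) b"
proof -
  define l where "l = (LEAST m. n \<le> m \<and> b \<in> B m)"
  have l: "n \<le> l \<and> b \<in> B l" unfolding l_def by (rule LeastI[of _ m]) (use assms in auto)
  have "l \<le> m" unfolding l_def by (rule Least_le) (use assms in auto)
  have "T0 n k b = tr l (k * 2 ^ (l - n)) b"
    unfolding T0_def Let_def l_def ..
  also have "\<dots> = tr m (k * 2 ^ (m - n)) b"
    unfolding tr_def using l \<open>l \<le> m\<close> assms comp_level[of b l m n k] by simp
  finally show ?thesis .
qed

text \<open>The block at \<open>k * 2 ^ (m - n)\<close> has size \<open>q n k\<close> on every floor
  \<open>m\<close>, so the constant does not depend on the floor where \<open>a\<close> and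
  \<open>b\<close> meet. This allows the extension to the closure.\<close>

lemma T0_lipschitz:
  assumes k: "k \<le> 2 ^ n" and "a \<in> UB" "b \<in> UB"
  shows "dist (T0 n k a) (T0 n k b) \<le> real (q n k) * dist a b"
proof -
  obtain m where m: "n \<le> m" "a \<in> B m" "b \<in> B m" using UB_common[OF assms(2,3)] .
  then show ?thesis
    using norm_tr_le[of "a - b" m "k * 2 ^ (m - n)"] k
    by (simp add: T0_eq dist_norm tr_diff vertex_le q_vertex)
qed

definition T :: "nat \<Rightarrow> nat \<Rightarrow> 'a \<Rightarrow> complex" where
  "T n k = (SOME f. continuous_on UNIV f \<and> (\<forall>b\<in>UB. f b = T0 n k b))"

lemma T:
  assumes k: "k \<le> 2 ^ n"
  shows "continuous_on UNIV (T n k)" "b \<in> UB \<Longrightarrow> T n k b = T0 n k b"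
proof -
  have u: "uniformly_continuous_on UB (T0 n k)"
    unfolding uniformly_continuous_on_def
  proof (intro allI impI)
    fix e :: real assume e: "0 < e"
    have qp: "0 < real (q n k)" using q_pos by simp
    show "\<exists>d>0. \<forall>x\<in>UB. \<forall>x'\<in>UB. dist x' x < d \<longrightarrow> dist (T0 n k x') (T0 n k x) < e"
    proof (intro exI[of _ "e / real (q n k)"] conjI ballI impI)
      fix x x' assume x: "x \<in> UB" "x' \<in> UB" "dist x' x < e / real (q n k)"
      then have "real (q n k) * dist x' x < e" using qp by (simp add: field_simps)
      with T0_lipschitz[OF k x(2,1)] show "dist (T0 n k x') (T0 n k x) < e" by linarith
    qed (use e qp in simp)
  qed
  obtain f where f: "uniformly_continuous_on (closure UB) f" "\<And>x. x \<in> UB \<Longrightarrow> T0 n k x = f x"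
    by (rule uniformly_continuous_on_extension_on_closure[OF u]) (rule that, assumption+)
  have "continuous_on UNIV f \<and> (\<forall>b\<in>UB. f b = T0 n k b)"
    using uniformly_continuous_imp_continuous[OF f(1)] f(2) by (simp add: UB_closure)
  then have "continuous_on UNIV (T n k) \<and> (\<forall>b\<in>UB. T n k b = T0 n k b)"
    unfolding T_def
    by (rule someI[where P = "\<lambda>f. continuous_on UNIV f \<and> (\<forall>b\<in>UB. f b = T0 n k b)"])
  then show "continuous_on UNIV (T n k)" "b \<in> UB \<Longrightarrow> T n k b = T0 n k b" by auto
qed

lemma T_level: "b \<in> B m \<Longrightarrow> n \<le> m \<Longrightarrow> k \<le> 2 ^ n \<Longrightarrow> T n k b = tr m (k * 2 ^ (m - n)) b"
  using T(2)[of k n b] T0_eq[of b m n k] by (auto simp: UB_def)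

lemma T_tr: "b \<in> B n \<Longrightarrow> k \<le> 2 ^ n \<Longrightarrow> T n k b = tr n k b"
  using T_level[of b n n k] by simp

lemma T_tendsto: "k \<le> 2 ^ n \<Longrightarrow> (f \<longlongrightarrow> x) F \<Longrightarrow> ((\<lambda>i. T n k (f i)) \<longlongrightarrow> T n k x) F"
  using continuous_on_tendsto_compose[OF T(1)] by fastforce

text \<open>Two approximating sequences can be matched term by term on a common floor, as high as
  desired, so an identity between continuous expressions need only be checked inside the stages.
  Identities in one variable are the case where \<open>F\<close> and \<open>G\<close> ignore
  \<open>y\<close>.\<close>

lemma density_principle:
  fixes F G :: "'a \<Rightarrow> 'a \<Rightarrow> complex"
  assumes F: "\<And>f g x y. f \<longlonglongrightarrow> x \<Longrightarrow> g \<longlonglongrightarrow> y \<Longrightarrow> (\<lambda>i. F (f i) (g i)) \<longlonglongrightarrow> F x y"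
    and G: "\<And>f g x y. f \<longlonglongrightarrow> x \<Longrightarrow> g \<longlonglongrightarrow> y \<Longrightarrow> (\<lambda>i. G (f i) (g i)) \<longlonglongrightarrow> G x y"
    and eq: "\<And>m x y. n \<le> m \<Longrightarrow> x \<in> B m \<Longrightarrow> y \<in> B m \<Longrightarrow> F x y = G x y"
  shows "F x y = G x y"
proof -
  obtain f where f: "\<And>i. f i \<in> UB" "f \<longlonglongrightarrow> x" using UB_approx[of x] by metis
  obtain g where g: "\<And>i. g i \<in> UB" "g \<longlonglongrightarrow> y" using UB_approx[of y] by metis
  have "F (f i) (g i) = G (f i) (g i)" for i
    using UB_common[OF f(1)[of i] g(1)[of i], of n] eq by metis
  then have "(\<lambda>i. F (f i) (g i)) \<longlonglongrightarrow> G x y" using G[OF f(2) g(2)] by simp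
  then show ?thesis using F[OF f(2) g(2)] LIMSEQ_unique by blast
qed

lemma T_add: "k \<le> 2 ^ n \<Longrightarrow> T n k (x + y) = T n k x + T n k y"
proof (rule density_principle[where F = "\<lambda>x y. T n k (x + y)" and G = "\<lambda>x y. T n k x + T n k y" and n = n])
  fix m x y assume "k \<le> 2 ^ n" "n \<le> m" "x \<in> B m" "y \<in> B m"
  then show "T n k (x + y) = T n k x + T n k y"
    by (simp add: T_level[of _ m] tr_add vertex_le)
qed (auto intro!: tendsto_add T_tendsto)

lemma T_mult_commute: "k \<le> 2 ^ n \<Longrightarrow> T n k (x * y) = T n k (y * x)"
proof (rule density_principle[where F = "\<lambda>x y. T n k (x * y)" and G = "\<lambda>x y. T n k (y * x)" and n = n])
  fix m x y assume "k \<le> 2 ^ n" "n \<le> m" "x \<in> B m" "y \<in> B m"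
  then show "T n k (x * y) = T n k (y * x)"
    using tr_mult_commute[of x m y "k * 2 ^ (m - n)"] by (simp add: T_level[of _ m] vertex_le)
qed (auto intro!: tendsto_mult T_tendsto)

lemma scaleC_minus_right: "c *\<^sub>C (x - y) = c *\<^sub>C x - c *\<^sub>C (y::'a)"
  using scaleC_add_right[of c "x - y" y] by (simp add: algebra_simps)

lemma tendsto_scaleC_right: "(f \<longlongrightarrow> x) F \<Longrightarrow> ((\<lambda>i. c *\<^sub>C f i) \<longlongrightarrow> c *\<^sub>C (x::'a)) F"
proof -
  assume "(f \<longlongrightarrow> x) F"
  then have "((\<lambda>i. cmod c * norm (f i - x)) \<longlongrightarrow> cmod c * 0) F"
    by (intro tendsto_mult tendsto_const tendsto_norm_zero LIM_zero)
  then have "((\<lambda>i. norm (c *\<^sub>C f i - c *\<^sub>C x)) \<longlongrightarrow> 0) F"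
    by (simp add: norm_scaleC flip: scaleC_minus_right)
  then show ?thesis by (rule LIM_zero_cancel[OF tendsto_norm_zero_cancel])
qed

lemma T_scaleC: "k \<le> 2 ^ n \<Longrightarrow> T n k (c *\<^sub>C x) = c * T n k x"
proof (rule density_principle[where F = "\<lambda>x y. T n k (c *\<^sub>C x)" and G = "\<lambda>x y. c * T n k x" and n = n])
  fix m x assume "k \<le> 2 ^ n" "n \<le> m" "x \<in> B m"
  then show "T n k (c *\<^sub>C x) = c * T n k x"
    by (simp add: T_level[of _ m] tr_scaleC vertex_le)
qed (auto intro!: tendsto_mult tendsto_const T_tendsto tendsto_scaleC_right)

lemma T_even: "k \<le> 2 ^ n \<Longrightarrow> T (Suc n) (2 * k) x = T n k x"
proof (rule density_principle[where F = "\<lambda>x y. T (Suc n) (2 * k) x" and G = "\<lambda>x y. T n k x" and n = "Suc n"])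
  fix m x assume k: "k \<le> 2 ^ n" and m: "Suc n \<le> m" "x \<in> B m"
  then have "m - n = Suc (m - Suc n)" by simp
  then have eq: "2 * k * 2 ^ (m - Suc n) = k * 2 ^ (m - n)" by simp
  show "T (Suc n) (2 * k) x = T n k x"
    using T_level[OF m(2,1), of "2 * k"] T_level[OF m(2), of n k] k m unfolding eq by simp
qed (auto intro!: T_tendsto)

text \<open>Confined to \<open>B n\<close>, unlike \<open>T_even\<close>: the block
  \<open>2 * k + 1\<close> of a general element of floor \<open>n + 1\<close> is unrelated to its
  neighbours, and it is their direct sum only on the image of \<open>embed\<close>.\<close>

lemma T_odd:
  assumes "b \<in> B n" "k < 2 ^ n"
  shows "T (Suc n) (Suc (2 * k)) b = T n k b + T n (Suc k) b"
  using assms tr_odd[OF assms] by (simp add: T_tr B_Suc)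

text \<open>At the dyadic number 1 the summand has size \<open>q n (2 ^ n) = 1\<close> on every
  floor, so its trace is its only entry and hence a character.\<close>

definition chi :: "'a \<Rightarrow> complex" where "chi = T 0 1"

lemma q_last: "q n (2 ^ n) = 1"
  by (rule q_equations)

lemma chi_level:
  assumes "b \<in> B n"
  shows "chi b = comp n b (2 ^ n) $$ (0, 0)"
  using assms by (simp add: chi_def T_level[of b n] tr_sum q_last del: comp_dim)

lemma T_last: "T n (2 ^ n) = chi"
  by (induction n) (auto simp: chi_def T_even)

lemma chi_add: "chi (x + y) = chi x + chi y"
  by (simp add: chi_def T_add)

lemma chi_scaleC: "chi (c *\<^sub>C x) = c * chi x"
  by (simp add: chi_def T_scaleC)

lemma chi_tendsto: "(f \<longlongrightarrow> x) F \<Longrightarrow> ((\<lambda>i. chi (f i)) \<longlongrightarrow> chi x) F"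
  unfolding chi_def by (rule T_tendsto) auto

lemma chi_one [simp]: "chi 1 = 1"
  by (simp add: chi_level[OF B_one[of 0]] comp_one q_last)

lemma chi_mult: "chi (x * y) = chi x * chi y"
proof (rule density_principle[where F = "\<lambda>x y. chi (x * y)" and G = "\<lambda>x y. chi x * chi y" and n = 0])
  fix m x y assume "x \<in> B m" "y \<in> B m"
  then show "chi (x * y) = chi x * chi y"
    using index_mult_mat_sum[of "comp m x (2 ^ m)" 1 1 "comp m y (2 ^ m)" 1 0 0]
      comp_carrier[of x m "2 ^ m"] comp_carrier[of y m "2 ^ m"]
    by (simp add: chi_level[of _ m] comp_mult q_last del: index_mult_mat(1) comp_carrier)
qed (auto intro!: tendsto_intros chi_tendsto)

lemma chi_star: "chi (star x) = cnj (chi x)"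
proof (rule density_principle[where F = "\<lambda>x y. chi (star x)" and G = "\<lambda>x y. cnj (chi x)" and n = 0])
  fix m x assume "x \<in> B m"
  then show "chi (star x) = cnj (chi x)"
    by (simp add: chi_level[of _ m] comp_star q_last star_complex_def)
qed (auto intro!: tendsto_intros chi_tendsto tendsto_star)

lemma chi_hom: "star_hom chi"
  by (simp add: star_hom_def chi_add chi_mult chi_star star_complex_def)

lemma chi_diff: "chi (x - y) = chi x - chi y"
  using chi_add[of "x - y" y] by (simp add: algebra_simps)

lemma iota_floor_ideal: "\<iota> n ` floor_ideal n = {b \<in> B n. chi b = 0}"
proof (intro equalityI subsetI)
  fix b assume "b \<in> \<iota> n ` floor_ideal n"
  then obtain y where y: "y \<in> floor_alg n" "y (2 ^ n) = 0\<^sub>m (q n (2 ^ n)) (q n (2 ^ n))" "b = \<iota> n y"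
    by (auto simp: floor_ideal_def)
  then show "b \<in> {b \<in> B n. chi b = 0}"
    by (simp add: chi_level[of _ n] q_last)
next
  fix b assume b: "b \<in> {b \<in> B n. chi b = 0}"
  then have "comp n b (2 ^ n) = 0\<^sub>m (q n (2 ^ n)) (q n (2 ^ n))"
    by (intro eq_matI) (auto simp: chi_level[of _ n] q_last)
  then have "comp n b \<in> floor_ideal n" using b by (simp add: floor_ideal_def)
  then show "b \<in> \<iota> n ` floor_ideal n" using b by (metis (mono_tags, lifting) iota_comp imageI mem_Collect_eq)
qed

text \<open>An element of the kernel is approximated from the stages, and each approximant is
  corrected to \<open>f i - chi (f i) *\<^sub>C 1\<close>. The correction stays on its floor, lies
  in the kernel, and tends to 0 because \<open>chi a = 0\<close>.\<close>

lemma limit_ideal_eq_kernel: "limit_ideal \<iota> = {a. chi a = 0}"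
proof (intro equalityI subsetI)
  fix a assume "a \<in> limit_ideal \<iota>"
  then obtain f where f: "\<And>i. f i \<in> (\<Union>n. \<iota> n ` floor_ideal n)" "f \<longlonglongrightarrow> a"
    unfolding limit_ideal_def closure_sequential by auto
  have "chi (f i) = 0" for i using f(1)[of i] by (auto simp: iota_floor_ideal)
  then have "(\<lambda>i. 0) \<longlonglongrightarrow> chi a" using chi_tendsto[OF f(2)] by simp
  then have "chi a = 0" by (rule LIMSEQ_unique) (rule tendsto_const)
  then show "a \<in> {a. chi a = 0}" by simp
next
  fix a assume a: "a \<in> {a. chi a = 0}"
  obtain f where f: "\<And>i. f i \<in> UB" "f \<longlonglongrightarrow> a" using UB_approx[of a] by metis
  have "f i - chi (f i) *\<^sub>C 1 \<in> (\<Union>n. \<iota> n ` floor_ideal n)" for i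
  proof -
    obtain m where "f i \<in> B m" using f(1)[of i] by (auto simp: UB_def)
    then have "f i - chi (f i) *\<^sub>C 1 \<in> B m" by simp
    then show ?thesis by (auto simp: iota_floor_ideal chi_diff chi_scaleC)
  qed
  moreover have "(\<lambda>i. f i - chi (f i) *\<^sub>C 1) \<longlonglongrightarrow> a - chi a *\<^sub>C 1"
    by (intro tendsto_diff f tendsto_scaleC chi_tendsto)
  ultimately show "a \<in> limit_ideal \<iota>"
    unfolding limit_ideal_def closure_sequential using a
    by (intro exI[of _ "\<lambda>i. f i - chi (f i) *\<^sub>C 1"]) simp
qed

lemma closed_ideal_limit_ideal: "closed_ideal (limit_ideal \<iota>)"
proof -
  have "closed (limit_ideal \<iota>)" by (simp add: limit_ideal_def)
  moreover have "chi 0 = 0" using star_hom_zero[OF chi_hom] .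
  ultimately show ?thesis
    by (simp add: closed_ideal_def limit_ideal_eq_kernel chi_add chi_scaleC chi_mult)
qed

lemma codimension_one_limit_ideal: "codimension_one (limit_ideal \<iota>)"
  unfolding codimension_one_def limit_ideal_eq_kernel
  by (rule exI[of _ 1]) (auto simp: chi_diff chi_scaleC intro!: exI[of _ "chi _"])

end

section \<open>Classification of projections over the finite stages\<close>

lemma mat11_mult: "mat 1 1 (\<lambda>_. a) * mat 1 1 (\<lambda>_. b) = (mat 1 1 (\<lambda>_. a * b) :: 'a::semiring_0 mat)"
  by (rule eq_matI) (simp_all add: scalar_prod_def)

lemma mat11_adj: "adj (mat 1 1 (\<lambda>_. a)) = mat 1 1 (\<lambda>_. star a)"
  by (rule eq_matI) simp_all

lemma mat11_eq_iff: "mat 1 1 (\<lambda>_. a) = mat 1 1 (\<lambda>_. b) \<longleftrightarrow> a = b"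
  by (metis index_mat(1) less_numeral_extra(1))

lemma mat11_in_projs: "is_projection e \<Longrightarrow> e \<in> S \<Longrightarrow> mat 1 1 (\<lambda>_. e) \<in> projs S"
  by (rule projsI[of _ 1]) (auto simp: mat11_mult mat11_adj is_projection_def elements_mat_subset_iff simp del: One_nat_def)

text \<open>The hypothesis \<open>p * f = f\<close> says that \<open>f\<close> lies under
  \<open>p\<close>; its adjoint \<open>f * p = f\<close> makes the cross terms of the square
  collapse.\<close>

lemma proj_subtract:
  assumes S: "star_subring S" and p: "p \<in> projs S" "p \<in> carrier_mat N N"
    and f: "f \<in> projs S" "f \<in> carrier_mat N N" and pf: "p * f = f"
  shows "p - f \<in> projs S"
proof (rule projsI)
  have pp: "p * p = p" "adj p = p" "elements_mat p \<subseteq> S" and ff: "f * f = f" "adj f = f" "elements_mat f \<subseteq> S"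
    using p f by (auto simp: projs_def)
  have fp: "f * p = f" using arg_cong[OF pf, of adj] adj_mult[OF p(2) f(2)] by (simp add: pp ff)
  show pfc: "p - f \<in> carrier_mat N N" using f by (simp add: minus_carrier_mat)
  show "elements_mat (p - f) \<subseteq> S" by (rule elements_mat_minus[OF S p(2) f(2) pp(3) ff(3)])
  show "adj (p - f) = p - f" by (simp add: adj_minus[OF p(2) f(2)] pp ff)
  have "(p - f) * (p - f) = p * (p - f) - f * (p - f)"
    by (rule minus_mult_distrib_mat[OF p(2) f(2) pfc])
  also have "\<dots> = (p - f) - (f - f)"
    by (simp add: mult_minus_distrib_mat[OF p(2) p(2) f(2)] mult_minus_distrib_mat[OF f(2) p(2) f(2)] pp ff pf fp)
  also have "\<dots> = p - f" using p f by (intro eq_matI) auto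
  finally show "(p - f) * (p - f) = p - f" .
qed

lemma mtrace_minus:
  assumes "\<And>x y. t (x + y) = t x + t y" "p \<in> carrier_mat N N" "f \<in> carrier_mat N N"
  shows "mtrace t (p - f) = mtrace t p - mtrace t (f :: 'a::ab_group_add mat)"
proof -
  have "t (x - y) = t x - t y" for x y using assms(1)[of "x - y" y] by simp
  then show ?thesis using assms(2,3) by (simp add: mtrace_def sum_subtractf)
qed

text \<open>The partial isometry \<open>u + w v\<^sup>*\<close> glues \<open>u\<close> to the rank-one piece sending \<open>v\<close> to \<open>w\<close>.\<close>

lemma mvn_add_rank_one:
  assumes S: "star_subring S"
    and p: "p \<in> projs S" "p \<in> carrier_mat N N" and r: "r \<in> projs S" "r \<in> carrier_mat M M"
    and v: "v \<in> carrier_mat N 1" "elements_mat v \<subseteq> S" "adj v * v = E" "p * v = v" "v * E = v"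
    and w: "w \<in> carrier_mat M 1" "elements_mat w \<subseteq> S" "adj w * w = E" "r * w = w" "w * E = w"
    and u: "mvn S (p - v * adj v) (r - w * adj w)"
    and f: "v * adj v \<in> projs S" "w * adj w \<in> projs S"
  shows "mvn S p r"
proof -
  define p1 r1 where "p1 = p - v * adj v" and "r1 = r - w * adj w"
  have av: "adj v \<in> carrier_mat 1 N" and aw: "adj w \<in> carrier_mat 1 M" using v w by auto
  have E: "E \<in> carrier_mat 1 1" using v(1,3) by auto
  have vv: "v * adj v \<in> carrier_mat N N" using mult_carrier_mat[OF v(1) av] .
  have ww: "w * adj w \<in> carrier_mat M M" using mult_carrier_mat[OF w(1) aw] .
  have p1c: "p1 \<in> carrier_mat N N" and r1c: "r1 \<in> carrier_mat M M"
    using vv ww by (auto simp: p1_def r1_def minus_carrier_mat)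
  have pvv: "p * (v * adj v) = v * adj v" using assoc_mult_mat[OF p(2) v(1) av] v by simp
  have rww: "r * (w * adj w) = w * adj w" using assoc_mult_mat[OF r(2) w(1) aw] w by simp
  have p1: "p1 \<in> projs S" unfolding p1_def by (rule proj_subtract[OF S p f(1) vv pvv])
  have r1: "r1 \<in> projs S" unfolding r1_def by (rule proj_subtract[OF S r f(2) ww rww])
  obtain u where u: "u \<in> carrier_mat M N" "elements_mat u \<subseteq> S" "adj u * u = p1" "u * adj u = r1"
      "r1 * u = u" "u * p1 = u" "p1 * adj u = adj u" "adj u * r1 = adj u"
    using mvn_strong[OF S p1 p1c r1 r1c] u unfolding p1_def r1_def by metis
  have au: "adj u \<in> carrier_mat N M" using u by simp
  have z: "A - A = 0\<^sub>m a b" if "A \<in> carrier_mat a b" for A :: "'a mat" and a b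
    using that by (intro eq_matI) auto
  \<comment> \<open>Since \<open>u\<close> lives under \<open>p1\<close> and \<open>v\<close> is
    orthogonal to \<open>p1\<close>, and likewise on the other side for \<open>r1\<close> and
    \<open>w\<close>, all cross terms of \<open>adj U * U\<close> and \<open>U * adj U\<close>
    vanish.\<close>
  have p1v: "p1 * v = 0\<^sub>m N 1"
    unfolding p1_def using minus_mult_distrib_mat[OF p(2) vv v(1)] v assoc_mult_mat[OF v(1) av v(1)] z[OF v(1)] by simp
  have r1w: "r1 * w = 0\<^sub>m M 1"
    unfolding r1_def using minus_mult_distrib_mat[OF r(2) ww w(1)] w assoc_mult_mat[OF w(1) aw w(1)] z[OF w(1)] by simp
  have uv: "u * v = 0\<^sub>m M 1"
    using assoc_mult_mat[OF u(1) p1c v(1)] u(6) p1v u(1) by simp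
  have auw: "adj u * w = 0\<^sub>m N 1"
    using assoc_mult_mat[OF au r1c w(1)] u(8) r1w au by simp
  have avau: "adj v * adj u = 0\<^sub>m 1 M" using arg_cong[OF uv, of adj] adj_mult[OF u(1) v(1)] by simp
  have awu: "adj w * u = 0\<^sub>m 1 N" using arg_cong[OF auw, of adj] adj_mult[OF au w(1)] by simp
  have wv: "w * adj v \<in> carrier_mat M N" and vw: "v * adj w \<in> carrier_mat N M"
    using mult_carrier_mat[OF w(1) av] mult_carrier_mat[OF v(1) aw] by auto
  have awv: "adj (w * adj v) = v * adj w" using adj_mult[OF w(1) av] by simp
  define U where "U = u + w * adj v"
  have U: "U \<in> carrier_mat M N" using wv by (simp add: U_def)
  have aU: "adj U = adj u + v * adj w" unfolding U_def by (simp add: adj_add[OF u(1) wv] awv)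
  have 1: "adj u * (w * adj v) = 0\<^sub>m N N" using assoc_mult_mat[OF au w(1) av] auw av by simp
  have 2: "(v * adj w) * u = 0\<^sub>m N N" using assoc_mult_mat[OF v(1) aw u(1)] awu v by simp
  have 3: "(v * adj w) * (w * adj v) = v * adj v"
    using assoc_mult_mat[OF v(1) aw wv] assoc_mult_mat[OF aw w(1) av] assoc_mult_mat[OF v(1) E av] v w by simp
  have "adj U * U = p1 + v * adj v"
    unfolding aU unfolding U_def
    using add_mult_distrib_mat[OF au vw, of "u + w * adj v" N] mult_add_distrib_mat[OF au u(1) wv]
      mult_add_distrib_mat[OF vw u(1) wv] u(1) wv vv p1c by (simp add: 1 2 3 u(3) del: assoc_mult_mat)
  also have "\<dots> = p" unfolding p1_def using p vv by (intro eq_matI) auto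
  finally have UU: "adj U * U = p" .
  have 4: "u * (v * adj w) = 0\<^sub>m M M" using assoc_mult_mat[OF u(1) v(1) aw] uv aw by simp
  have 5: "(w * adj v) * adj u = 0\<^sub>m M M" using assoc_mult_mat[OF w(1) av au] avau w by simp
  have 6: "(w * adj v) * (v * adj w) = w * adj w"
    using assoc_mult_mat[OF w(1) av vw] assoc_mult_mat[OF av v(1) aw] assoc_mult_mat[OF w(1) E aw] v w by simp
  have "U * adj U = r1 + w * adj w"
    unfolding aU unfolding U_def
    using add_mult_distrib_mat[OF u(1) wv, of "adj u + v * adj w" M] mult_add_distrib_mat[OF u(1) au vw]
      mult_add_distrib_mat[OF wv au vw] au vw ww r1c by (simp add: 4 5 6 u(4) del: assoc_mult_mat)
  also have "\<dots> = r" unfolding r1_def using r ww by (intro eq_matI) auto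
  finally have UU': "U * adj U = r" .
  have "elements_mat U \<subseteq> S" unfolding U_def
    by (intro elements_mat_add[OF S u(1) wv u(2)] elements_mat_mult[OF S w(1) av w(2)] elements_mat_adj[OF S] v)
  then show ?thesis
    unfolding mvn_def using U UU UU' p(2) r(2) by (intro bexI[of _ U]) auto
qed

context pascal_limit begin

definition mt :: "nat \<Rightarrow> nat \<Rightarrow> 'a mat \<Rightarrow> complex" where
  "mt n k p = mtrace (T n k) p"

lemma comp_sum:
  assumes "finite I" "\<And>i. i \<in> I \<Longrightarrow> f i \<in> B n" "k \<le> 2 ^ n" "x < q n k" "y < q n k"
  shows "comp n (sum f I) k $$ (x, y) = (\<Sum>i\<in>I. comp n (f i) k $$ (x, y))"
  using assms
  by (induction I rule: finite_induct) (simp_all add: comp_zero comp_add star_subring_sum[OF B_subring])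

lemma mt_mvn: "k \<le> 2 ^ n \<Longrightarrow> mvn S p r \<Longrightarrow> mt n k p = mt n k r"
  unfolding mt_def by (rule mtrace_mvn) (auto intro: T_add T_mult_commute)

lemma mt_dsum: "p \<in> projs S \<Longrightarrow> r \<in> projs S' \<Longrightarrow> mt n k (p \<boxplus> r) = mt n k p + mt n k r"
  unfolding mt_def by (rule mtrace_dsum) (auto simp: projs_def)

lemma mt_minus: "k \<le> 2 ^ n \<Longrightarrow> p \<in> carrier_mat N N \<Longrightarrow> f \<in> carrier_mat N N \<Longrightarrow> mt n k (p - f) = mt n k p - mt n k f"
  unfolding mt_def by (rule mtrace_minus) (auto intro: T_add)

lemma mt_eq_sum:
  assumes "p \<in> projs (B n)" "p \<in> carrier_mat N N" "k \<le> 2 ^ n"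
  shows "mt n k p = (\<Sum>r<N. \<Sum>a<q n k. comp n (p $$ (r, r)) k $$ (a, a))"
proof -
  have "p $$ (r, r) \<in> B n" if "r < N" for r
    using assms that by (auto simp: projs_def elements_mat_subset_iff)
  then show ?thesis using assms by (simp add: mt_def mtrace_def T_tr tr_sum)
qed

text \<open>Reading \<open>p = p * adj p\<close> on the diagonal gives a sum of squares along a row.
  Hence traces are nonnegative, and a vanishing trace kills the whole block of every entry.\<close>

lemma proj_diagonal:
  assumes "p \<in> projs (B n)" "p \<in> carrier_mat N N" "k \<le> 2 ^ n" "r < N" "a < q n k"
  shows "comp n (p $$ (r, r)) k $$ (a, a)
    = of_real (\<Sum>j<N. \<Sum>b<q n k. (cmod (comp n (p $$ (r, j)) k $$ (a, b)))\<^sup>2)"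
proof -
  have pB: "p $$ (i, j) \<in> B n" if "i < N" "j < N" for i j
    using assms that by (auto simp: projs_def elements_mat_subset_iff)
  have pp: "p * adj p = p" using assms by (auto simp: projs_def)
  have "p $$ (r, r) = (p * adj p) $$ (r, r)" by (simp only: pp)
  also have "\<dots> = (\<Sum>j<N. p $$ (r, j) * star (p $$ (r, j)))"
    using assms by (subst index_mult_mat_sum[of _ N N _ N]) auto
  finally have eq: "p $$ (r, r) = (\<Sum>j<N. p $$ (r, j) * star (p $$ (r, j)))" .
  have "comp n (p $$ (r, r)) k $$ (a, a) = (\<Sum>j<N. comp n (p $$ (r, j) * star (p $$ (r, j))) k $$ (a, a))"
    unfolding eq by (rule comp_sum) (use assms pB in auto)
  also have "\<dots> = (\<Sum>j<N. \<Sum>b<q n k. of_real ((cmod (comp n (p $$ (r, j)) k $$ (a, b)))\<^sup>2))"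
  proof (rule sum.cong[OF refl], goal_cases)
    case (1 j)
    then have x: "p $$ (r, j) \<in> B n" using pB assms by simp
    show ?case
      unfolding comp_mult[OF x B_star[OF x] assms(3)] comp_star[OF x assms(3)] using x assms
      by (subst index_mult_mat_sum[of _ "q n k" "q n k" _ "q n k"])
        (auto simp: star_complex_def complex_norm_square simp del: of_real_power)
  qed
  finally show ?thesis by simp
qed

lemma mt_nonneg:
  assumes "p \<in> projs (B n)" "p \<in> carrier_mat N N" "k \<le> 2 ^ n"
  shows "mt n k p = of_real (\<Sum>r<N. \<Sum>a<q n k. \<Sum>j<N. \<Sum>b<q n k. (cmod (comp n (p $$ (r, j)) k $$ (a, b)))\<^sup>2)"
  using assms by (simp add: mt_eq_sum[OF assms] proj_diagonal[OF assms])

lemma mt_Re_nonneg: "p \<in> projs (B n) \<Longrightarrow> k \<le> 2 ^ n \<Longrightarrow> 0 \<le> Re (mt n k p)"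
  by (erule projsE) (auto simp: mt_nonneg projsI intro!: sum_nonneg)

lemma mt_zero_imp:
  assumes "p \<in> projs (B n)" "p \<in> carrier_mat N N" "k \<le> 2 ^ n" "mt n k p = 0" "r < N" "j < N"
  shows "comp n (p $$ (r, j)) k = 0\<^sub>m (q n k) (q n k)"
proof (rule eq_matI)
  fix a b assume "a < dim_row (0\<^sub>m (q n k) (q n k))" "b < dim_col (0\<^sub>m (q n k) (q n k))"
  then have ab: "a < q n k" "b < q n k" by auto
  have "(\<Sum>r<N. \<Sum>a<q n k. \<Sum>j<N. \<Sum>b<q n k. (cmod (comp n (p $$ (r, j)) k $$ (a, b)))\<^sup>2) = 0"
    using mt_nonneg[OF assms(1-3)] assms(4) by (metis of_real_eq_0_iff)
  then have "(\<Sum>a<q n k. \<Sum>j<N. \<Sum>b<q n k. (cmod (comp n (p $$ (r, j)) k $$ (a, b)))\<^sup>2) = 0"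
    using assms(5) by (subst (asm) sum_nonneg_eq_0_iff) (auto intro!: sum_nonneg)
  then have "(\<Sum>j<N. \<Sum>b<q n k. (cmod (comp n (p $$ (r, j)) k $$ (a, b)))\<^sup>2) = 0"
    using ab by (subst (asm) sum_nonneg_eq_0_iff) (auto intro!: sum_nonneg)
  then have "(\<Sum>b<q n k. (cmod (comp n (p $$ (r, j)) k $$ (a, b)))\<^sup>2) = 0"
    using assms(6) by (subst (asm) sum_nonneg_eq_0_iff) (auto intro!: sum_nonneg)
  then have "(cmod (comp n (p $$ (r, j)) k $$ (a, b)))\<^sup>2 = 0"
    using ab by (subst (asm) sum_nonneg_eq_0_iff) auto
  then show "comp n (p $$ (r, j)) k $$ (a, b) = 0\<^sub>m (q n k) (q n k) $$ (a, b)" using ab by simp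
next
  have "p $$ (r, j) \<in> B n" using assms by (auto simp: projs_def elements_mat_subset_iff)
  then show "dim_row (comp n (p $$ (r, j)) k) = dim_row (0\<^sub>m (q n k) (q n k))"
    "dim_col (comp n (p $$ (r, j)) k) = dim_col (0\<^sub>m (q n k) (q n k))" using assms by auto
qed

lemma mt_all_zero:
  assumes "p \<in> projs (B n)" "p \<in> carrier_mat N N" "\<And>k. k \<le> 2 ^ n \<Longrightarrow> mt n k p = 0"
  shows "p = 0\<^sub>m N N"
proof (rule eq_matI)
  fix r j assume "r < dim_row (0\<^sub>m N N :: 'a mat)" "j < dim_col (0\<^sub>m N N :: 'a mat)"
  then have rj: "r < N" "j < N" by auto
  have "p $$ (r, j) \<in> B n" using assms rj by (auto simp: projs_def elements_mat_subset_iff)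
  then have "p $$ (r, j) = 0"
    using mt_zero_imp[OF assms(1,2) _ assms(3) rj] by (intro comp_eqI[of _ n]) (auto simp: comp_zero)
  then show "p $$ (r, j) = 0\<^sub>m N N $$ (r, j)" using rj by simp
qed (use assms in auto)

definition mproj :: "nat \<Rightarrow> nat \<Rightarrow> 'a mat" where
  "mproj n k = mat 1 1 (\<lambda>_. mu n k 0 0)"

lemma mproj_in_projs: "k \<le> 2 ^ n \<Longrightarrow> mproj n k \<in> projs (B n)"
  unfolding mproj_def by (rule mat11_in_projs) (auto simp: is_projection_def mu_mult_mu star_mu q_pos)

lemma mt_mproj:
  assumes "k \<le> 2 ^ n" "j \<le> 2 ^ n"
  shows "mt n j (mproj n k) = (if j = k then 1 else 0)"
proof -
  have "mt n j (mproj n k) = (\<Sum>i<q n j. if i = 0 then (if j = k then 1 else 0) else 0)"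
    using assms by (auto simp: mt_def mproj_def mtrace_def T_tr tr_sum comp_mu intro!: sum.cong)
  also have "\<dots> = (if j = k then 1 else 0)" using q_pos[of n j] by simp
  finally show ?thesis .
qed

text \<open>Provides the rank-one subprojection \<open>v * adj v\<close> of \<open>p\<close>,
  equivalent to the minimal projection at \<open>k\<close>, that the inductions on the trace split
  off.\<close>

lemma exists_minimal_column:
  assumes p: "p \<in> projs (B n)" "p \<in> carrier_mat N N" and k: "k \<le> 2 ^ n" and nz: "mt n k p \<noteq> 0"
  obtains v where "v \<in> carrier_mat N 1" "elements_mat v \<subseteq> B n" "adj v * v = mproj n k"
    "p * v = v" "v * mproj n k = v"
proof -
  have pB: "p $$ (i, j) \<in> B n" if "i < N" "j < N" for i j
    using p that by (auto simp: projs_def elements_mat_subset_iff)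
  have pp: "p * p = p" "adj p = p" "adj p * p = p" using p by (auto simp: projs_def)
  obtain r a where ra: "r < N" "a < q n k" "comp n (p $$ (r, r)) k $$ (a, a) \<noteq> 0"
    using nz unfolding mt_eq_sum[OF p k] by (meson lessThan_iff sum.neutral)
  define s where "s = (\<Sum>j<N. \<Sum>b<q n k. (cmod (comp n (p $$ (r, j)) k $$ (a, b)))\<^sup>2)"
  have cs: "comp n (p $$ (r, r)) k $$ (a, a) = of_real s"
    unfolding s_def by (rule proj_diagonal[OF p k ra(1,2)])
  have "0 \<le> s" by (auto simp: s_def intro!: sum_nonneg)
  with ra(3) cs have s: "0 < s" by auto
  \<comment> \<open>Column \<open>r\<close> of \<open>p\<close>, cut down by a matrix unit and
    normalised. Columns of \<open>p\<close> are fixed by \<open>p\<close>, and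
    \<open>adj v * v\<close> reduces to \<open>p $$ (r, r)\<close> compressed to its entry
    \<open>s\<close> at \<open>(a, a)\<close>, divided by \<open>s\<close>.\<close>
  define v where "v = mat N 1 (\<lambda>(i, _). (1 / sqrt s) *\<^sub>R (p $$ (i, r) * mu n k a 0))"
  have v: "v \<in> carrier_mat N 1" by (simp add: v_def)
  have vi: "v $$ (i, 0) = (1 / sqrt s) *\<^sub>R (p $$ (i, r) * mu n k a 0)" if "i < N" for i
    using that by (simp add: v_def)
  have vB: "elements_mat v \<subseteq> B n"
    unfolding elements_mat_subset_iff v_def using pB ra by auto
  have "(adj v * v) $$ (0, 0) = (\<Sum>i<N. star (v $$ (i, 0)) * v $$ (i, 0))"
    using v by (subst index_mult_mat_sum[of _ 1 N _ 1]) auto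
  also have "\<dots> = (\<Sum>i<N. (1 / s) *\<^sub>R (mu n k 0 a * (star (p $$ (i, r)) * p $$ (i, r)) * mu n k a 0))"
    using s by (intro sum.cong[OF refl]) (simp add: vi star_scaleR star_mult star_mu k mult.assoc)
  also have "\<dots> = (1 / s) *\<^sub>R (mu n k 0 a * (\<Sum>i<N. star (p $$ (i, r)) * p $$ (i, r)) * mu n k a 0)"
    by (simp add: scaleR_sum_right sum_distrib_left sum_distrib_right)
  also have "(\<Sum>i<N. star (p $$ (i, r)) * p $$ (i, r)) = (adj p * p) $$ (r, r)"
    using p ra by (subst index_mult_mat_sum[of _ N N _ N]) auto
  also have "mu n k 0 a * (adj p * p) $$ (r, r) * mu n k a 0 = of_real s *\<^sub>C mu n k 0 0"
    unfolding pp(3) by (subst mu_mult_mult[OF pB[OF ra(1,1)] k ra(2,2)]) (simp add: cs)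
  also have "(1 / s) *\<^sub>R (complex_of_real s *\<^sub>C mu n k 0 0) = mu n k 0 0"
    using s by (simp flip: scaleR_scaleC)
  finally have 1: "adj v * v = mproj n k"
    using v by (intro eq_matI) (auto simp: mproj_def)
  have 2: "p * v = v"
  proof (rule eq_matI)
    fix i j assume "i < dim_row v" "j < dim_col v"
    then have ij: "i < N" "j = 0" using v by auto
    have "(p * v) $$ (i, 0) = (\<Sum>l<N. p $$ (i, l) * v $$ (l, 0))"
      using index_mult_mat_sum[OF p(2) v ij(1)] by simp
    also have "\<dots> = (1 / sqrt s) *\<^sub>R ((\<Sum>l<N. p $$ (i, l) * p $$ (l, r)) * mu n k a 0)"
      by (simp add: vi scaleR_sum_right sum_distrib_right mult.assoc)
    also have "(\<Sum>l<N. p $$ (i, l) * p $$ (l, r)) = (p * p) $$ (i, r)"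
      using index_mult_mat_sum[OF p(2,2) ij(1) ra(1)] by simp
    finally show "(p * v) $$ (i, j) = v $$ (i, j)" using ij by (simp add: pp vi)
  qed (use p v in auto)
  have 3: "v * mproj n k = v"
  proof (rule eq_matI)
    fix i j assume "i < dim_row v" "j < dim_col v"
    then have ij: "i < N" "j = 0" using v by auto
    have "(v * mproj n k) $$ (i, 0) = v $$ (i, 0) * mu n k 0 0"
      using ij v by (subst index_mult_mat_sum[of _ N 1 _ 1]) (auto simp: mproj_def)
    then show "(v * mproj n k) $$ (i, j) = v $$ (i, j)"
      using ij by (simp add: vi mult.assoc mu_mult_mu k q_pos)
  qed (use v in \<open>auto simp: mproj_def\<close>)
  show ?thesis by (rule that[OF v vB 1 2 3])
qed

lemma minimal_column_proj:
  assumes v: "v \<in> carrier_mat N 1" "elements_mat v \<subseteq> B n" "adj v * v = mproj n k" "v * mproj n k = v"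
    and k: "k \<le> 2 ^ n"
  shows "v * adj v \<in> projs (B n)" "j \<le> 2 ^ n \<Longrightarrow> mt n j (v * adj v) = (if j = k then 1 else 0)"
proof -
  have av: "adj v \<in> carrier_mat 1 N" using v by simp
  have vv: "v * adj v \<in> carrier_mat N N" using mult_carrier_mat[OF v(1) av] .
  have "(v * adj v) * (v * adj v) = (v * (adj v * v)) * adj v"
    using assoc_mult_mat[OF v(1) av vv] assoc_mult_mat[OF av v(1) av]
      assoc_mult_mat[OF v(1) mult_carrier_mat[OF av v(1)] av] by simp
  then have "(v * adj v) * (v * adj v) = v * adj v" by (simp only: v)
  then show p: "v * adj v \<in> projs (B n)"
    using adj_mult[OF v(1) av] by (intro projsI[OF vv] elements_mat_mult[OF B_subring v(1) av v(2)]
        elements_mat_adj[OF B_subring v(2)]) auto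
  assume j: "j \<le> 2 ^ n"
  have "mvn UNIV (mproj n k) (v * adj v)"
    unfolding mvn_def using v by (intro bexI[of _ v]) (auto simp: mproj_def)
  then show "mt n j (v * adj v) = (if j = k then 1 else 0)"
    using mt_mvn[OF j, of UNIV "mproj n k"] mt_mproj[OF k j] by simp
qed

text \<open>Splitting off a rank-one subprojection lowers the trace by 1. The trace is never
  negative, so a descent along a natural upper bound must end at 0.\<close>

lemma mt_nat:
  assumes "p \<in> projs (B n)" "k \<le> 2 ^ n"
  shows "mt n k p \<in> \<nat>"
proof -
  have "mt n k p \<in> \<nat>" if "Re (mt n k p) < real M" "p \<in> projs (B n)" for M
    using that
  proof (induction M arbitrary: p)
    case 0
    then show ?case using mt_Re_nonneg[OF 0(2) assms(2)] by simp
  next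
    case (Suc M)
    obtain N where N: "p \<in> carrier_mat N N" using Suc.prems(2) by (rule projsE)
    show ?case
    proof (cases "mt n k p = 0")
      case False
      obtain v where v: "v \<in> carrier_mat N 1" "elements_mat v \<subseteq> B n" "adj v * v = mproj n k"
          "p * v = v" "v * mproj n k = v"
        using exists_minimal_column[OF Suc.prems(2) N assms(2) False] .
      have av: "adj v \<in> carrier_mat 1 N" using v by simp
      have vv: "v * adj v \<in> carrier_mat N N" using mult_carrier_mat[OF v(1) av] .
      note f = minimal_column_proj[OF v(1,2,3,5) assms(2)]
      have "p - v * adj v \<in> projs (B n)"
        using assoc_mult_mat[OF N v(1) av] v(4)
        by (intro proj_subtract[OF B_subring Suc.prems(2) N f(1) vv]) simp
      moreover have m: "mt n k (p - v * adj v) = mt n k p - 1"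
        using mt_minus[OF assms(2) N vv] f(2)[OF assms(2)] by simp
      ultimately have "mt n k p - 1 \<in> \<nat>"
        using Suc.IH[of "p - v * adj v"] Suc.prems(1) unfolding m by simp
      then have "mt n k p - 1 + 1 \<in> \<nat>" by (intro Nats_add Nats_1)
      then show ?thesis by simp
    qed simp
  qed
  then show ?thesis using assms reals_Archimedean2 by blast
qed

text \<open>The same descent runs on both projections at once: at a vertex where the common trace is
  nonzero, both lose a rank-one piece equivalent to \<open>mproj n k\<close>. The induction is on a
  bound for the sum of the traces over the floor.\<close>

theorem mvn_if_traces_eq:
  assumes "p \<in> projs (B n)" "r \<in> projs (B n)" "\<And>k. k \<le> 2 ^ n \<Longrightarrow> mt n k p = mt n k r"
  shows "mvn (B n) p r"
proof -
  have "mvn (B n) p r" if "(\<Sum>k\<le>2 ^ n. Re (mt n k p)) < real M" "p \<in> projs (B n)" "r \<in> projs (B n)"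
      "\<And>k. k \<le> 2 ^ n \<Longrightarrow> mt n k p = mt n k r" for M
    using that
  proof (induction M arbitrary: p r)
    case 0
    have "0 \<le> (\<Sum>k\<le>2 ^ n. Re (mt n k p))" using 0 by (intro sum_nonneg mt_Re_nonneg) auto
    then show ?case using 0(1) by simp
  next
    case (Suc M)
    obtain N where N: "p \<in> carrier_mat N N" using Suc.prems(2) by (rule projsE)
    obtain N' where N': "r \<in> carrier_mat N' N'" using Suc.prems(3) by (rule projsE)
    show ?case
    proof (cases "\<forall>k\<le>2 ^ n. mt n k p = 0")
      case True
      \<comment> \<open>Zero projections of different sizes are equivalent through a rectangular
        zero matrix.\<close>
      then have "p = 0\<^sub>m N N" "r = 0\<^sub>m N' N'"
        using mt_all_zero[OF Suc.prems(2) N] mt_all_zero[OF Suc.prems(3) N'] Suc.prems(4) by auto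
      then show ?thesis
        unfolding mvn_def by (intro bexI[of _ "0\<^sub>m N' N"]) (auto simp: elements_mat_subset_iff)
    next
      case False
      then obtain k where k: "k \<le> 2 ^ n" "mt n k p \<noteq> 0" by blast
      then have k': "mt n k r \<noteq> 0" using Suc.prems(4) by simp
      obtain v where v: "v \<in> carrier_mat N 1" "elements_mat v \<subseteq> B n" "adj v * v = mproj n k"
          "p * v = v" "v * mproj n k = v"
        using exists_minimal_column[OF Suc.prems(2) N k] .
      obtain w where w: "w \<in> carrier_mat N' 1" "elements_mat w \<subseteq> B n" "adj w * w = mproj n k"
          "r * w = w" "w * mproj n k = w"
        using exists_minimal_column[OF Suc.prems(3) N' k(1) k'] .
      have av: "adj v \<in> carrier_mat 1 N" and aw: "adj w \<in> carrier_mat 1 N'" using v w by auto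
      have vv: "v * adj v \<in> carrier_mat N N" using mult_carrier_mat[OF v(1) av] .
      have ww: "w * adj w \<in> carrier_mat N' N'" using mult_carrier_mat[OF w(1) aw] .
      note f = minimal_column_proj[OF v(1,2,3,5) k(1)]
      note g = minimal_column_proj[OF w(1,2,3,5) k(1)]
      have p1: "p - v * adj v \<in> projs (B n)"
        using assoc_mult_mat[OF N v(1) av] v(4)
        by (intro proj_subtract[OF B_subring Suc.prems(2) N f(1) vv]) simp
      have r1: "r - w * adj w \<in> projs (B n)"
        using assoc_mult_mat[OF N' w(1) aw] w(4)
        by (intro proj_subtract[OF B_subring Suc.prems(3) N' g(1) ww]) simp
      have m: "mt n j (p - v * adj v) = mt n j p - (if j = k then 1 else 0)"
          "mt n j (r - w * adj w) = mt n j r - (if j = k then 1 else 0)" if "j \<le> 2 ^ n" for j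
        using that by (simp_all add: mt_minus[OF _ N vv] mt_minus[OF _ N' ww] f(2) g(2))
      have "(\<Sum>j\<le>2 ^ n. Re (mt n j (p - v * adj v))) = (\<Sum>j\<le>2 ^ n. Re (mt n j p) - (if j = k then 1 else 0))"
        by (intro sum.cong) (auto simp: m)
      also have "\<dots> < real M" using Suc.prems(1) k(1) by (simp add: sum_subtractf)
      finally have "mvn (B n) (p - v * adj v) (r - w * adj w)"
        using Suc.prems(4) by (intro Suc.IH p1 r1) (auto simp: m)
      then show ?thesis
        by (rule mvn_add_rank_one[OF B_subring Suc.prems(2) N Suc.prems(3) N' v w _ f(1) g(1)])
    qed
  qed
  then show ?thesis using assms reals_Archimedean2 by blast
qed

text \<open>A block sum of \<open>d k\<close> copies of the minimal projection of each summand; one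
  induction counts the copies, the other runs through the vertices.\<close>

lemma exists_proj_with_traces:
  shows "\<exists>p\<in>projs (B n). \<forall>k\<le>2 ^ n. mt n k p = of_nat (d k)"
proof -
  have copies: "\<exists>p'\<in>projs (B n). \<forall>k\<le>2 ^ n. mt n k p' = mt n k p + (if k = j then of_nat c else 0)"
    if p: "p \<in> projs (B n)" and j: "j \<le> 2 ^ n" for p j c
  proof (induction c)
    case 0
    then show ?case using p by auto
  next
    case (Suc c)
    then obtain p' where "p' \<in> projs (B n)" "\<forall>k\<le>2 ^ n. mt n k p' = mt n k p + (if k = j then of_nat c else 0)" by blast
    then show ?case
      using mproj_in_projs[OF j]
      by (intro bexI[of _ "p' \<boxplus> mproj n j"]) (auto simp: mt_dsum mt_mproj j intro!: dsum_in_projs)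
  qed
  have "\<exists>p\<in>projs (B n). \<forall>k\<le>2 ^ n. mt n k p = (if k < K then of_nat (d k) else 0)" if "K \<le> Suc (2 ^ n)" for K
    using that
  proof (induction K)
    case 0
    show ?case
      by (intro bexI[of _ "0\<^sub>m 0 0"]) (auto simp: mt_def mtrace_def intro!: zero_in_projs)
  next
    case (Suc K)
    then obtain p where p: "p \<in> projs (B n)" "\<forall>k\<le>2 ^ n. mt n k p = (if k < K then of_nat (d k) else 0)" by auto
    obtain p' where "p' \<in> projs (B n)" "\<forall>k\<le>2 ^ n. mt n k p' = mt n k p + (if k = K then of_nat (d K) else 0)"
      using copies[OF p(1), of K "d K"] Suc.prems by auto
    then show ?case using p by (intro bexI[of _ p']) (auto simp: less_Suc_eq)
  qed
  from this[of "Suc (2 ^ n)"] show ?thesis by (auto simp: less_Suc_eq_le)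
qed

lemma iota_summand: "\<iota> n ` summand n k = {b \<in> B n. \<forall>j\<le>2 ^ n. j \<noteq> k \<longrightarrow> comp n b j = 0\<^sub>m (q n j) (q n j)}"
proof (intro equalityI subsetI)
  fix b assume "b \<in> {b \<in> B n. \<forall>j\<le>2 ^ n. j \<noteq> k \<longrightarrow> comp n b j = 0\<^sub>m (q n j) (q n j)}"
  then have "b \<in> B n" "comp n b \<in> summand n k" by (auto simp: summand_def)
  then show "b \<in> \<iota> n ` summand n k" by (metis iota_comp imageI)
qed (auto simp: summand_def)

text \<open>A rank-one subprojection \<open>x * star x\<close> with the desired traces splits off
  from \<open>e\<close>, and minimality forces it to be \<open>e\<close>.\<close>

lemma mt_minimal_projection:
  assumes e: "minimal_projection (\<iota> n ` summand n k) e" and k: "k \<le> 2 ^ n" and j: "j \<le> 2 ^ n"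
  shows "mt n j (mat 1 1 (\<lambda>_. e)) = (if j = k then 1 else 0)"
proof -
  have eB: "e \<in> B n" and ej: "\<And>j. j \<le> 2 ^ n \<Longrightarrow> j \<noteq> k \<Longrightarrow> comp n e j = 0\<^sub>m (q n j) (q n j)"
    and pe: "is_projection e" "e \<noteq> 0"
    and min: "\<And>f. f \<in> \<iota> n ` summand n k \<Longrightarrow> is_projection f \<Longrightarrow> f * e = f \<Longrightarrow> f = 0 \<or> f = e"
    using e by (auto simp: minimal_projection_def iota_summand)
  define p where "p = mat 1 1 (\<lambda>_. e)"
  have p: "p \<in> projs (B n)" unfolding p_def by (rule mat11_in_projs[OF pe(1) eB])
  have pc: "p \<in> carrier_mat 1 1" by (simp add: p_def)
  have z: "mt n i p = 0" if "i \<le> 2 ^ n" "i \<noteq> k" for i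
    using that mt_eq_sum[OF p pc that(1)] ej by (simp add: p_def)
  have "mt n k p \<noteq> 0"
  proof
    assume "mt n k p = 0"
    then have "p = 0\<^sub>m 1 1" using mt_all_zero[OF p pc] z by metis
    then have "p $$ (0, 0) = 0" by simp
    then show False using pe(2) by (simp add: p_def)
  qed
  then obtain v where v: "v \<in> carrier_mat 1 1" "elements_mat v \<subseteq> B n" "adj v * v = mproj n k"
      "p * v = v" "v * mproj n k = v"
    using exists_minimal_column[OF p pc k] by metis
  note vv = minimal_column_proj[OF v(1,2,3,5) k]
  define x where "x = v $$ (0, 0)"
  have vx: "v = mat 1 1 (\<lambda>_. x)" using v(1) by (intro eq_matI) (auto simp: x_def)
  have xB: "x \<in> B n" using v(1,2) by (auto simp: elements_mat_subset_iff x_def)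
  have ex: "e * x = x" using v(4) unfolding vx p_def by (simp add: mat11_mult mat11_eq_iff del: One_nat_def)
  have vv': "v * adj v = mat 1 1 (\<lambda>_. x * star x)" unfolding vx by (simp only: mat11_adj mat11_mult)
  have xx: "is_projection (x * star x)"
    using vv(1) unfolding vv' projs_def
    by (auto simp: is_projection_def mat11_mult mat11_adj mat11_eq_iff simp del: One_nat_def)
  have "star x * e = star x" using arg_cong[OF ex, of star] pe by (simp add: star_mult is_projection_def)
  then have le: "x * star x * e = x * star x" by (simp add: mult.assoc)
  \<comment> \<open>Minimality only speaks of projections in the summand; \<open>x * star x\<close>
    belongs to it because it is a multiple of \<open>e\<close>, whose other blocks vanish.\<close>
  have "comp n (x * star x) i = 0\<^sub>m (q n i) (q n i)" if "i \<le> 2 ^ n" "i \<noteq> k" for i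
  proof -
    have "comp n (x * star x * e) i = comp n (x * star x) i * 0\<^sub>m (q n i) (q n i)"
      using that xB eB by (simp add: comp_mult[of "x * star x"] ej)
    then show ?thesis using le right_mult_zero_mat[OF comp_carrier[of "x * star x" n i], of "q n i"] xB that by simp
  qed
  then have "x * star x \<in> \<iota> n ` summand n k" using xB by (simp add: iota_summand)
  moreover have "x * star x \<noteq> 0"
  proof
    assume "x * star x = 0"
    then have "mt n k (v * adj v) = 0"
      unfolding vv' using T_scaleC[OF k, of 0 0] by (simp add: mt_def mtrace_def)
    then show False using vv(2)[OF k] by simp
  qed
  ultimately have "x * star x = e" using min xx le by blast
  then show ?thesis using vv(2)[OF j] unfolding vv' by simp
qed

end

section \<open>Approximation of projections\<close>

text \<open>The difference is \<open>p * (p - r) * p\<close>, and the two outer factors cost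
  \<open>L ^ 2\<close>. The bound 1/2 is the threshold of \<open>newton_limit\<close>.\<close>

lemma mnorm_proj_sandwich:
  assumes "p \<in> carrier_mat N N" "r \<in> carrier_mat N N" "p * p = p"
    "mnorm p \<le> L" "mnorm (p - r) \<le> 1 / (2 * L\<^sup>2)" "0 < L"
  shows "mnorm (p - p * r * p :: 'a::cstar_algebra mat) \<le> 1 / 2"
proof -
  have prc: "p - r \<in> carrier_mat N N" using assms by (simp add: minus_carrier_mat)
  have "p * (p - r) * p = p - p * r * p"
    using mult_minus_distrib_mat[OF assms(1,1,2)] minus_mult_distrib_mat[of p N N "p * r" p N] assms by simp
  then have "mnorm (p - p * r * p) \<le> mnorm (p * (p - r)) * mnorm p"
    using mnorm_mult[of "p * (p - r)" N N p N] assms prc by simp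
  also have "\<dots> \<le> (mnorm p * mnorm (p - r)) * mnorm p"
    using mnorm_mult[OF assms(1) prc] by (intro mult_right_mono) auto
  also have "\<dots> \<le> (L * (1 / (2 * L\<^sup>2))) * L"
    using assms by (intro mult_mono) auto
  also have "\<dots> = 1 / 2" using assms by (simp add: power2_eq_square)
  finally show ?thesis .
qed

text \<open>For \<open>v = r * p\<close> one has \<open>adj v * v = p * r * p\<close> and
  \<open>v * adj v = r * p * r\<close>, close to \<open>p\<close> and \<open>r\<close>; the
  iteration turns \<open>v\<close> into an exact partial isometry between them.\<close>

lemma close_projections_mvn:
  fixes p r :: "'a::cstar_algebra mat"
  assumes p: "p \<in> carrier_mat N N" "p * p = p" "adj p = p" and r: "r \<in> carrier_mat N N" "r * r = r" "adj r = r"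
    and L: "mnorm p \<le> L" "mnorm r \<le> L" "0 < L" "mnorm (p - r) \<le> 1 / (2 * L\<^sup>2)"
  shows "mvn UNIV p r"
proof -
  define v where "v = r * p"
  have v: "v \<in> carrier_mat N N" using p r by (simp add: v_def)
  have av: "adj v = p * r" using adj_mult[OF r(1) p(1)] by (simp add: v_def p r)
  have vp: "v * p = v" using p r by (simp add: v_def)
  have rv: "r * v = v" using assoc_mult_mat[OF r(1) r(1) p(1)] by (simp add: v_def r)
  have "adj v * v = p * (r * r) * p"
    unfolding av unfolding v_def using p(1) r(1)
    by (simp add: assoc_mult_mat[of _ N N _ N _ N])
  then have 1: "mnorm (p - adj v * v) \<le> 1 / 2"
    using mnorm_proj_sandwich[OF p(1) r(1) p(2) L(1,4,3)] by (simp only: r)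
  have "v * adj v = r * (p * p) * r"
    unfolding av unfolding v_def using p(1) r(1)
    by (simp add: assoc_mult_mat[of _ N N _ N _ N])
  then have 2: "mnorm (r - v * adj v) \<le> 1 / 2"
    using mnorm_proj_sandwich[OF r(1) p(1) r(2) L(2) _ L(3)] L(4) mnorm_minus_commute[OF p(1) r(1)]
    by (simp only: p)
  obtain w where "w \<in> carrier_mat N N" "adj w * w = p" "w * adj w = r"
    using newton_limit[OF v p vp r rv 1 order_refl 2, of UNIV] by auto
  then show ?thesis using p r unfolding mvn_def by (intro bexI[of _ w]) auto
qed

lemma adj_one: "adj (1\<^sub>m N) = (1\<^sub>m N :: 'a::{star_ring, ring_1} mat)"
proof -
  have "star (1::'a) = 1"
    using star_mult[of "star (1::'a)" 1] by (simp add: star_star)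
  then show ?thesis by (intro eq_matI) auto
qed

context pascal_limit begin

lemma approximate_matrix:
  fixes p :: "'a mat"
  assumes p: "p \<in> carrier_mat N N" "adj p = p" and d: "0 < d"
  obtains n x where "x \<in> carrier_mat N N" "elements_mat x \<subseteq> B n" "adj x = x" "mnorm (x - p) \<le> d"
proof -
  \<comment> \<open>The summand 1 keeps the denominator positive for the empty matrix.\<close>
  define c where "c = d / (real N * real N + 1)"
  have c: "0 < c" using d by (simp add: c_def add_nonneg_pos)
  have "\<exists>b m. b \<in> B m \<and> norm (b - a) < c" for a
  proof -
    have "a \<in> closure UB" by (simp add: UB_closure)
    then obtain b where "b \<in> UB" "dist b a < c" using c by (meson closure_approachable)
    then show ?thesis by (auto simp: UB_def dist_norm)
  qed
  then obtain f m where f: "\<And>a. f a \<in> B (m a)" "\<And>a. norm (f a - a) < c" by metis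
  \<comment> \<open>The sum serves as a common upper bound for the floors of the approximating
    entries.\<close>
  define n where "n = (\<Sum>i<N. \<Sum>j<N. m (p $$ (i, j)))"
  have "m (p $$ (i, j)) \<le> n" if "i < N" "j < N" for i j
  proof -
    have "m (p $$ (i, j)) \<le> (\<Sum>j<N. m (p $$ (i, j)))" using that by (intro member_le_sum) auto
    also have "\<dots> \<le> n" unfolding n_def using that
      by (intro member_le_sum[of _ _ "\<lambda>i. \<Sum>j<N. m (p $$ (i, j))"]) auto
    finally show ?thesis .
  qed
  then have fB: "f (p $$ (i, j)) \<in> B n" if "i < N" "j < N" for i j
    using that f(1)[of "p $$ (i, j)"] B_mono by blast
  define y where "y = map_mat f p"
  have y: "y \<in> carrier_mat N N" using p by (simp add: y_def)
  have yB: "elements_mat y \<subseteq> B n" using fB p by (auto simp: elements_mat_subset_iff y_def)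
  have "mnorm (y - p) = (\<Sum>i<N. \<Sum>j<N. norm (f (p $$ (i, j)) - p $$ (i, j)))"
    using p by (simp add: mnorm_def y_def)
  also have "\<dots> \<le> (\<Sum>i<N. \<Sum>j<N. c)" using f(2) by (intro sum_mono less_imp_le)
  also have "\<dots> = real N * real N * c" by simp
  also have "\<dots> \<le> (real N * real N + 1) * c" using c by (intro mult_right_mono) auto
  also have "\<dots> = d" by (simp add: c_def add_nonneg_eq_0_iff)
  finally have yp: "mnorm (y - p) \<le> d" .
  have ypc: "y - p \<in> carrier_mat N N" using p by (simp add: minus_carrier_mat)
  \<comment> \<open>Averaging with the adjoint restores self-adjointness; as \<open>p\<close> is
    self-adjoint and \<open>adj\<close> preserves \<open>mnorm\<close>, the distance to
    \<open>p\<close> does not grow.\<close>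
  define x where "x = half (y + adj y)"
  have x: "x \<in> carrier_mat N N" using y by (simp add: x_def)
  have yd: "dim_row y = N" "dim_col y = N" and pd: "dim_row p = N" "dim_col p = N" using y p by auto
  have ps: "star (p $$ (j, i)) = p $$ (i, j)" if "i < N" "j < N" for i j
    using index_adj[of i p j] p that pd by simp
  have "adj x = x" by (rule eq_matI) (auto simp: x_def yd star_scaleR star_add star_star add.commute)
  moreover have "elements_mat x \<subseteq> B n"
    unfolding x_def by (intro elements_mat_half B_scaleR elements_mat_add[OF B_subring y] elements_mat_adj[OF B_subring] yB)
      (use y in auto)
  moreover have "x - p = half ((y - p) + adj (y - p))"
  proof (rule eq_matI, goal_cases)
    case (1 i j)
    have h: "u = (1 / 2) *\<^sub>R (u + u)" for u :: 'a by (simp flip: scaleR_2)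
    show ?case using 1 h[of "p $$ (i, j)"]
      by (simp add: x_def yd pd star_diff ps scaleR_right_diff_distrib[symmetric] scaleR_right_distrib algebra_simps)
  qed (auto simp: x_def yd pd)
  then have "mnorm (x - p) \<le> (mnorm (y - p) + mnorm (adj (y - p))) / 2"
    using mnorm_add[OF ypc, of "adj (y - p)"] ypc by simp
  then have "mnorm (x - p) \<le> d" using yp by simp
  ultimately show ?thesis using that x by blast
qed

text \<open>Passing to \<open>s0 = 2 p - 1\<close> trades idempotence for
  \<open>s0 * s0 = 1\<close>. The approximant \<open>s\<close> is then nearly unitary, the iteration
  inside the closed subring \<open>B n\<close> makes it a symmetry \<open>w\<close>, and
  \<open>(1 + w) / 2\<close> is a projection of the stage close to \<open>p\<close>.\<close>

theorem projection_equivalent_to_stage: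
  fixes p :: "'a mat"
  assumes "p \<in> projs UNIV"
  obtains n p' where "p' \<in> projs (B n)" "mvn UNIV p p'"
proof -
  obtain N where p: "p \<in> carrier_mat N N" "p * p = p" "adj p = p" using assms by (rule projsE)
  define s0 where "s0 = p + p - 1\<^sub>m N"
  \<comment> \<open>Exceeding both norms by at least 1 leaves room for the perturbed matrices:
    \<open>mnorm s\<close> and \<open>mnorm p'\<close> stay below \<open>L\<close> too.\<close>
  define L where "L = 1 + mnorm p + mnorm s0"
  \<comment> \<open>The final error is at most
    \<open>(8 * d * L\<^sup>2 + 2 * d) / 2 \<le> 5 * d * L\<^sup>2\<close>, which this choice makes
    equal to the \<open>1 / (2 * L\<^sup>2)\<close> demanded by
    \<open>close_projections_mvn\<close>.\<close>
  define d where "d = 1 / (10 * L ^ 4)"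
  have L: "1 \<le> L" "mnorm p \<le> L - 1" "mnorm s0 \<le> L - 1" by (auto simp: L_def)
  have d: "0 < d" using L by (simp add: d_def)
  obtain n x where x: "x \<in> carrier_mat N N" "elements_mat x \<subseteq> B n" "adj x = x" "mnorm (x - p) \<le> d"
    using approximate_matrix[OF p(1,3) d] .
  define s where "s = x + x - 1\<^sub>m N"
  have pd: "dim_row p = N" "dim_col p = N" and xd: "dim_row x = N" "dim_col x = N" using p x by auto
  have one: "1\<^sub>m N \<in> carrier_mat N N" by simp
  have s: "s \<in> carrier_mat N N" and s0: "s0 \<in> carrier_mat N N"
    using x p by (auto simp: s_def s0_def minus_carrier_mat)
  have xx: "x + x \<in> carrier_mat N N" and pp: "p + p \<in> carrier_mat N N" using x p by auto
  have as: "adj s = s" unfolding s_def using adj_minus[OF xx one] adj_add[OF x(1,1)] x by (simp add: adj_one)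
  have oneB: "elements_mat (1\<^sub>m N) \<subseteq> B n" by (auto simp: elements_mat_subset_iff)
  have sB: "elements_mat s \<subseteq> B n"
    unfolding s_def by (intro elements_mat_minus[OF B_subring xx one] elements_mat_add[OF B_subring x(1,1)] x oneB)
  have "p * s0 = p"
    unfolding s0_def using mult_minus_distrib_mat[OF p(1) pp one] mult_add_distrib_mat[OF p(1,1,1)] p
    by (auto intro!: eq_matI)
  then have "s0 * s0 = p + p - s0"
    using minus_mult_distrib_mat[OF pp one s0] add_mult_distrib_mat[OF p(1,1) s0] s0
    by (simp flip: s0_def)
  also have "\<dots> = 1\<^sub>m N" unfolding s0_def using pd by (intro eq_matI) auto
  finally have s00: "s0 * s0 = 1\<^sub>m N" .
  have xpc: "x - p \<in> carrier_mat N N" using p by (simp add: minus_carrier_mat)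
  have ssc: "s0 - s \<in> carrier_mat N N" "s - s0 \<in> carrier_mat N N" using s s0 by (auto simp: minus_carrier_mat)
  have "s - s0 = (x - p) + (x - p)"
    unfolding s_def s0_def by (rule eq_matI) (auto simp: pd xd)
  then have ss0: "mnorm (s - s0) \<le> 2 * d" using mnorm_add[OF xpc xpc] x(4) by simp
  then have s0s: "mnorm (s0 - s) \<le> 2 * d" using mnorm_minus_commute[OF s s0] by simp
  have d1: "2 * d \<le> 1"
    using one_le_power[OF L(1), of 4] by (simp add: d_def divide_le_eq)
  have "s = s0 + (s - s0)" using s s0 by (intro eq_matI) auto
  then have "mnorm s \<le> mnorm s0 + mnorm (s - s0)" using mnorm_add[OF s0 ssc(2)] by simp
  then have sL: "mnorm s \<le> L" using ss0 d1 L by linarith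
  have cc: "s0 * (s0 - s) \<in> carrier_mat N N" "(s0 - s) * s \<in> carrier_mat N N"
    "s0 * s \<in> carrier_mat N N" "s * s \<in> carrier_mat N N" "s0 * s0 \<in> carrier_mat N N"
    using s s0 ssc by auto
  \<comment> \<open>The noncommutative difference of squares, with the unit written as
    \<open>s0 * s0\<close>.\<close>
  have "1\<^sub>m N - s * s = s0 * (s0 - s) + (s0 - s) * s"
    unfolding mult_minus_distrib_mat[OF s0 s0 s] minus_mult_distrib_mat[OF s0 s s] s00
    using carrier_matD[OF s] carrier_matD[OF s0] by (intro eq_matI) (auto simp del: index_mult_mat(1))
  then have "mnorm (1\<^sub>m N - s * s) \<le> mnorm (s0 * (s0 - s)) + mnorm ((s0 - s) * s)"
    using mnorm_add[OF cc(1,2)] by simp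
  also have "\<dots> \<le> mnorm s0 * mnorm (s0 - s) + mnorm (s0 - s) * mnorm s"
    by (intro add_mono mnorm_mult[OF s0 ssc(1)] mnorm_mult[OF ssc(1) s])
  also have "\<dots> \<le> L * (2 * d) + (2 * d) * L"
    using s0s sL L d by (intro add_mono mult_mono) auto
  finally have e: "mnorm (1\<^sub>m N - adj s * s) \<le> 4 * d * L" "mnorm (1\<^sub>m N - s * adj s) \<le> 4 * d * L"
    by (simp_all add: as mult_ac)
  have dL: "d * L ^ 4 = 1 / 10" using L by (simp add: d_def)
  have "d * L \<le> d * L ^ 4" using d L by (intro mult_left_mono self_le_power) auto
  then have small: "4 * d * L \<le> 1 / 2" using dL by simp
  obtain w where w: "w \<in> carrier_mat N N" "elements_mat w \<subseteq> B n" "adj w * w = 1\<^sub>m N"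
      "mnorm (w - s) \<le> 2 * (4 * d * L) * mnorm s" "adj w = w"
    using newton_limit[OF s one _ adj_one _ one _ adj_one _ e(1) small order_trans[OF e(2) small] B_subring _ closed_B sB]
      s as by auto
  have ww: "w * w = 1\<^sub>m N" using w by simp
  have wd: "dim_row w = N" "dim_col w = N" using w by auto
  define p' where "p' = half (1\<^sub>m N + w)"
  have wc: "1\<^sub>m N + w \<in> carrier_mat N N" using w by simp
  have p'c: "p' \<in> carrier_mat N N" using w by (simp add: p'_def)
  have p'B: "elements_mat p' \<subseteq> B n"
    unfolding p'_def by (intro elements_mat_half B_scaleR elements_mat_add[OF B_subring one w(1)] oneB w)
  have ap': "adj p' = p'" unfolding p'_def by (simp add: adj_half adj_add[OF one w(1)] adj_one w)
  have "(1\<^sub>m N + w) * (1\<^sub>m N + w) = (1\<^sub>m N + w) + (1\<^sub>m N + w)"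
    using add_mult_distrib_mat[OF one w(1) wc] mult_add_distrib_mat[OF w(1) one w(1)] w wc
    by (simp add: ww) (auto intro!: eq_matI simp: wd add.commute)
  then have "p' * p' = half (half ((1\<^sub>m N + w) + (1\<^sub>m N + w)))"
    unfolding p'_def using half_mult(1)[OF wc, of "half (1\<^sub>m N + w)" N] half_mult(2)[OF wc wc] wc by simp
  also have "\<dots> = p'"
    unfolding p'_def
  proof (rule eq_matI, goal_cases)
    case (1 i j)
    have h: "(1 / 2) *\<^sub>R (1 / 2) *\<^sub>R (u + u) = (1 / 2) *\<^sub>R u" for u :: 'a by (simp flip: scaleR_2)
    show ?case using 1 h by (simp add: wd del: scaleR_scaleR)
  qed auto
  finally have p'p': "p' * p' = p'" .
  have p': "p' \<in> projs (B n)" by (rule projsI[OF p'c p'B p'p' ap'])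
  have wsc: "w - s \<in> carrier_mat N N" using s by (simp add: minus_carrier_mat)
  have "p' - p = half ((w - s) + (s - s0))"
    unfolding p'_def s0_def
  proof (rule eq_matI, goal_cases)
    case (1 i j)
    have h: "(1 / 2) *\<^sub>R (a + b) - u = (1 / 2) *\<^sub>R (b - c + (c - (u + u - a)))" for a b c u :: 'a
    proof -
      have "(1 / 2) *\<^sub>R (u + u) = u" by (simp flip: scaleR_2)
      moreover have "(1 / 2) *\<^sub>R (b - c + (c - (u + u - a))) = (1 / 2) *\<^sub>R (a + b) - (1 / 2) *\<^sub>R (u + u)"
        unfolding scaleR_right_diff_distrib[symmetric] by (simp add: algebra_simps)
      ultimately show ?thesis by simp
    qed
    show ?case
      using 1 s h[of "1\<^sub>m N $$ (i, j)" "w $$ (i, j)" "p $$ (i, j)" "s $$ (i, j)"] by (simp add: wd pd)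
  qed (use s in \<open>auto simp: wd pd\<close>)
  then have "mnorm (p' - p) \<le> (mnorm (w - s) + mnorm (s - s0)) / 2"
    using mnorm_add[OF wsc ssc(2)] by simp
  also have "\<dots> \<le> (2 * (4 * d * L) * L + 2 * d) / 2"
  proof -
    have "2 * (4 * d * L) * mnorm s \<le> 2 * (4 * d * L) * L" using sL d L by (intro mult_left_mono) auto
    then show ?thesis using w(4) ss0 by simp
  qed
  also have "\<dots> \<le> 5 * d * L\<^sup>2"
  proof -
    have "d * 1 \<le> d * L\<^sup>2" using d L by (intro mult_left_mono one_le_power) auto
    then show ?thesis by (simp add: power2_eq_square mult_ac)
  qed
  also have "5 * d * L\<^sup>2 = 1 / (2 * L\<^sup>2)"
    using L by (simp add: d_def power2_eq_square power4_eq_xxxx)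
  finally have close: "mnorm (p' - p) \<le> 1 / (2 * L\<^sup>2)" .
  have "1 / (2 * L\<^sup>2) \<le> 1" using one_le_power[OF L(1), of 2] by (simp add: divide_le_eq)
  moreover have "p' = p + (p' - p)" using p p'c by (intro eq_matI) auto
  then have "mnorm p' \<le> mnorm p + mnorm (p' - p)"
    using mnorm_add[OF p(1), of "p' - p"] p by (simp add: minus_carrier_mat)
  ultimately have p'L: "mnorm p' \<le> L" using close L by linarith
  have "mvn UNIV p p'"
    by (rule close_projections_mvn[OF p p'c p'p' ap', of L])
      (use L p'L close mnorm_minus_commute[OF p(1) p'c] in auto)
  with p' show ?thesis by (rule that)
qed

end

section \<open>Quotients determined by an additive invariant\<close>

definition inv_value :: "('x \<Rightarrow> 'i \<Rightarrow> 'f) \<Rightarrow> 'x set \<Rightarrow> 'i \<Rightarrow> 'f" where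
  "inv_value H X = H (SOME a. a \<in> X)"

text \<open>The common shape of \<open>K0_unital\<close> and \<open>dirlim\<close>: pairs are
  identified when an additive, function-valued invariant agrees. The quotient then embeds into a
  group of functions, and two such quotients are compared through the functions they
  realise.\<close>

locale invariant_quotient =
  fixes H :: "'x \<Rightarrow> 'i \<Rightarrow> 'f::ab_group_add" and S R opr and M :: "'x set monoid"
  assumes R: "R = {(a, b). a \<in> S \<and> b \<in> S \<and> H a = H b}"
    and carr: "carrier M = S // R"
    and mul: "\<And>X Y. X \<otimes>\<^bsub>M\<^esub> Y = (\<Union>a\<in>X. \<Union>b\<in>Y. R `` {opr a b})"
    and opr_closed: "\<And>a b. a \<in> S \<Longrightarrow> b \<in> S \<Longrightarrow> opr a b \<in> S"
    and opr_add: "\<And>a b i. a \<in> S \<Longrightarrow> b \<in> S \<Longrightarrow> H (opr a b) i = H a i + H b i"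
begin

lemma cls_eq: "a \<in> S \<Longrightarrow> R `` {a} = {b \<in> S. H b = H a}"
  by (auto simp: R)

lemma carrierE:
  assumes "X \<in> carrier M"
  obtains a where "a \<in> S" "X = R `` {a}"
  using assms unfolding carr by (auto elim: quotientE)

lemma cls_in_carrier: "a \<in> S \<Longrightarrow> R `` {a} \<in> carrier M"
  unfolding carr by (rule quotientI)

lemma inv_value_cls: "a \<in> S \<Longrightarrow> inv_value H (R `` {a}) = H a"
proof -
  assume a: "a \<in> S"
  then have "(SOME b. b \<in> R `` {a}) \<in> R `` {a}"
    by (intro someI[of "\<lambda>b. b \<in> R `` {a}" a]) (simp add: cls_eq)
  then show ?thesis using a by (simp add: inv_value_def cls_eq)
qed

lemma inv_value_member: "X \<in> carrier M \<Longrightarrow> a \<in> X \<Longrightarrow> a \<in> S \<and> H a = inv_value H X"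
proof -
  assume X: "X \<in> carrier M" "a \<in> X"
  obtain b where b: "b \<in> S" "X = R `` {b}" using X(1) by (rule carrierE)
  show ?thesis
    using X(2) inv_value_cls[OF b(1)] unfolding b(2) cls_eq[OF b(1)] by simp
qed

lemma inv_value_inj: "X \<in> carrier M \<Longrightarrow> Y \<in> carrier M \<Longrightarrow> inv_value H X = inv_value H Y \<Longrightarrow> X = Y"
  by (elim carrierE) (simp add: inv_value_cls, simp add: cls_eq)

lemma mult_cls:
  assumes a: "a \<in> S" and b: "b \<in> S"
  shows "R `` {a} \<otimes>\<^bsub>M\<^esub> R `` {b} = R `` {opr a b}"
proof -
  have "R `` {opr a' b'} = R `` {opr a b}" if "a' \<in> R `` {a}" "b' \<in> R `` {b}" for a' b'
  proof -
    have "a' \<in> S" "b' \<in> S" "H a' = H a" "H b' = H b" using that a b by (auto simp: cls_eq)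
    then have "H (opr a' b') = H (opr a b)" using a b by (intro ext) (simp add: opr_add)
    then show ?thesis using \<open>a' \<in> S\<close> \<open>b' \<in> S\<close> a b by (simp add: cls_eq opr_closed)
  qed
  moreover have "a \<in> R `` {a}" "b \<in> R `` {b}" using a b by (auto simp: cls_eq)
  ultimately show ?thesis unfolding mul by blast
qed

lemma mult_carrier: "X \<in> carrier M \<Longrightarrow> Y \<in> carrier M \<Longrightarrow> X \<otimes>\<^bsub>M\<^esub> Y \<in> carrier M"
  by (elim carrierE) (simp add: mult_cls cls_in_carrier opr_closed)

lemma inv_value_mult:
  "X \<in> carrier M \<Longrightarrow> Y \<in> carrier M \<Longrightarrow> inv_value H (X \<otimes>\<^bsub>M\<^esub> Y) i = inv_value H X i + inv_value H Y i"
  by (elim carrierE) (simp add: mult_cls inv_value_cls opr_closed opr_add)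

end

section \<open>The direct limit of the groups of Laurent polynomials\<close>

lemma lookup_single_mult: "Poly_Mapping.lookup (Poly_Mapping.single a c * s) i = c * Poly_Mapping.lookup s (i - a)"
  for s :: laurent
proof -
  have "Sum_any (\<lambda>l'. Poly_Mapping.lookup s l' when i = l + l') = Poly_Mapping.lookup s (i - l)" for l
  proof -
    have "Sum_any (\<lambda>l'. Poly_Mapping.lookup s l' when i = l + l')
        = Sum_any (\<lambda>l'. Poly_Mapping.lookup s l' when l' = i - l)"
      by (rule Sum_any.cong) (auto simp: when_def)
    then show ?thesis by simp
  qed
  then show ?thesis by (simp add: lookup_mult lookup_single when_mult)
qed

lemma of_int_mult_X_pow: "of_int c * X_pow j = Poly_Mapping.single j c"
  by (simp add: X_pow_def mult_single flip: single_of_int)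

lemma lookup_subst_square:
  "Poly_Mapping.lookup (subst_square p) i = (if even i then Poly_Mapping.lookup p (i div 2) else 0)"
proof -
  have "Poly_Mapping.lookup (subst_square p) i
      = (\<Sum>j\<in>Poly_Mapping.keys p. if j = i div 2 then (if even i then Poly_Mapping.lookup p j else 0) else 0)"
    unfolding subst_square_def of_int_mult_X_pow lookup_sum
    by (rule sum.cong) (auto simp: lookup_single when_def)
  then show ?thesis by (simp add: in_keys_iff)
qed

lemma lookup_beta_aux: "Poly_Mapping.lookup (beta n p) i = Poly_Mapping.lookup (subst_square p) (i + 1)
    + Poly_Mapping.lookup (subst_square p) i + Poly_Mapping.lookup (subst_square p) (i - 1)"
  by (simp add: beta_def X_pow_def distrib_right lookup_add lookup_single_mult)

text \<open>The series \<open>p(X^2)\<close> lives on even exponents. An even exponent is reached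
  only through the middle term of \<open>X^(-1) + 1 + X\<close>, an odd one through the two outer
  terms.\<close>

lemma lookup_beta [simp]:
  "Poly_Mapping.lookup (beta n p) (2 * i) = Poly_Mapping.lookup p i"
  "Poly_Mapping.lookup (beta n p) (2 * i + 1) = Poly_Mapping.lookup p i + Poly_Mapping.lookup p (i + 1)"
proof -
  have e: "(2 * i + 2) div 2 = i + 1" for i :: int by presburger
  show "Poly_Mapping.lookup (beta n p) (2 * i) = Poly_Mapping.lookup p i"
    by (simp add: lookup_beta_aux lookup_subst_square)
  show "Poly_Mapping.lookup (beta n p) (2 * i + 1) = Poly_Mapping.lookup p i + Poly_Mapping.lookup p (i + 1)"
    by (simp add: lookup_beta_aux lookup_subst_square e add.commute)
qed

lemma parity_int_cases:
  fixes j :: int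
  obtains i where "j = 2 * i" | i where "j = 2 * i + 1"
  by (metis evenE oddE)

lemma beta_add: "beta n (x + y) = beta n x + beta n y"
proof (rule poly_mapping_eqI)
  show "Poly_Mapping.lookup (beta n (x + y)) j = Poly_Mapping.lookup (beta n x + beta n y) j" for j
    by (cases j rule: parity_int_cases) (simp_all add: lookup_add)
qed

lemma beta_inj: "beta n x = beta n y \<Longrightarrow> x = y"
  by (rule poly_mapping_eqI) (metis lookup_beta(1))

lemma lookup_p_poly: "Poly_Mapping.lookup (of_int c * p_poly n k) j = (if k = nat \<bar>j\<bar> then c else 0)"
proof (cases "k = 0")
  case True
  then show ?thesis by (auto simp: p_poly_def lookup_of_int when_def)
next
  case False
  have "Poly_Mapping.lookup (of_int c * p_poly n k) j = (c when int k = j) + (c when - int k = j)"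
    using False by (simp add: p_poly_def distrib_left of_int_mult_X_pow lookup_add lookup_single)
  also have "\<dots> = (if k = nat \<bar>j\<bar> then c else 0)"
    using False by (auto simp: when_def)
  finally show ?thesis .
qed

lemma lookup_p_sum:
  "Poly_Mapping.lookup (\<Sum>k<2 ^ n. of_int (c k) * p_poly n k) j = (if nat \<bar>j\<bar> < 2 ^ n then c (nat \<bar>j\<bar>) else 0)"
  by (simp add: lookup_sum lookup_p_poly)

text \<open>Symmetry and vanishing from \<open>2 ^ n\<close> on leave one free coefficient for each
  \<open>k < 2 ^ n\<close>, that is, for each vertex that survives on floor \<open>n\<close>; the
  exponent \<open>2 ^ n\<close> stands for the erased vertex.\<close>

lemma P_carrier:
  "x \<in> carrier (P_group n) \<longleftrightarrow> (\<forall>j. Poly_Mapping.lookup x (- j) = Poly_Mapping.lookup x j)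
     \<and> (\<forall>j. 2 ^ n \<le> j \<longrightarrow> Poly_Mapping.lookup x j = 0)" (is "?L \<longleftrightarrow> ?R")
proof
  assume ?L
  then obtain c where x: "x = (\<Sum>k<2 ^ n. of_int (c k) * p_poly n k)" by (auto simp: P_group_def)
  have "\<not> nat \<bar>j\<bar> < 2 ^ n" if "2 ^ n \<le> j" for j :: int
    using that by (simp add: nat_less_iff)
  then show ?R unfolding x lookup_p_sum by simp
next
  assume R: ?R
  have "x = (\<Sum>k<2 ^ n. of_int (Poly_Mapping.lookup x (int k)) * p_poly n k)"
  proof (rule poly_mapping_eqI)
    fix j
    have "Poly_Mapping.lookup x \<bar>j\<bar> = Poly_Mapping.lookup x j" using R by (auto simp: abs_if)
    moreover have "Poly_Mapping.lookup x \<bar>j\<bar> = 0" if "\<not> nat \<bar>j\<bar> < 2 ^ n"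
      using that R by (simp add: nat_less_iff)
    ultimately show "Poly_Mapping.lookup x j
        = Poly_Mapping.lookup (\<Sum>k<2 ^ n. of_int (Poly_Mapping.lookup x (int k)) * p_poly n k) j"
      unfolding lookup_p_sum by auto
  qed
  then show ?L unfolding P_group_def by (auto intro!: exI[of _ "\<lambda>k. Poly_Mapping.lookup x (int k)"])
qed

lemma P_symmetric: "x \<in> carrier (P_group n) \<Longrightarrow> Poly_Mapping.lookup x j = Poly_Mapping.lookup x (int (nat \<bar>j\<bar>))"
  unfolding P_carrier by (auto simp: abs_if)

lemma p_poly_in_P: "k < 2 ^ n \<Longrightarrow> p_poly n k \<in> carrier (P_group n)"
proof -
  assume k: "k < 2 ^ n"
  have l: "Poly_Mapping.lookup (p_poly n k) j = (if k = nat \<bar>j\<bar> then 1 else 0)" for j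
    using lookup_p_poly[of 1 n k j] by simp
  have "k \<noteq> nat \<bar>j\<bar>" if "2 ^ n \<le> j" for j :: int
  proof
    assume "k = nat \<bar>j\<bar>"
    moreover have "0 < j" using that by (rule less_le_trans[rotated]) simp
    ultimately have "j = int k" by simp
    with that have "int (2 ^ n) \<le> int k" by simp
    with k show False by linarith
  qed
  then show ?thesis unfolding P_carrier l by auto
qed

lemma beta_in_P: "x \<in> carrier (P_group n) \<Longrightarrow> beta n x \<in> carrier (P_group (Suc n))"
proof -
  assume x: "x \<in> carrier (P_group n)"
  then have s: "\<And>j. Poly_Mapping.lookup x (- j) = Poly_Mapping.lookup x j"
    and z: "\<And>j. 2 ^ n \<le> j \<Longrightarrow> Poly_Mapping.lookup x j = 0" by (auto simp: P_carrier)
  have "Poly_Mapping.lookup (beta n x) (- j) = Poly_Mapping.lookup (beta n x) j" for j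
  proof (cases j rule: parity_int_cases)
    case (1 i)
    then show ?thesis using s[of i] lookup_beta(1)[of n x "- i"] by simp
  next
    case (2 i)
    have "- j = 2 * (- i - 1) + 1" using 2 by simp
    then have "Poly_Mapping.lookup (beta n x) (- j) = Poly_Mapping.lookup x (- (i + 1)) + Poly_Mapping.lookup x (- i)"
      using lookup_beta(2)[of n x "- i - 1"] by simp
    then show ?thesis unfolding s using 2 by simp
  qed
  moreover have "Poly_Mapping.lookup (beta n x) j = 0" if "2 ^ Suc n \<le> j" for j
  proof (cases j rule: parity_int_cases)
    case (1 i)
    then show ?thesis using that z[of i] by simp
  next
    case (2 i)
    \<comment> \<open>The bound \<open>2 ^ Suc n\<close> is even, so an odd exponent
      \<open>2 * i + 1\<close> beyond it already forces \<open>2 ^ n \<le> i\<close>, and both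
      summands vanish.\<close>
    then have "2 ^ n \<le> i" using that by simp
    then show ?thesis using 2 z[of i] z[of "i + 1"] by simp
  qed
  ultimately show ?thesis by (simp add: P_carrier)
qed

lemma P_add: "x \<in> carrier (P_group n) \<Longrightarrow> y \<in> carrier (P_group n) \<Longrightarrow> x + y \<in> carrier (P_group n)"
  by (simp add: P_carrier lookup_add)

lemma P_mult [simp]: "x \<otimes>\<^bsub>P_group n\<^esub> y = x + y"
  by (simp add: P_group_def)

lemma beta_hom: "beta n \<in> hom (P_group n) (P_group (Suc n))"
  by (auto simp: hom_def beta_in_P beta_add)

lemma shift_in_P: "x \<in> carrier (P_group n) \<Longrightarrow> shift beta n d x \<in> carrier (P_group (n + d))"
  by (induction d) (auto intro: beta_in_P)

lemma shift_add: "shift beta n d (x + y) = shift beta n d x + shift beta n d y"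
  by (induction d) (auto simp: beta_add)

lemma shift_plus: "shift beta n (d + e) x = shift beta (n + d) e (shift beta n d x)"
  by (induction e) (auto simp: add.assoc)

lemma lookup_shift: "Poly_Mapping.lookup (shift beta n (d + e) x) (j * 2 ^ e) = Poly_Mapping.lookup (shift beta n d x) j"
proof (induction e)
  case (Suc e)
  have "j * 2 ^ Suc e = 2 * (j * 2 ^ e)" by simp
  then show ?case using Suc by (simp only: add_Suc_right shift.simps lookup_beta)
qed simp

text \<open>The coefficient at \<open>X ^ k\<close> on floor \<open>m\<close> reappears at \<open>X ^ (2 * k)\<close> on floor \<open>m + 1\<close>; hence an
  element of the limit is a function of the dyadic number \<open>k / 2 ^ m\<close>.\<close>

definition coeffs :: "nat \<times> laurent \<Rightarrow> nat \<times> nat \<Rightarrow> int" where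
  "coeffs = (\<lambda>(n, x) (m, k). Poly_Mapping.lookup (shift beta n (max m n - n) x) (int k * 2 ^ (max m n - m)))"

text \<open>Any common floor \<open>N\<close> may replace \<open>max m n\<close>, because raising
  the floor by \<open>e\<close> copies the coefficients to the multiples of
  \<open>2 ^ e\<close>.\<close>

lemma coeffs_eq:
  assumes "m \<le> N" "n \<le> N"
  shows "coeffs (n, x) (m, k) = Poly_Mapping.lookup (shift beta n (N - n) x) (int k * 2 ^ (N - m))"
proof -
  define M e where "M = max m n" and "e = N - M"
  have "N - n = (M - n) + e" "N - m = (M - m) + e" using assms by (auto simp: M_def e_def)
  then have "Poly_Mapping.lookup (shift beta n (N - n) x) (int k * 2 ^ (N - m))
      = Poly_Mapping.lookup (shift beta n (M - n) x) (int k * 2 ^ (M - m))"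
    by (simp only: power_add mult.assoc[symmetric] lookup_shift)
  then show ?thesis by (simp add: coeffs_def M_def)
qed

lemma coeffs_level: "coeffs (n, x) (n, k) = Poly_Mapping.lookup x (int k)"
  by (simp add: coeffs_def)

lemma coeffs_even: "coeffs (n, x) (Suc m, 2 * k) = coeffs (n, x) (m, k)"
  by (simp add: coeffs_eq[of _ "Suc (max m n)"] Suc_diff_le mult_ac)

text \<open>On a floor \<open>m < n\<close> the values are merely the coefficients of
  \<open>x\<close> at multiples of \<open>2 ^ (n - m)\<close>, and the rule can fail there.\<close>

lemma coeffs_odd: "n \<le> m \<Longrightarrow> coeffs (n, x) (Suc m, Suc (2 * k)) = coeffs (n, x) (m, k) + coeffs (n, x) (m, Suc k)"
  using lookup_beta(2)[of m "shift beta n (m - n) x" "int k"] coeffs_eq[of "Suc m" "Suc m" n x "Suc (2 * k)"]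
    coeffs_eq[of m m n x k] coeffs_eq[of m m n x "Suc k"]
  by (simp add: Suc_diff_le add.commute)

text \<open>From floor \<open>n\<close> both rules determine the values upwards; below it, the even
  rule alone recovers them from a higher floor.\<close>

lemma dyadic_function_eqI:
  fixes f g :: "nat \<times> nat \<Rightarrow> int"
  assumes f0: "\<And>m k. f (Suc m, 2 * k) = f (m, k)" and g0: "\<And>m k. g (Suc m, 2 * k) = g (m, k)"
    and f1: "\<And>m k. n \<le> m \<Longrightarrow> f (Suc m, Suc (2 * k)) = f (m, k) + f (m, Suc k)"
    and g1: "\<And>m k. n \<le> m \<Longrightarrow> g (Suc m, Suc (2 * k)) = g (m, k) + g (m, Suc k)"
    and eq: "\<And>k. f (n, k) = g (n, k)"
  shows "f = g"
proof
  have up: "f (n + d, k) = g (n + d, k)" for d k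
  proof (induction d arbitrary: k)
    case (Suc d)
    show ?case
    proof (cases "even k")
      case True
      then obtain j where "k = 2 * j" by blast
      then show ?thesis using Suc f0[of "n + d" j] g0[of "n + d" j] by simp
    next
      case False
      then obtain j where "k = Suc (2 * j)" by (metis oddE Suc_eq_plus1)
      then show ?thesis using Suc f1[of "n + d" j] g1[of "n + d" j] by simp
    qed
  qed (simp add: eq)
  have down: "f (m + d, k * 2 ^ d) = f (m, k)" "g (m + d, k * 2 ^ d) = g (m, k)" for m d k
    using f0[of "m + _" "k * 2 ^ _"] g0[of "m + _" "k * 2 ^ _"]
    by (induction d) (simp_all add: mult.left_commute)
  fix x :: "nat \<times> nat"
  obtain m k where "x = (m, k)" by force
  \<comment> \<open>The value at \<open>(m, k)\<close> equals the one at
    \<open>(m + n, k * 2 ^ n)\<close>, which lies on or above floor \<open>n\<close>.\<close>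
  then show "f x = g x"
    using down[of m n k] up[of m "k * 2 ^ n"] by (simp add: add.commute)
qed

text \<open>Shifting along \<open>beta\<close> does not change \<open>coeffs\<close>. Conversely,
  equal \<open>coeffs\<close> give equal coefficients at nonnegative exponents on the floor
  \<open>max m n\<close>, and symmetry extends this to all exponents.\<close>

lemma dirlim_rel_iff:
  "dirlim_rel P_group beta = {(a, b). a \<in> (SIGMA n:UNIV. carrier (P_group n)) \<and>
     b \<in> (SIGMA n:UNIV. carrier (P_group n)) \<and> coeffs a = coeffs b}"
proof -
  have key: "(\<exists>N. m \<le> N \<and> n \<le> N \<and> shift beta m (N - m) x = shift beta n (N - n) y) \<longleftrightarrow> coeffs (m, x) = coeffs (n, y)"
    if x: "x \<in> carrier (P_group m)" and y: "y \<in> carrier (P_group n)" for m n x y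
  proof
    assume "\<exists>N. m \<le> N \<and> n \<le> N \<and> shift beta m (N - m) x = shift beta n (N - n) y"
    then obtain N where N: "m \<le> N" "n \<le> N" "shift beta m (N - m) x = shift beta n (N - n) y" by blast
    have same: "coeffs (m, x) = coeffs (N, shift beta m (N - m) x)" if "m \<le> N" for m x
    proof
      fix i :: "nat \<times> nat"
      obtain a k where i: "i = (a, k)" by force
      define K where "K = max a N"
      have "shift beta N (K - N) (shift beta m (N - m) x) = shift beta m (K - m) x"
        using shift_plus[of m "N - m" "K - N" x] that by (simp add: K_def)
      then show "coeffs (m, x) i = coeffs (N, shift beta m (N - m) x) i"
        unfolding i using that by (simp add: coeffs_eq[of a K] K_def)
    qed
    show "coeffs (m, x) = coeffs (n, y)"
      using same[OF N(1)] same[OF N(2)] N(3) by simp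
  next
    assume eq: "coeffs (m, x) = coeffs (n, y)"
    define N where "N = max m n"
    have le: "m \<le> N" "n \<le> N" by (auto simp: N_def)
    have xN: "shift beta m (N - m) x \<in> carrier (P_group N)" and yN: "shift beta n (N - n) y \<in> carrier (P_group N)"
      using shift_in_P[OF x, of "N - m"] shift_in_P[OF y, of "N - n"] by (auto simp: N_def)
    have "shift beta m (N - m) x = shift beta n (N - n) y"
    proof (rule poly_mapping_eqI)
      fix j
      have "Poly_Mapping.lookup (shift beta m (N - m) x) (int (nat \<bar>j\<bar>)) = Poly_Mapping.lookup (shift beta n (N - n) y) (int (nat \<bar>j\<bar>))"
        using fun_cong[OF eq, of "(N, nat \<bar>j\<bar>)"] coeffs_eq[of N N m x "nat \<bar>j\<bar>"]
          coeffs_eq[of N N n y "nat \<bar>j\<bar>"] le by simp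
      then show "Poly_Mapping.lookup (shift beta m (N - m) x) j = Poly_Mapping.lookup (shift beta n (N - n) y) j"
        using P_symmetric[OF xN, of j] P_symmetric[OF yN, of j] by simp
    qed
    then show "\<exists>N. m \<le> N \<and> n \<le> N \<and> shift beta m (N - m) x = shift beta n (N - n) y"
      by (intro exI[of _ N]) (simp add: N_def)
  qed
  show ?thesis
  proof (rule Set.set_eqI)
    fix z :: "(nat \<times> laurent) \<times> (nat \<times> laurent)"
    obtain m x n y where z: "z = ((m, x), (n, y))" by (metis surj_pair)
    show "z \<in> dirlim_rel P_group beta \<longleftrightarrow> z \<in> {(a, b). a \<in> (SIGMA n:UNIV. carrier (P_group n)) \<and>
        b \<in> (SIGMA n:UNIV. carrier (P_group n)) \<and> coeffs a = coeffs b}"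
      unfolding z dirlim_rel_def using key[of x m y n] by simp blast
  qed
qed

definition dirlim_op :: "nat \<times> laurent \<Rightarrow> nat \<times> laurent \<Rightarrow> nat \<times> laurent" where
  "dirlim_op a b = (max (fst a) (fst b), shift beta (fst a) (max (fst a) (fst b) - fst a) (snd a)
     + shift beta (fst b) (max (fst a) (fst b) - fst b) (snd b))"

lemma coeffs_dirlim_op: "coeffs (dirlim_op a b) i = coeffs a i + coeffs b i"
proof -
  obtain m x where a: "a = (m, x)" by force
  obtain n y where b: "b = (n, y)" by force
  obtain l k where i: "i = (l, k)" by force
  define N where "N = max m n"
  define K where "K = max l N"
  have le: "m \<le> N" "n \<le> N" "l \<le> K" "N \<le> K" "m \<le> K" "n \<le> K" by (auto simp: N_def K_def)
  have sh: "shift beta N (K - N) (shift beta m (N - m) x) = shift beta m (K - m) x"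
    "shift beta N (K - N) (shift beta n (N - n) y) = shift beta n (K - n) y"
    using shift_plus[of m "N - m" "K - N" x] shift_plus[of n "N - n" "K - N" y] le by simp_all
  have opr: "dirlim_op (m, x) (n, y) = (N, shift beta m (N - m) x + shift beta n (N - n) y)"
    by (simp add: dirlim_op_def N_def)
  show ?thesis
    unfolding a b i opr coeffs_eq[OF le(3,4)] coeffs_eq[OF le(3,5)] coeffs_eq[OF le(3,6)]
    by (simp only: shift_add sh lookup_add)
qed

interpretation dirlim: invariant_quotient coeffs "SIGMA n:UNIV. carrier (P_group n)"
  "dirlim_rel P_group beta" dirlim_op "dirlim P_group beta"
proof
  show "dirlim_op a b \<in> (SIGMA n:UNIV. carrier (P_group n))"
    if "a \<in> (SIGMA n:UNIV. carrier (P_group n))" "b \<in> (SIGMA n:UNIV. carrier (P_group n))" for a b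
  proof -
    have "shift beta m (max m n - m) x \<in> carrier (P_group (max m n))"
      if "x \<in> carrier (P_group m)" for m n x
      using shift_in_P[OF that, of "max m n - m"] by simp
    from this[of "snd a" "fst a" "fst b"] this[of "snd b" "fst b" "fst a"] that show ?thesis
      by (auto simp: dirlim_op_def max.commute intro!: P_add)
  qed
  show "X \<otimes>\<^bsub>dirlim P_group beta\<^esub> Y = (\<Union>a\<in>X. \<Union>b\<in>Y. dirlim_rel P_group beta `` {dirlim_op a b})" for X Y
    by (simp add: dirlim_def dirlim_class_def dirlim_op_def case_prod_beta)
qed (simp_all add: dirlim_def flip: dirlim_rel_iff, rule coeffs_dirlim_op)

text \<open>Each application of \<open>beta\<close> keeps the old coefficients and adds sums of two
  of them, so no negative value can arise; in the other direction the coefficients of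
  \<open>x\<close> are themselves values of \<open>coeffs\<close>, up to symmetry.\<close>

lemma coeffs_nonneg_iff:
  assumes x: "x \<in> carrier (P_group n)"
  shows "(\<forall>i. 0 \<le> coeffs (n, x) i) \<longleftrightarrow> (\<forall>j. 0 \<le> Poly_Mapping.lookup x j)"
proof
  assume "\<forall>i. 0 \<le> coeffs (n, x) i"
  then have "0 \<le> Poly_Mapping.lookup x (int k)" for k by (metis coeffs_level)
  then show "\<forall>j. 0 \<le> Poly_Mapping.lookup x j" using P_symmetric[OF x] by metis
next
  assume *: "\<forall>j. 0 \<le> Poly_Mapping.lookup x j"
  have "\<forall>j. 0 \<le> Poly_Mapping.lookup (shift beta n d x) j" for d
  proof (induction d)
    case (Suc d)
    show ?case
    proof
      fix j show "0 \<le> Poly_Mapping.lookup (shift beta n (Suc d) x) j"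
        using Suc by (cases j rule: parity_int_cases) auto
    qed
  qed (use * in simp)
  then show "\<forall>i. 0 \<le> coeffs (n, x) i" by (auto simp: coeffs_def)
qed

section \<open>The K-groups\<close>

definition K0_op :: "'a::star_ring mat \<times> 'a mat \<Rightarrow> 'a mat \<times> 'a mat \<Rightarrow> 'a mat \<times> 'a mat" where
  "K0_op a b = (fst a \<boxplus> fst b, snd a \<boxplus> snd b)"

definition diff_value :: "('m \<Rightarrow> 'i \<Rightarrow> 'f::ab_group_add) \<Rightarrow> 'm \<times> 'm \<Rightarrow> 'i \<Rightarrow> 'f" where
  "diff_value H a i = H (fst a) i - H (snd a) i"

text \<open>A complete additive invariant of projections makes the semigroup cancellative, so that the
  Grothendieck relation is equality of formal differences of the invariant.\<close>

lemma K0_invariant_quotient: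
  fixes H :: "'a::star_ring mat \<Rightarrow> 'i \<Rightarrow> 'f::ab_group_add"
  assumes zero: "0 \<in> S"
    and mvn: "\<And>p r. p \<in> projs S \<Longrightarrow> r \<in> projs S \<Longrightarrow> mvn S p r \<longleftrightarrow> H p = H r"
    and add: "\<And>p r i. p \<in> projs S \<Longrightarrow> r \<in> projs S \<Longrightarrow> H (p \<boxplus> r) i = H p i + H r i"
  shows "invariant_quotient (diff_value H) (projs S \<times> projs S) (K0_rel S) K0_op (K0_unital S)"
proof
  have key: "(\<exists>s\<in>projs S. mvn S (p \<boxplus> r' \<boxplus> s) (p' \<boxplus> r \<boxplus> s)) \<longleftrightarrow> diff_value H (p, r) = diff_value H (p', r')"
    if P: "p \<in> projs S" "r \<in> projs S" "p' \<in> projs S" "r' \<in> projs S" for p r p' r'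
  proof -
    have "mvn S (p \<boxplus> r' \<boxplus> s) (p' \<boxplus> r \<boxplus> s) \<longleftrightarrow> diff_value H (p, r) = diff_value H (p', r')" if s: "s \<in> projs S" for s
    proof -
      have "mvn S (p \<boxplus> r' \<boxplus> s) (p' \<boxplus> r \<boxplus> s) \<longleftrightarrow> H (p \<boxplus> r' \<boxplus> s) = H (p' \<boxplus> r \<boxplus> s)"
        using P s by (intro mvn dsum_in_projs zero)
      also have "\<dots> \<longleftrightarrow> (\<forall>i. H p i + (H r' i + H s i) = H p' i + (H r i + H s i))"
        using P s by (simp add: fun_eq_iff add dsum_in_projs zero)
      also have "\<dots> \<longleftrightarrow> (\<forall>i. H p i - H r i = H p' i - H r' i)"
      proof -
        have "a + (b + e) = c + (d + e) \<longleftrightarrow> a - d = c - b" for a b c d e :: 'f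
        proof -
          have "a + (b + e) = c + (d + e) \<longleftrightarrow> (a + b) + e = (c + d) + e" by (simp only: add.assoc)
          also have "\<dots> \<longleftrightarrow> a + b = c + d" by (rule add_right_cancel)
          also have "\<dots> \<longleftrightarrow> a - d = c - b" by (simp add: diff_eq_eq eq_diff_eq algebra_simps)
          finally show ?thesis .
        qed
        then show ?thesis by simp
      qed
      finally show ?thesis by (simp add: fun_eq_iff diff_value_def)
    qed
    \<comment> \<open>The condition is the same for every \<open>s\<close>, so the existential only
      needs some projection, and the empty matrix is one.\<close>
    moreover have "0\<^sub>m 0 0 \<in> projs S" by (rule zero_in_projs[OF zero])
    ultimately show ?thesis by blast
  qed
  show "K0_rel S = {(a, b). a \<in> projs S \<times> projs S \<and> b \<in> projs S \<times> projs S \<and> diff_value H a = diff_value H b}"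
  proof (rule Set.set_eqI)
    fix z :: "('a mat \<times> 'a mat) \<times> ('a mat \<times> 'a mat)"
    obtain p r p' r' where z: "z = ((p, r), (p', r'))" by (metis surj_pair)
    show "z \<in> K0_rel S \<longleftrightarrow> z \<in> {(a, b). a \<in> projs S \<times> projs S \<and> b \<in> projs S \<times> projs S \<and> diff_value H a = diff_value H b}"
      unfolding z K0_rel_def using key[of p r p' r'] by simp blast
  qed
  show "X \<otimes>\<^bsub>K0_unital S\<^esub> Y = (\<Union>a\<in>X. \<Union>b\<in>Y. K0_rel S `` {K0_op a b})" for X Y
    by (simp add: K0_unital_def K0_diff_def K0_op_def case_prod_beta)
  show "K0_op a b \<in> projs S \<times> projs S" if "a \<in> projs S \<times> projs S" "b \<in> projs S \<times> projs S" for a b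
    using that by (auto simp: K0_op_def intro!: dsum_in_projs zero)
  show "diff_value H (K0_op a b) i = diff_value H a i + diff_value H b i"
    if "a \<in> projs S \<times> projs S" "b \<in> projs S \<times> projs S" for a b i
    using that by (auto simp: diff_value_def K0_op_def add)
qed (simp add: K0_unital_def)

lemma mvn_mono: "S \<subseteq> S' \<Longrightarrow> mvn S p r \<Longrightarrow> mvn S' p r"
  unfolding mvn_def by blast

section \<open>The integer invariant of projections over the limit algebra\<close>

context pascal_limit begin

lemma T_shift: "k \<le> 2 ^ m \<Longrightarrow> T (m + d) (k * 2 ^ d) = T m k"
proof (induction d)
  case (Suc d)
  have "k * 2 ^ d \<le> 2 ^ (m + d)" using Suc by (simp add: power_add)
  then have "T (Suc (m + d)) (2 * (k * 2 ^ d)) = T (m + d) (k * 2 ^ d)" by (intro ext T_even)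
  then show ?case using Suc by (simp add: mult_ac)
qed simp

lemma mt_last: "mt n (2 ^ n) p = mtrace chi p"
  by (simp add: mt_def T_last)

text \<open>The floor can be raised beyond any bound, so that several projections can be brought to
  a common one.\<close>

lemma stageE:
  assumes "p \<in> projs UNIV"
  obtains n p' where "M \<le> n" "p' \<in> projs (B n)" "mvn UNIV p p'"
proof -
  obtain n p' where "p' \<in> projs (B n)" "mvn UNIV p p'"
    using projection_equivalent_to_stage[OF assms] .
  then show ?thesis
    using projs_mono[OF B_mono[of n "max M n"]] by (intro that[of "max M n" p']) auto
qed

lemma mt_nat_UNIV:
  assumes p: "p \<in> projs UNIV" and k: "k \<le> 2 ^ m"
  shows "mt m k p \<in> \<nat>"
proof -
  obtain n p' where n: "m \<le> n" "p' \<in> projs (B n)" "mvn UNIV p p'" using stageE[OF p] .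
  have "mt m k p = mt n (k * 2 ^ (n - m)) p'"
    using mt_mvn[OF k n(3)] T_shift[OF k, of "n - m"] n(1) by (simp add: mt_def)
  then show ?thesis using mt_nat[OF n(2) vertex_le[OF k n(1)]] by simp
qed

text \<open>Floor and \<open>Re\<close> only change the type, since traces of projections are
  natural numbers. The default 0 for \<open>k > 2 ^ m\<close> matches the coefficients of a Laurent
  polynomial beyond its range, so that \<open>g\<close> and \<open>coeffs\<close> can be compared as
  total functions.\<close>

definition g :: "'a mat \<Rightarrow> nat \<times> nat \<Rightarrow> int" where
  "g p = (\<lambda>(m, k). if k \<le> 2 ^ m then \<lfloor>Re (mt m k p)\<rfloor> else 0)"

lemma of_int_g: "p \<in> projs UNIV \<Longrightarrow> k \<le> 2 ^ m \<Longrightarrow> of_int (g p (m, k)) = mt m k p"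
  using mt_nat_UNIV[of p k m] by (auto simp: g_def elim!: Nats_cases)

lemma g_beyond: "\<not> k \<le> 2 ^ m \<Longrightarrow> g p (m, k) = 0"
  by (simp add: g_def)

lemma g_nonneg: "p \<in> projs UNIV \<Longrightarrow> 0 \<le> g p i"
  using mt_nat_UNIV[of p "snd i" "fst i"] by (auto simp: g_def case_prod_beta elim!: Nats_cases)

lemma g_dsum:
  assumes "p \<in> projs UNIV" "r \<in> projs UNIV"
  shows "g (p \<boxplus> r) i = g p i + g r i"
proof -
  obtain m k where i: "i = (m, k)" by force
  show ?thesis
  proof (cases "k \<le> 2 ^ m")
    case True
    have "complex_of_int (g (p \<boxplus> r) i) = complex_of_int (g p i + g r i)"
      unfolding i of_int_add using True assms by (simp add: of_int_g dsum_in_projs mt_dsum)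
    then show ?thesis by (simp only: of_int_eq_iff)
  qed (simp add: i g_beyond)
qed

lemma mvn_iff_g:
  assumes p: "p \<in> projs UNIV" and r: "r \<in> projs UNIV"
  shows "mvn UNIV p r \<longleftrightarrow> g p = g r"
proof
  assume "mvn UNIV p r"
  then show "g p = g r" by (auto simp: g_def mt_mvn fun_eq_iff)
next
  assume eq: "g p = g r"
  obtain n0 r0 where r0: "r0 \<in> projs (B n0)" "mvn UNIV r r0" using stageE[OF r] by metis
  \<comment> \<open>Bounding the second floor below by the first puts both representatives on floor
    \<open>n\<close>.\<close>
  obtain n p' where n: "n0 \<le> n" "p' \<in> projs (B n)" "mvn UNIV p p'" using stageE[OF p] .
  have r': "r0 \<in> projs (B n)" using projs_mono[OF B_mono[OF n(1)]] r0 by auto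
  have "mt n k p' = mt n k r0" if k: "k \<le> 2 ^ n" for k
    using mt_mvn[OF k n(3)] mt_mvn[OF k r0(2)] of_int_g[OF p k] of_int_g[OF r k] eq by simp
  then have "mvn UNIV p' r0"
    using mvn_if_traces_eq[OF n(2) r'] mvn_mono[of "B n" UNIV] by auto
  moreover have "p' \<in> projs UNIV" "r0 \<in> projs UNIV" using projs_mono[of "B n" UNIV] n r' by auto
  ultimately show "mvn UNIV p r"
    using mvn_trans[OF star_subring_UNIV p _ _ n(3)] mvn_trans[OF star_subring_UNIV p _ r _ mvn_sym[OF star_subring_UNIV r0(2)]]
    by blast
qed

lemma g_even: "g p (Suc m, 2 * k) = g p (m, k)"
  by (simp add: g_def mt_def T_even mtrace_def)

lemma mt_odd:
  assumes p: "p \<in> projs (B m)" and k: "k < 2 ^ m"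
  shows "mt (Suc m) (Suc (2 * k)) p = mt m k p + mt m (Suc k) p"
proof -
  have "p $$ (i, i) \<in> B m" if "i < dim_row p" for i
    using p that by (auto simp: projs_def elements_mat_subset_iff)
  then show ?thesis using T_odd[OF _ k] by (simp add: mt_def mtrace_def sum.distrib)
qed

text \<open>The bridge between traces and polynomials: agreement on floor \<open>n\<close>
  propagates to all dyadic numbers by \<open>dyadic_function_eqI\<close>. At
  \<open>k = 2 ^ n\<close> the coefficient is 0, so the hypothesis makes the traces of
  \<open>p\<close> and \<open>r\<close> under \<open>chi\<close> equal.\<close>

lemma g_diff_eq_coeffs:
  assumes p: "p \<in> projs (B n)" and r: "r \<in> projs (B n)" and x: "x \<in> carrier (P_group n)"
    and eq: "\<And>k. k \<le> 2 ^ n \<Longrightarrow> mt n k p - mt n k r = of_int (Poly_Mapping.lookup x (int k))"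
  shows "(\<lambda>i. g p i - g r i) = coeffs (n, x)"
proof (rule dyadic_function_eqI[where n = n])
  have U: "p \<in> projs UNIV" "r \<in> projs UNIV" using p r projs_mono[of "B n" UNIV] by auto
  have P: "\<And>j. 2 ^ n \<le> j \<Longrightarrow> Poly_Mapping.lookup x j = 0" using x by (simp add: P_carrier)
  show "g p (Suc m, 2 * k) - g r (Suc m, 2 * k) = g p (m, k) - g r (m, k)" for m k
    by (simp add: g_even)
  show "coeffs (n, x) (Suc m, 2 * k) = coeffs (n, x) (m, k)" for m k by (rule coeffs_even)
  show "coeffs (n, x) (Suc m, Suc (2 * k)) = coeffs (n, x) (m, k) + coeffs (n, x) (m, Suc k)" if "n \<le> m" for m k
    using that by (rule coeffs_odd)
  show "g p (Suc m, Suc (2 * k)) - g r (Suc m, Suc (2 * k))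
      = g p (m, k) - g r (m, k) + (g p (m, Suc k) - g r (m, Suc k))" if m: "n \<le> m" for m k
  proof (cases "k < 2 ^ m")
    case True
    have pm: "p \<in> projs (B m)" "r \<in> projs (B m)" using p r projs_mono[OF B_mono[OF m]] by auto
    have le: "k \<le> 2 ^ m" "Suc k \<le> 2 ^ m" "Suc (2 * k) \<le> 2 ^ Suc m" using True by auto
    have "complex_of_int (g p (Suc m, Suc (2 * k)) - g r (Suc m, Suc (2 * k)))
      = complex_of_int (g p (m, k) - g r (m, k) + (g p (m, Suc k) - g r (m, Suc k)))"
      unfolding of_int_add of_int_diff of_int_g[OF U(1) le(1)] of_int_g[OF U(2) le(1)] of_int_g[OF U(1) le(2)]
        of_int_g[OF U(2) le(2)] of_int_g[OF U(1) le(3)] of_int_g[OF U(2) le(3)]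
        mt_odd[OF pm(1) True] mt_odd[OF pm(2) True] by simp
    then show ?thesis by (simp only: of_int_eq_iff)
  next
    case False
    \<comment> \<open>For \<open>k = 2 ^ m\<close> the left side is the default 0 beyond the last
      vertex, so the right side, the difference at the dyadic number 1, must vanish too.\<close>
    have "g p (m, 2 ^ m) - g r (m, 2 ^ m) = 0"
    proof -
      have "complex_of_int (g p (m, 2 ^ m) - g r (m, 2 ^ m)) = mt n (2 ^ n) p - mt n (2 ^ n) r"
        using U by (simp add: of_int_g mt_last)
      also have "\<dots> = 0" using eq[of "2 ^ n"] P[of "2 ^ n"] by simp
      finally show ?thesis by (simp only: of_int_eq_0_iff)
    qed
    then show ?thesis using False by (cases "k = 2 ^ m") (simp_all add: g_beyond)
  qed
  show "g p (n, k) - g r (n, k) = coeffs (n, x) (n, k)" for k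
  proof (cases "k \<le> 2 ^ n")
    case True
    then have "complex_of_int (g p (n, k) - g r (n, k)) = of_int (coeffs (n, x) (n, k))"
      using U eq[OF True] by (simp add: of_int_g coeffs_level)
    then show ?thesis by (simp only: of_int_eq_iff)
  next
    case False
    then have "int (2 ^ n) \<le> int k" by simp
    then have "Poly_Mapping.lookup x (int k) = 0" by (intro P) simp
    then show ?thesis using False by (simp add: g_beyond coeffs_level)
  qed
qed

subsection \<open>The unitization of the ideal\<close>

abbreviation CI :: "'a set" where "CI \<equiv> limit_ideal \<iota>"

definition phi :: "'a unitization \<Rightarrow> 'a" where
  "phi x = ideal_part x + scalar_part x *\<^sub>C 1"

text \<open>The inverse of \<open>phi\<close> on \<open>unitize CI\<close> only: on the unitization
  of the whole algebra \<open>phi\<close> sends both units, the inner and the adjoined one, to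
  1.\<close>

definition psi :: "'a \<Rightarrow> 'a unitization" where
  "psi a = Unitization (a - chi a *\<^sub>C 1) (chi a)"

lemma star_one: "star (1::'a) = 1"
  using star_mult[of "star (1::'a)" 1] by (simp add: star_star)

lemmas unitization_defs = zero_unitization_def one_unitization_def plus_unitization_def minus_unitization_def
    uminus_unitization_def times_unitization_def star_unitization_def scaleC_unitization_def

lemma phi_hom: "star_hom phi"
  unfolding star_hom_def phi_def unitization_defs
  by (simp add: algebra_simps scaleC_add_left scaleC_add_right scaleC_mult_left scaleC_mult_right scaleC_scaleC star_add
      star_scaleC star_one)

lemma psi_hom: "star_hom psi"
  unfolding star_hom_def psi_def unitization_defs
  by (simp add: algebra_simps chi_add chi_mult chi_star scaleC_add_left scaleC_minus_right scaleC_mult_left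
      scaleC_mult_right scaleC_scaleC star_diff star_scaleC star_one)

lemma scalar_part_hom: "star_hom (scalar_part :: 'a unitization \<Rightarrow> complex)"
  by (simp add: star_hom_def unitization_defs star_complex_def)

lemma phi_psi [simp]: "phi (psi a) = a"
  by (simp add: phi_def psi_def)

lemma psi_in_unitize: "psi a \<in> unitize CI"
  by (simp add: psi_def unitize_def limit_ideal_eq_kernel chi_diff chi_scaleC)

lemma chi_phi: "x \<in> unitize CI \<Longrightarrow> chi (phi x) = scalar_part x"
  by (simp add: phi_def unitize_def limit_ideal_eq_kernel chi_add chi_scaleC)

lemma psi_phi: "x \<in> unitize CI \<Longrightarrow> psi (phi x) = x"
  by (cases x) (simp add: psi_def chi_phi, simp add: phi_def)

lemma zero_in_unitize: "0 \<in> unitize CI"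
  using psi_in_unitize[of 0] star_hom_zero[OF psi_hom] by simp

definition gU :: "'a unitization mat \<Rightarrow> nat \<times> nat \<Rightarrow> int" where
  "gU p = g (map_mat phi p)"

lemma phi_projs: "p \<in> projs (unitize CI) \<Longrightarrow> map_mat phi p \<in> projs UNIV"
  by (rule map_mat_projs[OF phi_hom]) auto

lemma psi_projs: "p \<in> projs UNIV \<Longrightarrow> map_mat psi p \<in> projs (unitize CI)"
  by (rule map_mat_projs[OF psi_hom]) (auto simp: psi_in_unitize)

lemma map_psi_phi: "elements_mat p \<subseteq> unitize CI \<Longrightarrow> map_mat psi (map_mat phi p) = p"
  by (rule eq_matI) (auto simp: elements_mat_subset_iff psi_phi)

lemma map_phi_psi [simp]: "map_mat phi (map_mat psi p) = p"
  by (rule eq_matI) auto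

lemma mvn_iff_gU:
  assumes p: "p \<in> projs (unitize CI)" and r: "r \<in> projs (unitize CI)"
  shows "mvn (unitize CI) p r \<longleftrightarrow> gU p = gU r"
proof -
  have "mvn (unitize CI) p r" if "mvn UNIV (map_mat phi p) (map_mat phi r)"
  proof -
    have "psi ` UNIV \<subseteq> unitize CI" by (auto simp: psi_in_unitize)
    from mvn_map_mat[OF psi_hom this that] show ?thesis
      using p r map_psi_phi[of p] map_psi_phi[of r] by (simp add: projs_def)
  qed
  then have "mvn (unitize CI) p r \<longleftrightarrow> mvn UNIV (map_mat phi p) (map_mat phi r)"
    using mvn_map_mat[OF phi_hom, of "unitize CI" UNIV p r] by auto
  then show ?thesis using mvn_iff_g[OF phi_projs[OF p] phi_projs[OF r]] by (simp add: gU_def)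
qed

lemma gU_dsum: "p \<in> projs (unitize CI) \<Longrightarrow> r \<in> projs (unitize CI) \<Longrightarrow> gU (p \<boxplus> r) i = gU p i + gU r i"
  by (simp add: gU_def map_mat_dsum[OF phi_hom] g_dsum phi_projs)

lemma KU: "invariant_quotient (diff_value gU) (projs (unitize CI) \<times> projs (unitize CI)) (K0_rel (unitize CI))
    K0_op (K0_unital (unitize CI))"
  by (rule K0_invariant_quotient[OF zero_in_unitize mvn_iff_gU gU_dsum])

text \<open>Complex projections of equal trace are compared inside \<open>'a\<close>, where \<open>complex\<close> sits as the
  multiples of the unit, and the equivalence is pushed back by the character.\<close>

lemma mvn_complex_iff:
  fixes P Q :: "complex mat"
  assumes P: "P \<in> projs UNIV" and Q: "Q \<in> projs UNIV"
  shows "mvn UNIV P Q \<longleftrightarrow> (\<lambda>_::unit. mtrace (\<lambda>x. x) P) = (\<lambda>_. mtrace (\<lambda>x. x) Q)"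
proof
  assume "mvn UNIV P Q"
  then have "mtrace (\<lambda>x. x) P = mtrace (\<lambda>x. x) Q" by (rule mtrace_mvn[rotated 2]) auto
  then show "(\<lambda>_::unit. mtrace (\<lambda>x. x) P) = (\<lambda>_. mtrace (\<lambda>x. x) Q)" by simp
next
  define \<theta> where "\<theta> c = c *\<^sub>C (1::'a)" for c
  have hom: "star_hom \<theta>"
    by (simp add: star_hom_def \<theta>_def scaleC_add_left scaleC_mult_left scaleC_mult_right scaleC_scaleC star_scaleC
        star_one star_complex_def mult.commute)
  have chi: "chi (\<theta> c) = c" for c by (simp add: \<theta>_def chi_scaleC)
  have inv: "map_mat chi (map_mat \<theta> A) = A" for A by (rule eq_matI) (simp_all add: chi)
  have B0: "map_mat \<theta> A \<in> projs (B 0)" if "A \<in> projs UNIV" for A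
    by (rule map_mat_projs[OF hom _ that]) (auto simp: \<theta>_def)
  \<comment> \<open>Floor 0 suffices: it consists of two summands of size 1, and
    \<open>\<theta> c\<close> has the entry \<open>c\<close> in both.\<close>
  have mt: "mt 0 k (map_mat \<theta> A) = mtrace (\<lambda>x. x) A" if "A \<in> projs UNIV" "k \<le> 2 ^ 0" for A k
  proof -
    have "T 0 k 1 = 1" using that T_tr[OF B_one that(2)] by (simp add: tr_sum comp_one)
    moreover have "dim_col A = dim_row A" using that by (simp add: projs_def)
    ultimately show ?thesis using that by (simp add: mt_def mtrace_def \<theta>_def T_scaleC)
  qed
  assume "(\<lambda>_::unit. mtrace (\<lambda>x. x) P) = (\<lambda>_. mtrace (\<lambda>x. x) Q)"
  then have "mtrace (\<lambda>x. x) P = mtrace (\<lambda>x. x) Q" by (rule fun_cong)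
  then have "mvn (B 0) (map_mat \<theta> P) (map_mat \<theta> Q)"
    using mt[OF P] mt[OF Q] by (intro mvn_if_traces_eq B0 P Q) simp
  from mvn_map_mat[OF chi_hom _ this, of UNIV] show "mvn UNIV P Q" by (simp only: inv subset_UNIV simp_thms)
qed

text \<open>The single trace is made a function on \<open>unit\<close> to fit the shape of
  \<open>invariant_quotient\<close>.\<close>

lemma KC: "invariant_quotient (diff_value (\<lambda>P (_::unit). mtrace (\<lambda>x. x) P)) (projs UNIV \<times> projs UNIV)
    (K0_rel (UNIV :: complex set)) K0_op (K0_unital UNIV)"
proof (rule K0_invariant_quotient)
  show "mtrace (\<lambda>x. x) (p \<boxplus> r) = mtrace (\<lambda>x. x) p + mtrace (\<lambda>x. x) r"
    if "p \<in> projs UNIV" "r \<in> projs UNIV" for p r :: "complex mat"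
    using that by (intro mtrace_dsum) (auto simp: projs_def)
  show "mvn UNIV p r \<longleftrightarrow> (\<lambda>_::unit. mtrace (\<lambda>x. x) p) = (\<lambda>_. mtrace (\<lambda>x. x) r)"
    if "p \<in> projs UNIV" "r \<in> projs UNIV" for p r :: "complex mat"
    by (rule mvn_complex_iff[OF that])
qed simp

text \<open>Under the identification by \<open>phi\<close> the canonical character of the
  unitization is \<open>chi\<close>, the trace at the dyadic number 1.\<close>

lemma trace_scalar_part:
  assumes p: "p \<in> projs (unitize CI)"
  shows "mtrace (\<lambda>x. x) (map_mat scalar_part p) = of_int (gU p (0, 1))"
proof -
  have "p $$ (i, i) \<in> unitize CI" if "i < dim_row p" for i
    using p that by (auto simp: projs_def elements_mat_subset_iff)
  moreover have "dim_col p = dim_row p" using p by (simp add: projs_def)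
  ultimately have "mtrace (\<lambda>x. x) (map_mat scalar_part p) = mtrace chi (map_mat phi p)"
    by (simp add: mtrace_def chi_phi)
  also have "\<dots> = of_int (gU p (0, 1))"
    using of_int_g[OF phi_projs[OF p], of 1 0] mt_last[of 0] by (simp add: gU_def)
  finally show ?thesis .
qed

text \<open>Turns the kernel that defines \<open>K0\<close> into one linear condition on the
  invariant, its vanishing at the dyadic number 1.\<close>

lemma K0_map_scalar_part:
  assumes X: "X \<in> carrier (K0_unital (unitize CI))"
  shows "K0_map UNIV scalar_part X = \<one>\<^bsub>K0_unital UNIV\<^esub> \<longleftrightarrow> inv_value (diff_value gU) X (0, 1) = 0"
proof -
  interpret KU: invariant_quotient "diff_value gU" "projs (unitize CI) \<times> projs (unitize CI)" "K0_rel (unitize CI)"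
    K0_op "K0_unital (unitize CI)" by (rule KU)
  interpret KC: invariant_quotient "diff_value (\<lambda>P (_::unit). mtrace (\<lambda>x. x) P)" "projs UNIV \<times> projs UNIV"
    "K0_rel (UNIV :: complex set)" K0_op "K0_unital UNIV" by (rule KC)
  define c where "c = complex_of_int (inv_value (diff_value gU) X (0, 1))"
  have mem: "(map_mat scalar_part (fst a), map_mat scalar_part (snd a)) \<in> projs UNIV \<times> projs UNIV \<and>
      diff_value (\<lambda>P (_::unit). mtrace (\<lambda>x. x) P) (map_mat scalar_part (fst a), map_mat scalar_part (snd a)) = (\<lambda>_. c)"
    if "a \<in> X" for a
  proof -
    have a: "a \<in> projs (unitize CI) \<times> projs (unitize CI)" "diff_value gU a = inv_value (diff_value gU) X"
      using KU.inv_value_member[OF X that] by auto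
    have "map_mat scalar_part p \<in> projs UNIV" if "p \<in> projs (unitize CI)" for p
      using map_mat_projs[OF scalar_part_hom _ that] by auto
    then show ?thesis
      using a(1) trace_scalar_part[of "fst a"] trace_scalar_part[of "snd a"]
      unfolding c_def a(2)[symmetric] by (auto simp: diff_value_def)
  qed
  have "X \<noteq> {}"
    using X KU.cls_eq by (elim KU.carrierE) auto
  then obtain a where a: "a \<in> X" by blast
  define P where "P a = (map_mat scalar_part (fst a), map_mat scalar_part (snd a))" for a :: "'a unitization mat \<times> 'a unitization mat"
  let ?D = "diff_value (\<lambda>P (_::unit). mtrace (\<lambda>x. x) P)"
  have PX: "P b \<in> projs UNIV \<times> projs UNIV" "?D (P b) = (\<lambda>_. c)" if "b \<in> X" for b
    using mem[OF that] by (simp_all add: P_def)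
  \<comment> \<open>\<open>K0_map\<close> is a union over all representatives of \<open>X\<close>;
    it is a single class because all of them have the same trace difference
    \<open>c\<close>.\<close>
  have "K0_rel UNIV `` {P b} = K0_rel UNIV `` {P a}" if "b \<in> X" for b
    unfolding KC.cls_eq[OF PX(1)[OF that]] KC.cls_eq[OF PX(1)[OF a]] PX(2)[OF that] PX(2)[OF a] ..
  moreover have "K0_map UNIV scalar_part X = (\<Union>b\<in>X. K0_rel UNIV `` {P b})"
    by (simp add: K0_map_def K0_diff_def P_def case_prod_beta)
  ultimately have 1: "K0_map UNIV scalar_part X = K0_rel UNIV `` {P a}" using a by blast
  have z: "(0\<^sub>m 0 0, 0\<^sub>m 0 0) \<in> projs UNIV \<times> (projs UNIV :: complex mat set)" by (auto intro: zero_in_projs)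
  have 2: "\<one>\<^bsub>K0_unital UNIV\<^esub> = K0_rel UNIV `` {(0\<^sub>m 0 0, 0\<^sub>m 0 0 :: complex mat)}"
    by (simp add: K0_unital_def K0_diff_def)
  have 3: "diff_value (\<lambda>P (_::unit). mtrace (\<lambda>x. x) P) (0\<^sub>m 0 0, 0\<^sub>m 0 0 :: complex mat) = (\<lambda>_. 0)"
    by (simp add: diff_value_def fun_eq_iff)
  have "K0_rel UNIV `` {P a} = K0_rel UNIV `` {(0\<^sub>m 0 0, 0\<^sub>m 0 0)} \<longleftrightarrow> (\<lambda>_::unit. c) = (\<lambda>_. 0)"
  proof
    assume "K0_rel UNIV `` {P a} = K0_rel UNIV `` {(0\<^sub>m 0 0, 0\<^sub>m 0 0)}"
    then have "?D (P a) = ?D (0\<^sub>m 0 0, 0\<^sub>m 0 0)"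
      using KC.inv_value_cls[OF PX(1)[OF a]] KC.inv_value_cls[OF z] by simp
    then show "(\<lambda>_::unit. c) = (\<lambda>_. 0)" unfolding PX(2)[OF a] 3 .
  next
    assume "(\<lambda>_::unit. c) = (\<lambda>_. 0)"
    then show "K0_rel UNIV `` {P a} = K0_rel UNIV `` {(0\<^sub>m 0 0, 0\<^sub>m 0 0)}"
      unfolding KC.cls_eq[OF PX(1)[OF a]] KC.cls_eq[OF z] PX(2)[OF a] 3 by simp
  qed
  then have "K0_map UNIV scalar_part X = \<one>\<^bsub>K0_unital UNIV\<^esub> \<longleftrightarrow> (\<lambda>_::unit. c) = (\<lambda>_. 0)"
    unfolding 1 2 .
  then show ?thesis by (simp add: fun_eq_iff c_def)
qed

lemma K0_carrier:
  "X \<in> carrier (K0 CI) \<longleftrightarrow> X \<in> carrier (K0_unital (unitize CI)) \<and> inv_value (diff_value gU) X (0, 1) = 0"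
  using K0_map_scalar_part[of X] by (auto simp: K0_def kernel_def)

lemma K0_mult: "X \<otimes>\<^bsub>K0 CI\<^esub> Y = X \<otimes>\<^bsub>K0_unital (unitize CI)\<^esub> Y"
  by (simp add: K0_def)

end

section \<open>The isomorphism\<close>

context pascal_limit begin

lemma g_01: "p \<in> projs UNIV \<Longrightarrow> of_int (g p (0, 1)) = mtrace chi p"
  using of_int_g[of p 1 0] mt_last[of 0 p] by simp

lemma g_zero: "g (0\<^sub>m 0 0) i = 0"
  by (simp add: g_def mt_def mtrace_def case_prod_beta)

text \<open>Entries in the ideal are killed by \<open>chi\<close>, so the class lies in the kernel;
  the empty second component contributes nothing to the invariant.\<close>

lemma K0_class_value:
  assumes p: "p \<in> projs CI"
  shows "K0_class CI p \<in> carrier (K0 CI)" "inv_value (diff_value gU) (K0_class CI p) = g p"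
proof -
  interpret KU: invariant_quotient "diff_value gU" "projs (unitize CI) \<times> projs (unitize CI)" "K0_rel (unitize CI)"
    K0_op "K0_unital (unitize CI)" by (rule KU)
  have hom: "star_hom (\<lambda>a::'a. Unitization a 0)"
    by (simp add: star_hom_def unitization_defs)
  define pU where "pU = map_mat (\<lambda>a. Unitization a 0) p"
  have pU: "pU \<in> projs (unitize CI)"
    unfolding pU_def by (rule map_mat_projs[OF hom _ p]) (auto simp: unitize_def)
  have z: "0\<^sub>m 0 0 \<in> projs (unitize CI)" by (rule zero_in_projs[OF zero_in_unitize])
  have "map_mat phi pU = p" unfolding pU_def by (rule eq_matI) (simp_all add: phi_def)
  moreover have "map_mat phi (0\<^sub>m 0 0) = 0\<^sub>m 0 0" by (rule eq_matI) simp_all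
  ultimately have v: "diff_value gU (pU, 0\<^sub>m 0 0) = g p"
    by (simp add: diff_value_def gU_def g_zero fun_eq_iff)
  have cls: "K0_class CI p = K0_rel (unitize CI) `` {(pU, 0\<^sub>m 0 0)}"
    by (simp add: K0_class_def K0_diff_def pU_def)
  have mem: "(pU, 0\<^sub>m 0 0) \<in> projs (unitize CI) \<times> projs (unitize CI)" using pU z by simp
  show val: "inv_value (diff_value gU) (K0_class CI p) = g p"
    unfolding cls KU.inv_value_cls[OF mem] by (rule v)
  have "p $$ (i, i) \<in> CI" if "i < dim_row p" for i
    using p that by (auto simp: projs_def elements_mat_subset_iff)
  then have "mtrace chi p = 0" by (simp add: mtrace_def limit_ideal_eq_kernel)
  then have "g p (0, 1) = 0" using g_01[of p] p projs_mono[of CI UNIV] by auto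
  then show "K0_class CI p \<in> carrier (K0 CI)"
    unfolding K0_carrier val using KU.cls_in_carrier[OF mem] cls by simp
qed

text \<open>Both projections representing \<open>X\<close> are moved to one floor \<open>n\<close>.
  Their trace differences at \<open>k < 2 ^ n\<close> become the coefficients, and at
  \<open>2 ^ n\<close> the difference is 0 because \<open>X\<close> lies in the kernel.\<close>

lemma K0_value_is_coeffs:
  assumes X: "X \<in> carrier (K0 CI)"
  shows "\<exists>Y\<in>carrier (dirlim P_group beta). inv_value coeffs Y = inv_value (diff_value gU) X"
proof -
  interpret KU: invariant_quotient "diff_value gU" "projs (unitize CI) \<times> projs (unitize CI)" "K0_rel (unitize CI)"
    K0_op "K0_unital (unitize CI)" by (rule KU)
  have XU: "X \<in> carrier (K0_unital (unitize CI))" and X0: "inv_value (diff_value gU) X (0, 1) = 0"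
    using X by (auto simp: K0_carrier)
  obtain a where a: "a \<in> projs (unitize CI) \<times> projs (unitize CI)" "X = K0_rel (unitize CI) `` {a}"
    using XU by (rule KU.carrierE)
  define p r where "p = map_mat phi (fst a)" and "r = map_mat phi (snd a)"
  have pr: "p \<in> projs UNIV" "r \<in> projs UNIV" using a(1) by (auto simp: p_def r_def intro!: phi_projs)
  have val: "inv_value (diff_value gU) X = (\<lambda>i. g p i - g r i)"
    unfolding a(2) KU.inv_value_cls[OF a(1)] by (simp add: diff_value_def gU_def p_def r_def fun_eq_iff)
  obtain n0 r' where n0: "r' \<in> projs (B n0)" "mvn UNIV r r'" using stageE[OF pr(2)] by metis
  obtain n p' where n: "n0 \<le> n" "p' \<in> projs (B n)" "mvn UNIV p p'" using stageE[OF pr(1)] .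
  have r': "r' \<in> projs (B n)" using projs_mono[OF B_mono[OF n(1)]] n0 by auto
  have U: "p' \<in> projs UNIV" "r' \<in> projs UNIV" using n r' projs_mono[of "B n" UNIV] by auto
  have g: "g p = g p'" "g r = g r'"
    using mvn_iff_g[OF pr(1) U(1)] mvn_iff_g[OF pr(2) U(2)] n n0 by auto
  define x where "x = (\<Sum>k<2 ^ n. of_int (g p' (n, k) - g r' (n, k)) * p_poly n k)"
  have x: "x \<in> carrier (P_group n)" by (auto simp: x_def P_group_def simp del: of_int_diff)
  have lx: "Poly_Mapping.lookup x (int k) = (if k < 2 ^ n then g p' (n, k) - g r' (n, k) else 0)" for k
    unfolding x_def lookup_p_sum by simp
  have "mt n k p' - mt n k r' = of_int (Poly_Mapping.lookup x (int k))" if k: "k \<le> 2 ^ n" for k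
  proof (cases "k = 2 ^ n")
    case True
    have "mt n k p' - mt n k r' = of_int (g p' (0, 1) - g r' (0, 1))"
      using g_01[OF U(1)] g_01[OF U(2)] by (simp add: True mt_last)
    also have "\<dots> = 0" using X0 unfolding val g by simp
    finally show ?thesis using True by (simp only: lx) simp
  next
    case False
    then show ?thesis
      using k of_int_g[OF U(1) k] of_int_g[OF U(2) k] by (simp add: lx)
  qed
  then have "inv_value (diff_value gU) X = coeffs (n, x)"
    using g_diff_eq_coeffs[OF n(2) r' x] unfolding val g by simp
  moreover have m: "(n, x) \<in> (SIGMA n:UNIV. carrier (P_group n))" using x by simp
  ultimately show ?thesis
    using dirlim.inv_value_cls[OF m] dirlim.cls_in_carrier[OF m] by metis
qed

text \<open>Positive and negative parts of the coefficients are natural numbers, hence the traces of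
  two projections on floor \<open>n\<close>, whose formal difference is the class sought. The
  coefficient 0 at \<open>2 ^ n\<close> puts it into the kernel.\<close>

lemma coeffs_is_K0_value:
  assumes Y: "Y \<in> carrier (dirlim P_group beta)"
  shows "\<exists>X\<in>carrier (K0 CI). inv_value (diff_value gU) X = inv_value coeffs Y"
proof -
  interpret KU: invariant_quotient "diff_value gU" "projs (unitize CI) \<times> projs (unitize CI)" "K0_rel (unitize CI)"
    K0_op "K0_unital (unitize CI)" by (rule KU)
  obtain n x where x: "x \<in> carrier (P_group n)" and Y: "Y = dirlim_rel P_group beta `` {(n, x)}"
    using Y by (auto elim!: dirlim.carrierE)
  have val: "inv_value coeffs Y = coeffs (n, x)"
    unfolding Y by (rule dirlim.inv_value_cls) (use x in simp)
  obtain p where p: "p \<in> projs (B n)" "\<forall>k\<le>2 ^ n. mt n k p = of_nat (nat (Poly_Mapping.lookup x (int k)))"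
    using exists_proj_with_traces[of n "\<lambda>k. nat (Poly_Mapping.lookup x (int k))"] by blast
  obtain r where r: "r \<in> projs (B n)" "\<forall>k\<le>2 ^ n. mt n k r = of_nat (nat (- Poly_Mapping.lookup x (int k)))"
    using exists_proj_with_traces[of n "\<lambda>k. nat (- Poly_Mapping.lookup x (int k))"] by blast
  have U: "p \<in> projs UNIV" "r \<in> projs UNIV" using p r projs_mono[of "B n" UNIV] by auto
  have eq: "mt n k p - mt n k r = of_int (Poly_Mapping.lookup x (int k))" if "k \<le> 2 ^ n" for k
    using p(2) r(2) that by (cases "0 \<le> Poly_Mapping.lookup x (int k)") (simp_all add: of_nat_nat)
  have gd: "(\<lambda>i. g p i - g r i) = coeffs (n, x)" by (rule g_diff_eq_coeffs[OF p(1) r(1) x eq])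
  define X where "X = K0_rel (unitize CI) `` {(map_mat psi p, map_mat psi r)}"
  have mem: "(map_mat psi p, map_mat psi r) \<in> projs (unitize CI) \<times> projs (unitize CI)"
    using U by (simp add: psi_projs)
  have valX: "inv_value (diff_value gU) X = coeffs (n, x)"
    unfolding X_def KU.inv_value_cls[OF mem] gd[symmetric] by (simp add: diff_value_def gU_def fun_eq_iff)
  have "Poly_Mapping.lookup x (int (2 ^ n)) = 0" using x by (simp add: P_carrier)
  then have "complex_of_int (g p (0, 1) - g r (0, 1)) = 0"
    using g_01[OF U(1)] g_01[OF U(2)] eq[of "2 ^ n"] by (simp add: mt_last)
  then have "g p (0, 1) - g r (0, 1) = 0" by (simp only: of_int_eq_0_iff)
  then have "coeffs (n, x) (0, 1) = 0" unfolding gd[symmetric] .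
  then have "X \<in> carrier (K0 CI)"
    unfolding K0_carrier valX using KU.cls_in_carrier[OF mem] by (simp add: X_def)
  then show ?thesis using valX val by auto
qed

text \<open>\<open>\<Phi>\<close> sends a class to the unique element of the limit with the same
  invariant. As invariants are additive and injective on both sides, every claim becomes a
  comparison of integer functions.\<close>

theorem K0_limit_ideal:
  "\<exists>\<Phi>. \<Phi> \<in> iso (K0 CI) (dirlim P_group beta) \<and>
      (\<forall>n k e. k < 2 ^ n \<longrightarrow> minimal_projection (\<iota> n ` summand n k) e \<longrightarrow>
         \<Phi> (K0_class CI (mat 1 1 (\<lambda>_. e))) = dirlim_class P_group beta n (p_poly n k)) \<and>
      (\<forall>n. \<forall>p \<in> carrier (P_group n).
         dirlim_class P_group beta n p \<in> \<Phi> ` K0_positive CI \<longleftrightarrow> (\<forall>j. 0 \<le> Poly_Mapping.lookup p j))"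
proof -
  interpret KU: invariant_quotient "diff_value gU" "projs (unitize CI) \<times> projs (unitize CI)" "K0_rel (unitize CI)"
    K0_op "K0_unital (unitize CI)" by (rule KU)
  let ?D = "dirlim P_group beta" and ?h = "inv_value (diff_value gU)" and ?c = "inv_value coeffs"
  obtain \<Phi> where \<Phi>: "\<And>X. X \<in> carrier (K0 CI) \<Longrightarrow> \<Phi> X \<in> carrier ?D" "\<And>X. X \<in> carrier (K0 CI) \<Longrightarrow> ?c (\<Phi> X) = ?h X"
    using K0_value_is_coeffs by metis
  have KUc: "X \<in> carrier (K0_unital (unitize CI))" if "X \<in> carrier (K0 CI)" for X
    using that by (simp add: K0_carrier)
  have \<Phi>_eq: "\<Phi> X = Y" if "X \<in> carrier (K0 CI)" "Y \<in> carrier ?D" "?h X = ?c Y" for X Y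
    by (rule dirlim.inv_value_inj) (use that \<Phi> in auto)
  have mult: "X \<otimes>\<^bsub>K0 CI\<^esub> Y \<in> carrier (K0 CI)" if "X \<in> carrier (K0 CI)" "Y \<in> carrier (K0 CI)" for X Y
    using that by (simp add: K0_carrier K0_mult KU.mult_carrier KU.inv_value_mult)
  have "\<Phi> \<in> hom (K0 CI) ?D"
  proof (rule homI)
    fix X Y assume X: "X \<in> carrier (K0 CI)" and Y: "Y \<in> carrier (K0 CI)"
    show "\<Phi> (X \<otimes>\<^bsub>K0 CI\<^esub> Y) = \<Phi> X \<otimes>\<^bsub>?D\<^esub> \<Phi> Y"
    proof (rule \<Phi>_eq[OF mult[OF X Y]])
      show "\<Phi> X \<otimes>\<^bsub>?D\<^esub> \<Phi> Y \<in> carrier ?D" by (intro dirlim.mult_carrier \<Phi> X Y)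
      show "?h (X \<otimes>\<^bsub>K0 CI\<^esub> Y) = ?c (\<Phi> X \<otimes>\<^bsub>?D\<^esub> \<Phi> Y)"
        using X Y by (simp add: fun_eq_iff K0_mult KU.inv_value_mult KUc dirlim.inv_value_mult \<Phi>)
    qed
  qed (rule \<Phi>)
  moreover have "bij_betw \<Phi> (carrier (K0 CI)) (carrier ?D)"
  proof (rule bij_betw_imageI)
    show "inj_on \<Phi> (carrier (K0 CI))"
      by (rule inj_onI) (metis KU.inv_value_inj KUc \<Phi>(2))
    show "\<Phi> ` carrier (K0 CI) = carrier ?D"
    proof (intro equalityI subsetI)
      fix Y assume Y: "Y \<in> carrier ?D"
      obtain X where "X \<in> carrier (K0 CI)" "?h X = ?c Y" using coeffs_is_K0_value[OF Y] by blast
      then show "Y \<in> \<Phi> ` carrier (K0 CI)" using \<Phi>_eq[of X Y] Y by blast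
    qed (use \<Phi> in auto)
  qed
  ultimately have "\<Phi> \<in> iso (K0 CI) ?D" by (simp add: iso_def)
  moreover have cls: "dirlim_class P_group beta n x \<in> carrier ?D" "?c (dirlim_class P_group beta n x) = coeffs (n, x)"
    if "x \<in> carrier (P_group n)" for n x
    unfolding dirlim_class_def using that by (intro dirlim.cls_in_carrier dirlim.inv_value_cls; simp)+
  have "\<Phi> (K0_class CI (mat 1 1 (\<lambda>_. e))) = dirlim_class P_group beta n (p_poly n k)"
    if k: "k < 2 ^ n" and e: "minimal_projection (\<iota> n ` summand n k) e" for n k e
  proof -
    have k': "k \<le> 2 ^ n" using k by simp
    have eB: "e \<in> B n" and ez: "comp n e (2 ^ n) = 0\<^sub>m (q n (2 ^ n)) (q n (2 ^ n))" and pe: "is_projection e"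
      using e k by (auto simp: minimal_projection_def iota_summand)
    have "e \<in> CI" using ez by (simp add: limit_ideal_eq_kernel chi_level[OF eB] q_last)
    then have p: "mat 1 1 (\<lambda>_. e) \<in> projs CI" by (rule mat11_in_projs[OF pe])
    have pB: "mat 1 1 (\<lambda>_. e) \<in> projs (B n)" by (rule mat11_in_projs[OF pe eB])
    have l: "Poly_Mapping.lookup (p_poly n k) j = (if k = nat \<bar>j\<bar> then 1 else 0)" for j
      using lookup_p_poly[of 1 n k j] by simp
    have z: "mt n j (0\<^sub>m 0 0) = 0" for j by (simp add: mt_def mtrace_def)
    \<comment> \<open>A single projection is the difference with the empty one. Its traces on floor
      \<open>n\<close> are 1 at \<open>k\<close> and 0 elsewhere, as are the coefficients of
      \<open>p_poly n k\<close> at nonnegative exponents.\<close>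
    have "(\<lambda>i. g (mat 1 1 (\<lambda>_. e)) i - g (0\<^sub>m 0 0) i) = coeffs (n, p_poly n k)"
      by (rule g_diff_eq_coeffs[OF pB zero_in_projs[OF B_zero] p_poly_in_P[OF k]])
        (auto simp: mt_minimal_projection[OF e k'] z l simp del: One_nat_def)
    then have "g (mat 1 1 (\<lambda>_. e)) = coeffs (n, p_poly n k)" by (simp add: g_zero)
    then show ?thesis
      using K0_class_value[OF p] cls[OF p_poly_in_P[OF k]] by (intro \<Phi>_eq) auto
  qed
  moreover have "dirlim_class P_group beta n x \<in> \<Phi> ` K0_positive CI \<longleftrightarrow> (\<forall>j. 0 \<le> Poly_Mapping.lookup x j)"
    if x: "x \<in> carrier (P_group n)" for n x
  proof
    assume "dirlim_class P_group beta n x \<in> \<Phi> ` K0_positive CI"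
    then obtain p where p: "p \<in> projs CI" "dirlim_class P_group beta n x = \<Phi> (K0_class CI p)"
      by (auto simp: K0_positive_def)
    have "coeffs (n, x) = g p"
      using cls(2)[OF x] \<Phi>(2)[OF K0_class_value(1)[OF p(1)]] K0_class_value(2)[OF p(1)] p(2) by simp
    moreover have "p \<in> projs UNIV" using p(1) projs_mono[of CI UNIV] by auto
    ultimately have "\<forall>i. 0 \<le> coeffs (n, x) i" by (simp add: g_nonneg)
    then show "\<forall>j. 0 \<le> Poly_Mapping.lookup x j" using coeffs_nonneg_iff[OF x] by blast
  next
    assume pos: "\<forall>j. 0 \<le> Poly_Mapping.lookup x j"
    obtain p where p: "p \<in> projs (B n)" "\<forall>k\<le>2 ^ n. mt n k p = of_nat (nat (Poly_Mapping.lookup x (int k)))"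
      using exists_proj_with_traces[of n "\<lambda>k. nat (Poly_Mapping.lookup x (int k))"] by blast
    obtain N where N: "p \<in> carrier_mat N N" using p(1) by (rule projsE)
    have "Poly_Mapping.lookup x (int (2 ^ n)) = 0" using x by (simp add: P_carrier)
    then have z: "mt n (2 ^ n) p = 0" using p(2) by simp
    \<comment> \<open>Trace 0 at the last vertex makes that block of every entry vanish, so
      \<open>p\<close> is a projection over the ideal itself and its class lies in the positive
      cone.\<close>
    have "p $$ (i, j) \<in> CI" if "i < N" "j < N" for i j
    proof -
      have "p $$ (i, j) \<in> B n" using p(1) N that by (auto simp: projs_def elements_mat_subset_iff)
      then show ?thesis
        using mt_zero_imp[OF p(1) N _ z that] by (simp add: limit_ideal_eq_kernel chi_level[of _ n] q_last)
    qed
    then have pC: "p \<in> projs CI" using p(1) N by (auto simp: projs_def elements_mat_subset_iff)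
    have z0: "mt n k (0\<^sub>m 0 0) = 0" for k by (simp add: mt_def mtrace_def)
    have "(\<lambda>i. g p i - g (0\<^sub>m 0 0) i) = coeffs (n, x)"
      by (rule g_diff_eq_coeffs[OF p(1) zero_in_projs[OF B_zero] x]) (simp add: p z0 pos of_nat_nat)
    then have "g p = coeffs (n, x)" by (simp add: g_zero)
    then have "\<Phi> (K0_class CI p) = dirlim_class P_group beta n x"
      using K0_class_value[OF pC] cls[OF x] by (intro \<Phi>_eq) auto
    then show "dirlim_class P_group beta n x \<in> \<Phi> ` K0_positive CI"
      using pC unfolding K0_positive_def by blast
  qed
  ultimately show ?thesis by blast
qed

end

theorem mainTheorem4:
  fixes \<iota> :: "nat \<Rightarrow> (nat \<Rightarrow> complex mat) \<Rightarrow> 'a::{cstar_algebra, real_normed_algebra_1}"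
    and C :: "'a set"
  assumes limit: "pascal_limit \<iota>"
    and C_def: "C = limit_ideal \<iota>"
  shows "closed_ideal C \<and> codimension_one C \<and>
    (\<forall>n. beta n \<in> hom (P_group n) (P_group (Suc n)) \<and> inj_on (beta n) (carrier (P_group n))) \<and>
    (\<exists>\<Phi>. \<Phi> \<in> iso (K0 C) (dirlim P_group beta) \<and>
      (\<forall>n k e. k < 2 ^ n \<longrightarrow> minimal_projection (\<iota> n ` summand n k) e \<longrightarrow>
         \<Phi> (K0_class C (mat 1 1 (\<lambda>_. e))) = dirlim_class P_group beta n (p_poly n k)) \<and>
      (\<forall>n. \<forall>p \<in> carrier (P_group n).
         dirlim_class P_group beta n p \<in> \<Phi> ` K0_positive C \<longleftrightarrow> (\<forall>j. 0 \<le> Poly_Mapping.lookup p j)))"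
proof -
  interpret pascal_limit \<iota> by (rule limit)
  show ?thesis
    unfolding C_def using closed_ideal_limit_ideal codimension_one_limit_ideal K0_limit_ideal beta_hom
    by (auto intro: inj_onI dest: beta_inj)
qed

end
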